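(* Let $\vartheta\in(0,\pi/2]$, $\Theta:=\sin\vartheta$, and let $\gamma\subset\mathbb{S}^2$ be a closed spherical curve with thickness $\triangle[\gamma]\ge\Theta$ whose spherical tubular neighbourhood $\mathcal{T}_\vartheta(\gamma)=\{\xi\in\mathbb{S}^2:\mathrm{dist}_{\mathbb{S}^2}(\gamma,\xi)<\vartheta\}$ satisfies $$\mathrm{area}(\mathcal{T}_\vartheta(\gamma))=4\pi=\mathrm{area}(\mathbb{S}^2).$$ Then there exist a positive integer $n$ and $k\in\{0,\dots,n-1\}$ with $\gcd(k,n)=1$ such that $\vartheta=\vartheta_n:=\frac{\pi}{2n}$, $\triangle[\gamma]=\Theta_n:=\sin\vartheta_n$, and $\gamma$ coincides, up to congruence, with $\gamma_{n,k}$, i.e. with one of the $\varphi(n)$ explicit curves $\gamma_{n,k}$ described in the context.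
   Context: $\mathbb{S}^2=\{x\in\mathbb{R}^3:|x|=1\}$, with intrinsic (geodesic) distance $\mathrm{dist}_{\mathbb{S}^2}$; $\mathrm{dist}_{\mathbb{S}^2}(\gamma,\xi)=\inf_{p\in\gamma}\mathrm{dist}_{\mathbb{S}^2}(p,\xi)$. All curves are assumed to be simple, of positive length, and continuously differentiable (regular, e.g. in arclength parametrization); a closed curve is a map $\gamma:\mathbb{S}^1\cong\mathbb{R}/(2\pi\mathbb{Z})\to\mathbb{S}^2$ and is identified with its image when convenient. Thickness: for a curve $\gamma\subset\mathbb{R}^3$, $\triangle[\gamma]:=\inf R(x,y,z)$, the infimum taken over all triples of pairwise distinct points $x,y,z\in\gamma$, where $R(x,y,z)$ is the radius of the circumcircle of $x,y,z$ ($R=\infty$ for collinear points). Construction of $\gamma_{n,k}$ for a positive integer $n$ and $k\in\{0,\dots,n-1\}$ with $\gcd(k,n)=1$: put $\vartheta_n=\pi/(2n)$, let $e_1,e_2,e_3$ be the standard basis of $\mathbb{R}^3$ and let $e_3$ be the north pole. For $i=0,\dots,n-1$ let $C_i=\{x\in\mathbb{S}^2:\mathrm{dist}_{\mathbb{S}^2}(x,e_3)=(2i+1)\vartheta_n\}$. Let $\mathbb{S}^w=\{x\in\mathbb{S}^2:x_1\le 0\}$ and $\mathbb{S}^e=\{x\in\mathbb{S}^2:x_1\ge 0\}$ be the closed western and eastern hemispheres, and let $\rho_\alpha$ be the rotation of $\mathbb{R}^3$ about the $e_1$-axis by the angle $\alpha$ (with a fixed sense of rotation). Then $$\gamma_{n,k}:=\Big(\mathbb{S}^w\cap\bigcup_{i=0}^{n-1}C_i\Big)\cup\rho_{2k\vartheta_n}\Big(\mathbb{S}^e\cap\bigcup_{i=0}^{n-1}C_i\Big).$$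 Each such $\gamma_{n,k}$ is a closed curve solving Problem (P) for thickness $\Theta_n=\sin(\pi/2n)$, i.e. it has maximal length among all closed curves on $\mathbb{S}^2$ with thickness at least $\Theta_n$. $\varphi$ is Euler's totient function: $\varphi(n)$ is the number of integers $0\le k<n$ with $\gcd(k,n)=1$ (with $\gcd(0,n)=n$). Two subsets of $\mathbb{S}^2$ are congruent if one is the image of the other under a rotation in $SO(3)$. *)

theory Defs
  imports "HOL-Analysis.Analysis"
begin

definition sphere_dist :: "real^3 \<Rightarrow> real^3 \<Rightarrow> real" where
  "sphere_dist x y = arccos (x \<bullet> y)"

definition sphere_setdist :: "(real^3) set \<Rightarrow> real^3 \<Rightarrow> real" where
  "sphere_setdist A \<xi> = (INF p\<in>A. sphere_dist p \<xi>)"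

definition spherical_tube :: "real \<Rightarrow> (real^3) set \<Rightarrow> (real^3) set" where
  "spherical_tube \<theta> A = {\<xi> \<in> sphere 0 1. sphere_setdist A \<xi> < \<theta>}"

text \<open>The surface measure on the unit sphere, obtained from the Lebesgue measure by polar
  coordinates: the solid cone over a set of area \<open>a\<close> has volume \<open>a / 3\<close>.\<close>

definition sphere_area :: "(real^3) set \<Rightarrow> real" where
  "sphere_area A = 3 * measure lebesgue {t *\<^sub>R x | t x. 0 \<le> t \<and> t \<le> 1 \<and> x \<in> A}"

lemma sphere_area_sphere: "sphere_area (sphere 0 1) = 4 * pi"
proof -
  have "y \<in> {t *\<^sub>R x | t x. 0 \<le> t \<and> t \<le> 1 \<and> x \<in> sphere (0::real^3) 1}" if "norm y \<le> 1" for y :: "real^3"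
  proof (cases "y = 0")
    case True
    have "y = 0 *\<^sub>R axis 1 1 \<and> (0::real) \<le> 0 \<and> (0::real) \<le> 1 \<and> axis 1 1 \<in> sphere (0::real^3) 1"
      using True by (simp add: norm_axis_1)
    then show ?thesis by blast
  next
    case False
    then have "y = norm y *\<^sub>R (y /\<^sub>R norm y) \<and> 0 \<le> norm y \<and> norm y \<le> 1 \<and> y /\<^sub>R norm y \<in> sphere 0 1"
      using that by simp
    then show ?thesis by blast
  qed
  then have "{t *\<^sub>R x | t x. 0 \<le> t \<and> t \<le> 1 \<and> x \<in> sphere (0::real^3) 1} = cball 0 1"
    by auto
  then show ?thesis
    by (simp add: sphere_area_def content_cball unit_ball_vol_3)
qed

definition circumradius :: "real^3 \<Rightarrow> real^3 \<Rightarrow> real^3 \<Rightarrow> ereal" where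
  "circumradius x y z =
     (if collinear {x, y, z} then \<infinity>
      else ereal (THE r. \<exists>c \<in> affine hull {x, y, z}. dist c x = r \<and> dist c y = r \<and> dist c z = r))"

lemma circumradius_unique:
  fixes x y z :: "real^3"
  assumes "\<not> collinear {x, y, z}"
  shows "\<exists>!r. \<exists>c \<in> affine hull {x, y, z}. dist c x = r \<and> dist c y = r \<and> dist c z = r"
proof -
  define a where "a = y - x"
  define b where "b = z - x"
  define A where "A = a \<bullet> a"
  define B where "B = b \<bullet> b"
  define m where "m = a \<bullet> b"
  define D where "D = A * B - m\<^sup>2"
  have hull: "c \<in> affine hull {x, y, z} \<longleftrightarrow> (\<exists>s t. c = x + s *\<^sub>R a + t *\<^sub>R b)" for c
  proof -
    have "u *\<^sub>R x + v *\<^sub>R y + w *\<^sub>R z = x + v *\<^sub>R a + w *\<^sub>R b" if "u + v + w = 1" for u v w :: real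
    proof -
      have "u = 1 - v - w" using that by simp
      then show ?thesis
        by (simp only: a_def b_def scaleR_diff_left scaleR_diff_right scaleR_one) simp
    qed
    moreover have "(1 - s - t) + s + t = 1" for s t :: real by simp
    ultimately show ?thesis
      unfolding affine_hull_3 mem_Collect_eq by metis
  qed
  have ncol: "\<not> collinear {0, a, b}"
    using assms collinear_3[of y x z] by (simp add: a_def b_def insert_commute)
  have "\<bar>m\<bar> \<noteq> norm a * norm b"
    using ncol norm_cauchy_schwarz_equal[of a b] by (simp add: m_def)
  moreover have "\<bar>m\<bar> \<le> norm a * norm b"
    by (simp add: m_def Cauchy_Schwarz_ineq2)
  ultimately have "\<bar>m\<bar>\<^sup>2 < (norm a * norm b)\<^sup>2"
    by (intro power_strict_mono) auto
  then have D: "D > 0"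
    by (simp add: D_def A_def B_def power_mult_distrib dot_square_norm)
  have eqd: "(dist (x + s *\<^sub>R a + t *\<^sub>R b) y = dist (x + s *\<^sub>R a + t *\<^sub>R b) x \<longleftrightarrow> s * A + t * m = A / 2)"
    "(dist (x + s *\<^sub>R a + t *\<^sub>R b) z = dist (x + s *\<^sub>R a + t *\<^sub>R b) x \<longleftrightarrow> s * m + t * B = B / 2)" for s t
  proof -
    have *: "dist (x + p) (x + d) = dist (x + p) x \<longleftrightarrow> p \<bullet> d = d \<bullet> d / 2" for p d :: "real^3"
    proof -
      have "dist (x + p) (x + d) = dist (x + p) x \<longleftrightarrow> norm (p - d) = norm p"
        by (simp add: dist_norm)
      also have "\<dots> \<longleftrightarrow> (p - d) \<bullet> (p - d) = p \<bullet> p"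
        by (simp add: norm_eq)
      also have "\<dots> \<longleftrightarrow> p \<bullet> d = d \<bullet> d / 2"
        by (auto simp: inner_diff inner_commute)
      finally show ?thesis .
    qed
    have y: "x + a = y" and z: "x + b = z"
      by (simp_all add: a_def b_def)
    have p: "(s *\<^sub>R a + t *\<^sub>R b) \<bullet> a = s * A + t * m" "(s *\<^sub>R a + t *\<^sub>R b) \<bullet> b = s * m + t * B"
      by (simp_all add: A_def B_def m_def inner_add_left inner_commute[of b a])
    show "(dist (x + s *\<^sub>R a + t *\<^sub>R b) y = dist (x + s *\<^sub>R a + t *\<^sub>R b) x \<longleftrightarrow> s * A + t * m = A / 2)"
      using *[of "s *\<^sub>R a + t *\<^sub>R b" a] unfolding p y add.assoc A_def[symmetric] .
    show "(dist (x + s *\<^sub>R a + t *\<^sub>R b) z = dist (x + s *\<^sub>R a + t *\<^sub>R b) x \<longleftrightarrow> s * m + t * B = B / 2)"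
      using *[of "s *\<^sub>R a + t *\<^sub>R b" b] unfolding p z add.assoc B_def[symmetric] .
  qed
  define s0 where "s0 = B * (A - m) / (2 * D)"
  define t0 where "t0 = A * (B - m) / (2 * D)"
  have sol: "s * A + t * m = A / 2 \<and> s * m + t * B = B / 2 \<longleftrightarrow> s = s0 \<and> t = t0" for s t
  proof
    assume h: "s * A + t * m = A / 2 \<and> s * m + t * B = B / 2"
    have "s * D = (s * A + t * m) * B - (s * m + t * B) * m"
      "t * D = (s * m + t * B) * A - (s * A + t * m) * m"
      by (simp_all add: D_def algebra_simps power2_eq_square)
    then have "s * D = A / 2 * B - B / 2 * m" "t * D = B / 2 * A - A / 2 * m"
      using h by simp_all
    then show "s = s0 \<and> t = t0"
      using D by (simp add: s0_def t0_def field_simps)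
  next
    assume h: "s = s0 \<and> t = t0"
    have "2 * D * (s0 * A + t0 * m) = B * (A - m) * A + A * (B - m) * m"
      "2 * D * (s0 * m + t0 * B) = B * (A - m) * m + A * (B - m) * B"
      using D by (simp_all add: s0_def t0_def field_simps)
    then have "2 * D * (s0 * A + t0 * m) = 2 * D * (A / 2)"
      "2 * D * (s0 * m + t0 * B) = 2 * D * (B / 2)"
      by (simp_all add: D_def algebra_simps power2_eq_square)
    then show "s * A + t * m = A / 2 \<and> s * m + t * B = B / 2"
      using D h by simp
  qed
  have "(\<exists>c \<in> affine hull {x, y, z}. dist c x = r \<and> dist c y = r \<and> dist c z = r)
      \<longleftrightarrow> r = dist (x + s0 *\<^sub>R a + t0 *\<^sub>R b) x" for r
    using eqd sol hull by metis
  then show ?thesis by simp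
qed

definition thickness :: "(real^3) set \<Rightarrow> ereal" where
  "thickness A =
     Inf {circumradius x y z | x y z. x \<in> A \<and> y \<in> A \<and> z \<in> A \<and> x \<noteq> y \<and> y \<noteq> z \<and> z \<noteq> x}"

text \<open>Simple, regular, continuously differentiable maps from the circle to the unit sphere; a map on
  the circle is given as a \<open>2\<pi>\<close>-periodic function on the reals. A regular curve has positive
  length.\<close>

definition closed_spherical_curve :: "(real \<Rightarrow> real^3) \<Rightarrow> bool" where
  "closed_spherical_curve \<gamma> \<longleftrightarrow>
     (\<forall>t. \<gamma> (t + 2 * pi) = \<gamma> t) \<and>
     inj_on \<gamma> {0..<2 * pi} \<and>
     \<gamma> C1_differentiable_on UNIV \<and>
     (\<forall>t. vector_derivative \<gamma> (at t) \<noteq> 0) \<and>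
     range \<gamma> \<subseteq> sphere 0 1"

definition latitude_circle :: "nat \<Rightarrow> nat \<Rightarrow> (real^3) set" where
  "latitude_circle n i =
     {x \<in> sphere 0 1. sphere_dist x (axis 3 1) = (2 * real i + 1) * (pi / (2 * real n))}"

definition west_hemisphere :: "(real^3) set" where
  "west_hemisphere = {x \<in> sphere 0 1. x $ 1 \<le> 0}"

definition east_hemisphere :: "(real^3) set" where
  "east_hemisphere = {x \<in> sphere 0 1. x $ 1 \<ge> 0}"

definition rot_e1 :: "real \<Rightarrow> real^3 \<Rightarrow> real^3" where
  "rot_e1 \<alpha> x =
     vector [x $ 1, cos \<alpha> * x $ 2 - sin \<alpha> * x $ 3, sin \<alpha> * x $ 2 + cos \<alpha> * x $ 3]"

definition gamma_curve :: "nat \<Rightarrow> nat \<Rightarrow> (real^3) set" where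
  "gamma_curve n k =
     (west_hemisphere \<inter> (\<Union>i<n. latitude_circle n i)) \<union>
     rot_e1 (2 * real k * (pi / (2 * real n))) `
       (east_hemisphere \<inter> (\<Union>i<n. latitude_circle n i))"

definition sphere_congruent :: "(real^3) set \<Rightarrow> (real^3) set \<Rightarrow> bool" where
  "sphere_congruent A B \<longleftrightarrow> (\<exists>Q :: real^3^3. rotation_matrix Q \<and> A = (\<lambda>x. Q *v x) ` B)"

end

theory Submission
  imports Defs
begin

text \<open>
  Thickness at least \<open>sin \<theta>\<close> means that the two balls of radius \<open>\<theta>\<close> touching the curve at a point
  contain no further curve point; full area means that no such ball can be pushed off the curve. Hence
  the contact points of a touching ball do not lie in an open half circle. A contact point
  ahead blocks the motion of the touching ball, so either the point opposite to the foot point is on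
  the curve as well, or (for \<open>\<theta> < \<pi>/2\<close>) the curve runs through exactly a closed half circle of the
  boundary of the ball. Half circles propagate to concentric half circles, which fill a whole
  hemisphere and force \<open>2 n \<theta> = \<pi>\<close>. If, starting from some point, one meets only antipodal contacts,
  touching balls line up along a normal great circle; two different such great circles violate the
  thickness bound near their intersection. So some half circle exists, and since the boundary of
  its hemisphere is already such a great circle, a second one exists in the opposite hemisphere.
\<close>

text \<open>The curve is only C1, so the centres of its touching balls depend continuously, but in
  general not differentiably, on the parameter; their motion is studied through normalised
  increments and compactness. A blocked ball rests while the curve runs along its boundary, and the
  two ends of a nontrivial maximal interval of rest turn out to be antipodal: this is why half
  circles, and no other arcs, occur. The concentric family about a pole has to fit exactly up to the
  antipode of the pole, whence 2 n \<theta> = pi. The poles of the two hemispheres lie on the common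
  boundary circle and differ by an even multiple of \<theta>, which yields k. Coprimality comes from
  connectedness of the curve, and the upper bound for the thickness from three points of the
  smallest half circle, whose circumradius is sin \<theta>. For \<theta> = pi / 2 the touching balls
  are hemispheres and the curve is a great circle; this case is separate because the balls about c
  and - c then share their boundary.\<close>

unbundle cross3_syntax

subsection \<open>Orthonormal frames\<close>

lemma frame_expand:
  fixes a b x :: "real^3"
  assumes "norm a = 1" "norm b = 1" "a \<bullet> b = 0"
  shows "x = (x \<bullet> a) *\<^sub>R a + (x \<bullet> b) *\<^sub>R b + (x \<bullet> (a \<times> b)) *\<^sub>R (a \<times> b)"
proof -
  define N where "N = a \<times> b"
  define y where "y = x - (x \<bullet> a) *\<^sub>R a - (x \<bullet> b) *\<^sub>R b - (x \<bullet> N) *\<^sub>R N"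
  have aa: "a \<bullet> a = 1" "b \<bullet> b = 1"
    using assms by (simp_all add: norm_eq_1)
  have "(norm N)\<^sup>2 = 1"
    unfolding N_def norm_cross using assms by simp
  then have NN: "N \<bullet> N = 1"
    by (simp add: power2_norm_eq_inner)
  have Nab: "N \<bullet> a = 0" "N \<bullet> b = 0" "a \<bullet> N = 0" "b \<bullet> N = 0"
    by (simp_all add: N_def dot_cross_self)
  have ya: "y \<bullet> a = 0" "y \<bullet> b = 0" "y \<bullet> N = 0"
    using assms aa NN Nab by (simp_all add: y_def inner_diff_left inner_commute[of b a])
  \<comment> \<open>A vector orthogonal to \<open>a\<close> and \<open>b\<close> is parallel to
    their cross product; being orthogonal to that as well, it vanishes.\<close>
  have "y \<times> N = 0"
    unfolding N_def Lagrange using ya by simp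
  then have "y = 0"
    using norm_and_cross_eq_0[of y N] ya NN by auto
  then show ?thesis
    by (simp add: y_def N_def algebra_simps)
qed

lemma frame_inner:
  fixes a b x y :: "real^3"
  assumes "norm a = 1" "norm b = 1" "a \<bullet> b = 0"
  shows "x \<bullet> y = (x \<bullet> a) * (y \<bullet> a) + (x \<bullet> b) * (y \<bullet> b) + (x \<bullet> (a \<times> b)) * (y \<bullet> (a \<times> b))"
proof -
  have "x \<bullet> y = ((x \<bullet> a) *\<^sub>R a + (x \<bullet> b) *\<^sub>R b + (x \<bullet> (a \<times> b)) *\<^sub>R (a \<times> b)) \<bullet> y"
    using arg_cong[OF frame_expand[OF assms, of x], of "\<lambda>z. z \<bullet> y"] .
  then show ?thesis
    unfolding inner_add_left inner_scaleR_left by (simp only: inner_commute[of _ y])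
qed

lemma norm_cross_orthonormal:
  fixes a b :: "real^3"
  assumes "norm a = 1" "norm b = 1" "a \<bullet> b = 0"
  shows "norm (a \<times> b) = 1"
proof -
  have "(norm (a \<times> b))\<^sup>2 = 1"
    unfolding norm_cross using assms by simp
  then show ?thesis
    using power2_eq_1_iff[of "norm (a \<times> b)"] norm_ge_zero[of "a \<times> b"] by linarith
qed

lemma perp_plane_expand:
  fixes a b x :: "real^3"
  assumes "norm a = 1" "norm b = 1" "a \<bullet> b = 0" "x \<bullet> a = 0" "x \<bullet> b = 0"
  shows "x = (x \<bullet> (a \<times> b)) *\<^sub>R (a \<times> b)"
  using frame_expand[OF assms(1-3), of x] unfolding assms(4,5) scaleR_zero_left add_0 .

lemma perp_plane_unit:
  fixes a b x :: "real^3"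
  assumes "norm a = 1" "norm b = 1" "a \<bullet> b = 0" "x \<bullet> a = 0" "x \<bullet> b = 0" "norm x = 1"
  shows "x = a \<times> b \<or> x = - (a \<times> b)"
proof -
  have e: "x = (x \<bullet> (a \<times> b)) *\<^sub>R (a \<times> b)"
    using perp_plane_expand assms by blast
  then have "norm x = \<bar>x \<bullet> (a \<times> b)\<bar> * norm (a \<times> b)"
    by (metis norm_scaleR)
  then have "\<bar>x \<bullet> (a \<times> b)\<bar> = 1"
    using norm_cross_orthonormal assms by auto
  then have "x \<bullet> (a \<times> b) = 1 \<or> x \<bullet> (a \<times> b) = -1"
    by linarith
  then show ?thesis
    using e by (metis scaleR_minus1_left scaleR_one)
qed

lemma abs_inner_unit:
  fixes x y :: "real^3"
  assumes "norm x = 1" "norm y = 1" "\<bar>x \<bullet> y\<bar> \<ge> 1"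
  shows "x = y \<or> x = - y"
proof -
  have "\<bar>x \<bullet> y\<bar> = 1"
    using Cauchy_Schwarz_ineq2[of x y] assms by simp
  then consider "x \<bullet> y = 1" | "x \<bullet> y = - 1" by linarith
  then show ?thesis
  proof cases
    case 1
    then have "(x - y) \<bullet> (x - y) = 0"
      using assms by (simp add: inner_diff inner_commute norm_eq_1)
    then show ?thesis by simp
  next
    case 2
    then have "(x + y) \<bullet> (x + y) = 0"
      using assms by (simp add: inner_add inner_commute norm_eq_1)
    then show ?thesis by (simp add: eq_neg_iff_add_eq_0)
  qed
qed

subsection \<open>Thickness and area\<close>

text \<open>The squared circumradius of three points of the unit sphere is 1 minus the squared
  distance from the origin to their plane, so a circumradius of at least sin \<theta> bounds that
  distance by cos \<theta>. Multiplying by the squared length of the normal \<open>N\<close> avoids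
  a division and lets the bound pass to tangent planes.\<close>

lemma thick_plane:
  fixes x y z :: "real^3"
  assumes th: "thickness A \<ge> ereal (sin \<theta>)" "0 < \<theta>" "\<theta> \<le> pi / 2"
    and xyz: "x \<in> A" "y \<in> A" "z \<in> A" "x \<noteq> y" "y \<noteq> z" "z \<noteq> x"
    and unit: "norm x = 1" "norm y = 1" "norm z = 1"
  defines "N \<equiv> (y - x) \<times> (z - x)"
  shows "(x \<bullet> N)\<^sup>2 \<le> (cos \<theta>)\<^sup>2 * (N \<bullet> N)"
proof (cases "collinear {x, y, z}")
  case True
  then have "collinear {0, y - x, z - x}"
    using collinear_3[of y x z] by (simp add: insert_commute)
  then have "N = 0"
    by (simp add: N_def cross_eq_0)
  then show ?thesis by simp
next
  case False
  have "ereal (sin \<theta>) \<le> circumradius x y z"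
    by (rule order_trans[OF th(1)]) (unfold thickness_def, rule Inf_lower, use xyz in blast)
  then have le: "sin \<theta> \<le> (THE r. \<exists>c \<in> affine hull {x, y, z}. dist c x = r \<and> dist c y = r \<and> dist c z = r)"
    using False by (simp add: circumradius_def)
  obtain r c where c: "c \<in> affine hull {x, y, z}" "dist c x = r" "dist c y = r" "dist c z = r"
    using circumradius_unique[OF False] by blast
  have "(THE r. \<exists>c \<in> affine hull {x, y, z}. dist c x = r \<and> dist c y = r \<and> dist c z = r) = r"
    using circumradius_unique[OF False] c by (intro the1_equality) blast+
  then have r: "sin \<theta> \<le> r"
    using le by simp
  have sq: "r\<^sup>2 = c \<bullet> c - 2 * (c \<bullet> p) + 1" if "dist c p = r" "norm p = 1" for p
  proof -
    have "r\<^sup>2 = (c - p) \<bullet> (c - p)"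
      unfolding that(1)[symmetric] dist_norm power2_norm_eq_inner ..
    moreover have "p \<bullet> p = 1"
      using that by (simp add: norm_eq_1)
    ultimately show ?thesis
      by (simp add: inner_diff inner_commute)
  qed
  have cy: "c \<bullet> y = c \<bullet> x" and cz: "c \<bullet> z = c \<bullet> x"
    using sq[OF c(2) unit(1)] sq[OF c(3) unit(2)] sq[OF c(4) unit(3)] by linarith+
  obtain u v w where uvw: "c = u *\<^sub>R x + v *\<^sub>R y + w *\<^sub>R z" "u + v + w = 1"
    using c(1) unfolding affine_hull_3 by blast
  \<comment> \<open>The circumcentre is the foot of the perpendicular from the origin: it has the
    same inner product with every point of the plane, itself included.\<close>
  have "c \<bullet> c = c \<bullet> (u *\<^sub>R x + v *\<^sub>R y + w *\<^sub>R z)"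
    using uvw by simp
  also have "\<dots> = (u + v + w) * (c \<bullet> x)"
    using cy cz by (simp add: inner_add_right algebra_simps)
  finally have ccx: "c \<bullet> c = c \<bullet> x"
    using uvw by simp
  have Ny: "y \<bullet> N = x \<bullet> N" and Nz: "z \<bullet> N = x \<bullet> N"
    using dot_cross_self[of "y - x" "z - x"] dot_cross_self[of "z - x" "y - x"]
    by (simp_all add: N_def inner_diff_left)
  have "c \<bullet> N = (u + v + w) * (x \<bullet> N)"
    using Ny Nz by (simp add: uvw(1) inner_add_left algebra_simps)
  then have cN: "c \<bullet> N = x \<bullet> N"
    using uvw by simp
  have "c \<times> N = 0"
    unfolding N_def Lagrange using cy cz by (simp add: inner_diff_right)
  then have "(c \<bullet> N)\<^sup>2 = (c \<bullet> c) * (N \<bullet> N)"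
    using norm_cross[of c N] by (simp add: power2_norm_eq_inner)
  moreover have "c \<bullet> c \<le> (cos \<theta>)\<^sup>2"
  proof -
    have "r\<^sup>2 = 1 - c \<bullet> c"
      using sq[OF c(2) unit(1)] ccx by simp
    moreover have "(sin \<theta>)\<^sup>2 \<le> r\<^sup>2"
      using r th by (intro power_mono) (auto intro: sin_ge_zero)
    ultimately show ?thesis
      using sin_cos_squared_add[of \<theta>] by linarith
  qed
  ultimately show ?thesis
    using cN by (metis inner_ge_zero mult_right_mono)
qed

lemma vector_derivative_quotient:
  assumes der: "(f has_vector_derivative v) (at t)"
  shows "(\<lambda>h. (f (t + h) - f t) /\<^sub>R h) \<midarrow>0\<rightarrow> v"
proof -
  define Q where "Q h = (f (t + h) - f t) /\<^sub>R h" for h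
    have "(\<lambda>h. norm (f (t + h) - f t - h *\<^sub>R v) / norm h) \<midarrow>0\<rightarrow> 0"
      using der unfolding has_vector_derivative_def has_derivative_at by simp
    moreover have "norm (Q h - v) = norm (f (t + h) - f t - h *\<^sub>R v) / norm h" if "h \<noteq> 0" for h
    proof -
      have "Q h - v = (f (t + h) - f t - h *\<^sub>R v) /\<^sub>R h"
        using that unfolding Q_def scaleR_diff_right by simp
      then show ?thesis
        by (simp only: norm_scaleR divide_inverse_commute norm_inverse real_norm_def abs_inverse)
    qed
    then have "\<forall>\<^sub>F h in at 0. norm (f (t + h) - f t - h *\<^sub>R v) / norm h = norm (Q h - v)"
      by (auto simp: eventually_at_filter)
    ultimately have "(\<lambda>h. norm (Q h - v)) \<midarrow>0\<rightarrow> 0"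
      by (rule Lim_transform_eventually)
    then show ?thesis
      unfolding Q_def by (rule LIM_zero_cancel[OF tendsto_norm_zero_cancel])
qed

text \<open>Limit case of \<open>thick_plane\<close> in which two of the three points merge at
  \<open>t\<close>. Both sides are quadratic in the normal, so dividing the secant by
  \<open>h\<close> preserves the inequality, and a nonzero \<open>v\<close> keeps the merging points
  distinct for small \<open>h\<close>.\<close>

lemma thick_tangent:
  fixes \<gamma> :: "real \<Rightarrow> real^3"
  assumes th: "thickness (range \<gamma>) \<ge> ereal (sin \<theta>)" "0 < \<theta>" "\<theta> \<le> pi / 2"
    and unit: "\<And>t. norm (\<gamma> t) = 1"
    and der: "(\<gamma> has_vector_derivative v) (at t)" and nz: "v \<noteq> 0"
    and ne: "\<gamma> s \<noteq> \<gamma> t"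
  defines "N \<equiv> v \<times> (\<gamma> s - \<gamma> t)"
  shows "(\<gamma> t \<bullet> N)\<^sup>2 \<le> (cos \<theta>)\<^sup>2 * (N \<bullet> N)"
proof -
  define Q where "Q h = (\<gamma> (t + h) - \<gamma> t) /\<^sub>R h" for h
  have lim: "Q \<midarrow>0\<rightarrow> v"
    unfolding Q_def by (rule vector_derivative_quotient[OF der])
  have cont: "isCont \<gamma> t"
    using der has_vector_derivative_continuous by blast
  then have "(\<lambda>h. \<gamma> (t + h)) \<midarrow>0\<rightarrow> \<gamma> t"
    by (simp add: isCont_iff)
  then have ev1: "\<forall>\<^sub>F h in at 0. \<gamma> (t + h) \<noteq> \<gamma> s"
    using ne by (metis tendsto_imp_eventually_ne)
  have ev2: "\<forall>\<^sub>F h in at 0. Q h \<noteq> 0"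
    using lim nz tendsto_imp_eventually_ne by blast
  define M where "M h = Q h \<times> (\<gamma> s - \<gamma> t)" for h
  have limM: "M \<midarrow>0\<rightarrow> N"
    unfolding M_def N_def using lim
    by (intro bounded_bilinear.tendsto[OF bilinear_conv_bounded_bilinear[THEN iffD1, OF bilinear_cross]]
        tendsto_const)
  have "\<forall>\<^sub>F h in at 0. (\<gamma> t \<bullet> M h)\<^sup>2 \<le> (cos \<theta>)\<^sup>2 * (M h \<bullet> M h)"
    using ev1 ev2 eventually_neq_at_within[of 0 0 UNIV]
  proof eventually_elim
    case (elim h)
    define K where "K = (\<gamma> (t + h) - \<gamma> t) \<times> (\<gamma> s - \<gamma> t)"
    have "\<gamma> (t + h) \<noteq> \<gamma> t"
      using elim(2) by (auto simp: Q_def)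
    then have "(\<gamma> t \<bullet> K)\<^sup>2 \<le> (cos \<theta>)\<^sup>2 * (K \<bullet> K)"
      unfolding K_def using elim ne by (intro thick_plane[OF th]) (auto simp: unit)
    then have "(inverse h)\<^sup>2 * (\<gamma> t \<bullet> K)\<^sup>2 \<le> (inverse h)\<^sup>2 * ((cos \<theta>)\<^sup>2 * (K \<bullet> K))"
      by (intro mult_left_mono) auto
    moreover have "M h = inverse h *\<^sub>R K"
      by (simp add: M_def K_def Q_def cross_mult_left)
    ultimately show ?case
      by (simp add: power_mult_distrib power2_eq_square mult_ac)
  qed
  then show ?thesis
    by (rule tendsto_le[rotated 3]) (auto intro!: tendsto_intros limM)
qed


text \<open>Full area only says that the tube misses a null set. But a point farther than \<theta>
  from the compact curve has a whole neighbourhood outside the tube, so every point is within the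
  closed distance \<theta>.\<close>

lemma full_tube_covers:
  fixes A :: "(real^3) set"
  assumes A: "compact A" "A \<noteq> {}" "A \<subseteq> sphere 0 1"
    and th: "0 < \<theta>" "\<theta> \<le> pi / 2"
    and area: "sphere_area (spherical_tube \<theta> A) = 4 * pi"
    and \<xi>: "norm \<xi> = 1"
  shows "\<exists>x\<in>A. x \<bullet> \<xi> \<ge> cos \<theta>"
proof (rule ccontr)
  assume "\<not> ?thesis"
  then have less: "x \<bullet> \<xi> < cos \<theta>" if "x \<in> A" for x
    using that by (auto simp: not_le)
  have cos01: "0 \<le> cos \<theta>" "cos \<theta> \<le> 1"
    using th by (auto intro: cos_ge_zero)
  have "continuous_on A (\<lambda>x. x \<bullet> \<xi>)"
    by (intro continuous_intros)
  then obtain x0 where x0: "x0 \<in> A" "\<And>x. x \<in> A \<Longrightarrow> x \<bullet> \<xi> \<le> x0 \<bullet> \<xi>"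
    using continuous_attains_sup[OF A(1,2)] by metis
  define \<eta> where "\<eta> = cos \<theta> - x0 \<bullet> \<xi>"
  have \<eta>: "\<eta> > 0"
    using less[OF x0(1)] by (simp add: \<eta>_def)
  define cone where "cone = {t *\<^sub>R x | t x. 0 \<le> t \<and> t \<le> 1 \<and> x \<in> spherical_tube \<theta> A}"
  \<comment> \<open>The test ball sits around half of \<xi>. The bound 1/4 keeps it inside the unit
    ball and away from the origin; \<eta>/8 pays for two errors of size \<open>r\<close>, one in the
    inner product and one in the norm, out of the gap \<eta>/2.\<close>
  define r where "r = min (\<eta> / 8) (1 / 4)"
  have r: "0 < r" "r \<le> \<eta> / 8" "r \<le> 1 / 4"
    using \<eta> by (auto simp: r_def)
  define B where "B = ball (\<xi> /\<^sub>R 2) r"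
  have disj: "y \<notin> cone" if "y \<in> B" for y
  proof
    assume "y \<in> cone"
    then obtain t z where tz: "y = t *\<^sub>R z" "0 \<le> t" "z \<in> spherical_tube \<theta> A"
      by (auto simp: cone_def)
    have z: "norm z = 1" "sphere_setdist A z < \<theta>"
      using tz by (auto simp: spherical_tube_def)
    have ny: "norm y = t"
      using tz z by simp
    have yd: "norm (y - \<xi> /\<^sub>R 2) < r"
      using that by (simp add: B_def dist_norm norm_minus_commute)
    have "norm (\<xi> /\<^sub>R 2) \<le> norm y + norm (y - \<xi> /\<^sub>R 2)"
      using norm_triangle_ineq4[of y "y - \<xi> /\<^sub>R 2"] by simp
    then have t: "t \<ge> 1 / 2 - r"
      using \<xi> ny yd by simp
    then have tpos: "t > 0"
      using r by simp
    have "x \<bullet> z < cos \<theta>" if x: "x \<in> A" for x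
    proof -
      have "x \<bullet> (y - \<xi> /\<^sub>R 2) \<le> norm x * norm (y - \<xi> /\<^sub>R 2)"
        by (rule norm_cauchy_schwarz)
      then have "x \<bullet> y \<le> (x \<bullet> \<xi>) / 2 + r"
        using A(3) x yd by (auto simp: inner_diff_right)
      also have "\<dots> \<le> (cos \<theta> - \<eta>) / 2 + r"
        using x0(2)[OF x] by (simp add: \<eta>_def)
      also have "\<dots> < cos \<theta> / 2 - r"
        using r \<eta> by (simp add: field_simps)
      also have "\<dots> \<le> cos \<theta> * (1 / 2 - r)"
        using cos01 r mult_right_mono[of "cos \<theta>" 1 r] by (simp add: algebra_simps)
      also have "\<dots> \<le> cos \<theta> * t"
        using t cos01 by (intro mult_left_mono) auto
      finally show ?thesis
        using tpos by (simp add: tz(1) mult.commute)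
    qed
    then have "\<theta> \<le> sphere_dist x z" if "x \<in> A" for x
    proof -
      have "\<bar>x \<bullet> z\<bar> \<le> 1"
        using Cauchy_Schwarz_ineq2[of x z] z A(3) that by auto
      then have "arccos (cos \<theta>) \<le> arccos (x \<bullet> z)"
        using \<open>\<And>x. x \<in> A \<Longrightarrow> x \<bullet> z < cos \<theta>\<close>[OF that] cos01 by (intro arccos_le_arccos) auto
      then show ?thesis
        using th by (simp add: sphere_dist_def arccos_cos)
    qed
    then have "\<theta> \<le> sphere_setdist A z"
      unfolding sphere_setdist_def using A(2) by (intro cINF_greatest) auto
    then show False
      using z by simp
  qed
  have "cone \<subseteq> cball 0 1"
    by (auto simp: cone_def spherical_tube_def)
  moreover have Bsub: "B \<subseteq> cball 0 1"
  proof
    fix y assume "y \<in> B"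
    then have "norm (y - \<xi> /\<^sub>R 2) < r"
      by (simp add: B_def dist_norm norm_minus_commute)
    then have "norm y \<le> norm (\<xi> /\<^sub>R 2) + r"
      using norm_triangle_ineq2[of y "\<xi> /\<^sub>R 2"] by simp
    then show "y \<in> cball 0 1"
      using r \<xi> by simp
  qed
  ultimately have sub: "cone \<subseteq> cball 0 1 - B"
    using disj by blast
  have m: "measure lebesgue cone = 4 * pi / 3"
    using area by (simp add: sphere_area_def cone_def)
  \<comment> \<open>\<open>measure\<close> is 0 on non-measurable sets, so the positive value of the
    area forces measurability.\<close>
  then have "cone \<in> sets lebesgue"
    using measure_notin_sets[of cone lebesgue] pi_gt_zero by fastforce
  moreover have "cball (0::real^3) 1 - B \<in> lmeasurable"
    by (simp add: B_def lmeasurable_ball lmeasurable_cball fmeasurable.Diff)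
  ultimately have "measure lebesgue cone \<le> measure lebesgue (cball 0 1 - B)"
    using sub by (intro measure_mono_fmeasurable)
  also have "\<dots> = measure lebesgue (cball (0::real^3) 1) - measure lebesgue B"
    using Bsub by (intro measurable_measure_Diff) (auto simp: B_def lmeasurable_ball lmeasurable_cball)
  also have "measure lebesgue (cball (0::real^3) 1) = 4 * pi / 3"
    by (simp add: content_cball unit_ball_vol_3)
  finally have "measure lebesgue B \<le> 0"
    using m by simp
  moreover have "measure lebesgue B > 0"
    using r by (simp add: B_def content_ball_pos)
  ultimately show False by simp
qed

subsection \<open>Touching balls\<close>

lemma periodic_int:
  assumes period: "\<And>t. f (t + 2 * pi) = f t"
  shows "f (t + 2 * pi * of_int n) = f t"
proof (induction n rule: int_induct[of _ 0])
  case (step1 i)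
  then show ?case using period[of "t + 2 * pi * of_int i"] by (simp add: algebra_simps)
next
  case (step2 i)
  then show ?case using period[of "t + 2 * pi * of_int (i - 1)"] by (simp add: algebra_simps)
qed simp

lemma range_periodic:
  assumes period: "\<And>t. f (t + 2 * pi) = f t"
  shows "range f = f ` {0..2 * pi}"
proof -
  have "\<exists>s\<in>{0..2 * pi}. f s = f t" for t
  proof -
    define n where "n = - \<lfloor>t / (2 * pi)\<rfloor>"
    have "of_int \<lfloor>t / (2 * pi)\<rfloor> \<le> t / (2 * pi)" "t / (2 * pi) \<le> of_int \<lfloor>t / (2 * pi)\<rfloor> + 1"
      by linarith+
    then have "of_int \<lfloor>t / (2 * pi)\<rfloor> * (2 * pi) \<le> t" "t \<le> (of_int \<lfloor>t / (2 * pi)\<rfloor> + 1) * (2 * pi)"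
      using pi_gt_zero by (simp_all only: pos_le_divide_eq pos_divide_le_eq mult_pos_pos zero_less_numeral)
    then have "t + 2 * pi * of_int n \<in> {0..2 * pi}"
      by (simp add: n_def algebra_simps)
    then show ?thesis
      using periodic_int[of f, OF period] by blast
  qed
  then have "range f \<subseteq> f ` {0..2 * pi}"
    by (auto simp: image_iff) metis
  then show ?thesis by blast
qed

text \<open>Assumption \<open>thick\<close> says that the two open balls of radius \<open>\<theta>\<close> touching the curve at
  \<open>\<gamma> t\<close> contain no curve point.\<close>

locale thick_curve =
  fixes \<theta> :: real and \<gamma> \<tau> :: "real \<Rightarrow> real^3" and v :: "real \<Rightarrow> real"
  assumes th_pos: "0 < \<theta>" and th_le: "\<theta> \<le> pi / 2"
    and unit: "norm (\<gamma> t) = 1"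
    and period: "\<gamma> (t + 2 * pi) = \<gamma> t"
    and der: "(\<gamma> has_vector_derivative v t *\<^sub>R \<tau> t) (at t)"
    and v_pos: "v t > 0"
    and tau_unit: "norm (\<tau> t) = 1"
    and tau_cont: "continuous_on UNIV \<tau>"
    and thick: "cos \<theta> * (\<gamma> s \<bullet> \<gamma> t) + sin \<theta> * \<bar>\<gamma> s \<bullet> (\<gamma> t \<times> \<tau> t)\<bar> \<le> cos \<theta>"
    and cover: "norm \<xi> = 1 \<Longrightarrow> \<exists>s. cos \<theta> \<le> \<gamma> s \<bullet> \<xi>"
begin

lemma sin_pos: "sin \<theta> > 0"
  using th_pos th_le by (intro sin_gt_zero) auto

lemma cos_nonneg: "cos \<theta> \<ge> 0"
  using th_pos th_le by (intro cos_ge_zero) auto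

lemma gamma_cont: "continuous_on UNIV \<gamma>"
  by (intro continuous_at_imp_continuous_on ballI has_vector_derivative_continuous[OF der])

lemma gamma_gamma [simp]: "\<gamma> t \<bullet> \<gamma> t = 1"
  using unit by (simp add: norm_eq_1)

lemma tau_tau [simp]: "\<tau> t \<bullet> \<tau> t = 1"
  using tau_unit by (simp add: norm_eq_1)

lemma inner_der:
  "((\<lambda>s. \<gamma> s \<bullet> x) has_real_derivative v t * (\<tau> t \<bullet> x)) (at t)"
proof -
  have "((\<lambda>s. \<gamma> s \<bullet> x) has_derivative (\<lambda>h. (h *\<^sub>R (v t *\<^sub>R \<tau> t)) \<bullet> x)) (at t)"
    using der[of t, unfolded has_vector_derivative_def] by (rule has_derivative_inner_left)
  then show ?thesis
    unfolding has_field_derivative_def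
    by (rule has_derivative_eq_rhs) (auto simp: mult_ac)
qed

lemma tau_perp_of_max:
  assumes "\<And>s. \<gamma> s \<bullet> x \<le> \<gamma> t \<bullet> x"
  shows "\<tau> t \<bullet> x = 0"
proof -
  have "v t * (\<tau> t \<bullet> x) = 0"
    using DERIV_local_max[OF inner_der[of x t], of 1] assms by simp
  then show ?thesis
    using v_pos[of t] by simp
qed

lemma gamma_tau [simp]: "\<gamma> t \<bullet> \<tau> t = 0" "\<tau> t \<bullet> \<gamma> t = 0"
proof -
  have "\<gamma> s \<bullet> \<gamma> t \<le> \<gamma> t \<bullet> \<gamma> t" for s
    using norm_cauchy_schwarz[of "\<gamma> s" "\<gamma> t"] by (simp add: unit)
  then show "\<tau> t \<bullet> \<gamma> t = 0"
    by (rule tau_perp_of_max)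
  then show "\<gamma> t \<bullet> \<tau> t = 0"
    by (simp add: inner_commute)
qed

lemma period_shift: "\<exists>s \<ge> a. \<gamma> s = \<gamma> t"
proof -
  obtain n :: nat where "(a - t) / (2 * pi) < real n"
    using reals_Archimedean2 by blast
  then have "a \<le> t + 2 * pi * of_int (int n)"
    by (simp add: field_simps)
  then show ?thesis
    using periodic_int[of \<gamma>, OF period, of t "int n"] by blast
qed

lemma compact_range: "compact (range \<gamma>)"
  unfolding range_periodic[of \<gamma>, OF period] by (intro compact_continuous_image continuous_on_subset[OF gamma_cont]) auto

lemma closed_range: "closed (range \<gamma>)"
  using compact_range compact_imp_closed by blast

text \<open>Inner products are cosines of distances: the open ball of radius \<theta> about
  \<open>c\<close> contains no curve point. Curve points with equality are the contact points of the
  ball.\<close>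

definition ctr :: "real^3 \<Rightarrow> bool" where
  "ctr c \<longleftrightarrow> norm c = 1 \<and> (\<forall>s. \<gamma> s \<bullet> c \<le> cos \<theta>)"

text \<open>For \<open>\<sigma> = \<plusminus>1\<close> the centres of the two balls of radius \<open>\<theta>\<close> that touch the curve at \<open>\<gamma> t\<close>.\<close>

definition cc :: "real \<Rightarrow> real \<Rightarrow> real^3" where
  "cc \<sigma> t = cos \<theta> *\<^sub>R \<gamma> t + (\<sigma> * sin \<theta>) *\<^sub>R (\<gamma> t \<times> \<tau> t)"

lemma ctrD: "ctr c \<Longrightarrow> norm c = 1" "ctr c \<Longrightarrow> c \<bullet> c = 1" "ctr c \<Longrightarrow> \<gamma> s \<bullet> c \<le> cos \<theta>"
  by (auto simp: ctr_def norm_eq_1)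

lemma norm_nu: "norm (\<gamma> t \<times> \<tau> t) = 1" "(\<gamma> t \<times> \<tau> t) \<bullet> (\<gamma> t \<times> \<tau> t) = 1"
  using norm_cross_orthonormal[OF unit tau_unit gamma_tau(1)] by (simp_all add: norm_eq_1)

lemma gamma_cc: "\<gamma> t \<bullet> cc \<sigma> t = cos \<theta>"
  by (simp add: cc_def inner_add_right dot_cross_self)

lemma tau_cc: "\<tau> t \<bullet> cc \<sigma> t = 0"
  by (simp add: cc_def inner_add_right dot_cross_self)

lemma ctr_cc:
  assumes "\<bar>\<sigma>\<bar> = 1"
  shows "ctr (cc \<sigma> t)"
proof -
  have "\<sigma>\<^sup>2 = 1"
    using assms by (simp add: abs_square_eq_1)
  moreover have "cc \<sigma> t \<bullet> cc \<sigma> t = (cos \<theta>)\<^sup>2 + \<sigma>\<^sup>2 * (sin \<theta>)\<^sup>2"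
    by (simp add: cc_def inner_add_left inner_add_right dot_cross_self norm_nu
        power2_eq_square mult_ac)
  ultimately have "norm (cc \<sigma> t) = 1"
    by (simp add: norm_eq_1)
  moreover have "\<gamma> s \<bullet> cc \<sigma> t \<le> cos \<theta>" for s
  proof -
    have "\<sigma> * (\<gamma> s \<bullet> (\<gamma> t \<times> \<tau> t)) \<le> \<bar>\<gamma> s \<bullet> (\<gamma> t \<times> \<tau> t)\<bar>"
      using abs_ge_self[of "\<sigma> * (\<gamma> s \<bullet> (\<gamma> t \<times> \<tau> t))"] assms by (simp add: abs_mult)
    then have "sin \<theta> * (\<sigma> * (\<gamma> s \<bullet> (\<gamma> t \<times> \<tau> t))) \<le> sin \<theta> * \<bar>\<gamma> s \<bullet> (\<gamma> t \<times> \<tau> t)\<bar>"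
      using sin_pos by simp
    then show ?thesis
      using thick[of s t] by (simp add: cc_def inner_add_right mult_ac)
  qed
  ultimately show ?thesis by (simp add: ctr_def)
qed

lemma cross_gamma_nu: "\<gamma> t \<times> (\<gamma> t \<times> \<tau> t) = - \<tau> t"
  by (simp add: Lagrange)

lemma cross_cc: "cc \<sigma> t \<times> \<gamma> t = (\<sigma> * sin \<theta>) *\<^sub>R \<tau> t"
proof -
  have "(\<gamma> t \<times> \<tau> t) \<times> \<gamma> t = \<tau> t"
    using cross_gamma_nu cross_skew by (metis minus_minus)
  then show ?thesis
    by (simp add: cc_def cross_add_left cross_mult_left)
qed

text \<open>A contact point maximises the inner product with the centre, so the centre is orthogonal
  to the tangent there. It lies in the plane of \<open>\<gamma> t\<close> and the normal, and its
  length fixes the normal component up to sign.\<close>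

lemma touch:
  assumes "ctr c" "\<gamma> t \<bullet> c = cos \<theta>"
  shows "\<tau> t \<bullet> c = 0" "\<exists>\<sigma>. \<bar>\<sigma>\<bar> = 1 \<and> c = cc \<sigma> t"
proof -
  show tc: "\<tau> t \<bullet> c = 0"
    using assms by (intro tau_perp_of_max) (auto simp: ctr_def)
  define \<kappa> where "\<kappa> = c \<bullet> (\<gamma> t \<times> \<tau> t)"
  have e: "c = cos \<theta> *\<^sub>R \<gamma> t + \<kappa> *\<^sub>R (\<gamma> t \<times> \<tau> t)"
    using frame_expand[OF unit[of t] tau_unit gamma_tau(1), of c] tc assms(2)
    by (simp add: \<kappa>_def inner_commute)
  have "1 = c \<bullet> c"
    using ctrD assms by simp
  also have "\<dots> = (cos \<theta>)\<^sup>2 + \<kappa>\<^sup>2"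
    using frame_inner[OF unit[of t] tau_unit gamma_tau(1), of c c] tc assms(2)
    by (simp add: \<kappa>_def inner_commute power2_eq_square)
  finally have "\<kappa>\<^sup>2 = (sin \<theta>)\<^sup>2"
    using sin_cos_squared_add[of \<theta>] by linarith
  then have "\<kappa> = 1 * sin \<theta> \<or> \<kappa> = (-1) * sin \<theta>"
    by (simp add: power2_eq_iff)
  then show "\<exists>\<sigma>. \<bar>\<sigma>\<bar> = 1 \<and> c = cc \<sigma> t"
    using e unfolding cc_def by (metis abs_minus_cancel abs_one)
qed

lemma nu_cont: "continuous_on UNIV (\<lambda>t. \<gamma> t \<times> \<tau> t)"
  by (intro continuous_on_cross gamma_cont tau_cont)

lemma cc_cont: "continuous_on UNIV (cc \<sigma>)"
  unfolding cc_def by (intro continuous_intros gamma_cont nu_cont)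

text \<open>Otherwise the ball around \<open>c\<close> could be pushed off the curve in direction \<open>w\<close>.\<close>

lemma contact_in_halfspace:
  assumes c: "ctr c" and w: "w \<bullet> c \<ge> 0"
  shows "\<exists>s. \<gamma> s \<bullet> c = cos \<theta> \<and> \<gamma> s \<bullet> w \<ge> 0"
proof -
  define h where "h k = inverse (real (Suc k))" for k
  have "\<exists>x\<in>range \<gamma>. cos \<theta> \<le> x \<bullet> (c + h k *\<^sub>R w)" for k
  proof -
    \<comment> \<open>Since \<open>w \<bullet> c\<close> is nonnegative, the shift by
      \<open>w\<close> does not shorten the centre, and the normalised shift is covered by some
      curve point. As no curve point has inner product above cos \<theta> with \<open>c\<close>, the
      component along \<open>w\<close> cannot be negative.\<close>
    define u where "u = c + h k *\<^sub>R w"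
    have "1 \<le> u \<bullet> c"
      using ctrD[OF c] w by (simp add: u_def inner_add_left h_def)
    also have "\<dots> \<le> norm u"
      using norm_cauchy_schwarz[of u c] ctrD[OF c] by simp
    finally have u1: "1 \<le> norm u" .
    then have "norm (u /\<^sub>R norm u) = 1"
      by (cases "u = 0") auto
    then obtain s where "cos \<theta> \<le> \<gamma> s \<bullet> (u /\<^sub>R norm u)"
      using cover by blast
    then have "cos \<theta> \<le> \<gamma> s \<bullet> u / norm u"
      by (simp add: divide_inverse_commute)
    moreover have "0 < norm u"
      using u1 by linarith
    ultimately have "cos \<theta> * norm u \<le> \<gamma> s \<bullet> u"
      by (simp only: pos_le_divide_eq)
    moreover have "cos \<theta> \<le> cos \<theta> * norm u"
      using u1 cos_nonneg by (simp add: mult_le_cancel_left1)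
    ultimately show ?thesis
      unfolding u_def by (meson order_trans rangeI)
  qed
  then obtain x where x: "\<And>k. x k \<in> range \<gamma>" "\<And>k. cos \<theta> \<le> x k \<bullet> (c + h k *\<^sub>R w)"
    by metis
  obtain l r where lr: "l \<in> range \<gamma>" "strict_mono r" "(x \<circ> r) \<longlonglongrightarrow> l"
    using compact_range x(1) unfolding compact_def by metis
  have xw: "x k \<bullet> w \<ge> 0" for k
  proof -
    have "x k \<bullet> c \<le> cos \<theta>"
      using x(1)[of k] ctrD(3)[OF c] by auto
    then have "h k * (x k \<bullet> w) \<ge> 0"
      using x(2)[of k] by (simp add: inner_add_right)
    moreover have "h k > 0" by (simp add: h_def)
    ultimately show ?thesis by (simp add: zero_le_mult_iff)
  qed
  have "h \<longlonglongrightarrow> 0"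
    unfolding h_def by (rule LIMSEQ_inverse_real_of_nat)
  then have "(h \<circ> r) \<longlonglongrightarrow> 0"
    using lr(2) by (rule LIMSEQ_subseq_LIMSEQ)
  then have "(\<lambda>k. (x \<circ> r) k \<bullet> (c + (h \<circ> r) k *\<^sub>R w)) \<longlonglongrightarrow> l \<bullet> (c + 0 *\<^sub>R w)"
    by (intro tendsto_intros lr)
  then have "cos \<theta> \<le> l \<bullet> (c + 0 *\<^sub>R w)"
    by (rule LIMSEQ_le_const) (use x(2) in auto)
  moreover have "(\<lambda>k. (x \<circ> r) k \<bullet> w) \<longlonglongrightarrow> l \<bullet> w"
    by (intro tendsto_intros lr)
  then have "0 \<le> l \<bullet> w"
    by (rule LIMSEQ_le_const) (use xw in auto)
  moreover obtain s where "l = \<gamma> s" using lr by auto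
  ultimately show ?thesis
    using ctrD(3)[OF c, of s] by force
qed

text \<open>As \<open>s\<close> grows, the touching ball can only move in the direction of \<open>\<tau>\<close>; a contact point
  ahead blocks it.\<close>

lemma cc_locally_constant:
  assumes \<sigma>: "\<bar>\<sigma>\<bar> = 1" and q: "\<gamma> u \<bullet> cc \<sigma> t = cos \<theta>" "\<gamma> u \<bullet> \<tau> t > 0"
  shows "\<exists>\<epsilon>>0. \<forall>s\<in>{t..<t+\<epsilon>}. cc \<sigma> s = cc \<sigma> t"
proof (rule ccontr)
  assume neg: "\<not> ?thesis"
  define c where "c = cc \<sigma> t"
  have c: "ctr c" "ctr (cc \<sigma> s)" for s
    using ctr_cc[OF \<sigma>] by (auto simp: c_def)
  define h where "h k = inverse (real (Suc k))" for k
  have "\<exists>s. t < s \<and> s < t + h k \<and> cc \<sigma> s \<noteq> c" for k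
  proof -
    have "h k > 0" by (simp add: h_def)
    then obtain s where "s \<in> {t..<t + h k}" "cc \<sigma> s \<noteq> c"
      using neg unfolding c_def by blast
    moreover then have "s \<noteq> t" by (auto simp: c_def)
    ultimately show ?thesis by force
  qed
  then obtain S where S: "\<And>k. t < S k" "\<And>k. S k < t + h k" "\<And>k. cc \<sigma> (S k) \<noteq> c"
    by metis
  \<comment> \<open>Normalised increments of the centre replace the missing derivative of
    \<open>cc\<close>; by compactness they have a limit direction \<open>e\<close>, which is tangent
    to the sphere at \<open>c\<close>.\<close>
  define E where "E k = (cc \<sigma> (S k) - c) /\<^sub>R norm (cc \<sigma> (S k) - c)" for k
  have "E k \<in> sphere 0 1" for k
    using S(3)[of k] by (simp add: E_def)
  then obtain e r where er: "e \<in> sphere 0 1" "strict_mono r" "(E \<circ> r) \<longlonglongrightarrow> e"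
    using compact_sphere[of "0 :: real^3" 1] unfolding compact_def by metis
  have "h \<longlonglongrightarrow> 0"
    unfolding h_def by (rule LIMSEQ_inverse_real_of_nat)
  then have "(\<lambda>k. t + h k) \<longlonglongrightarrow> t"
    using tendsto_add[OF tendsto_const[of t], of h 0 sequentially] by simp
  then have "S \<longlonglongrightarrow> t"
    by (rule tendsto_sandwich[OF _ _ tendsto_const, rotated 2])
      (auto intro!: always_eventually less_imp_le S)
  then have Sr: "(S \<circ> r) \<longlonglongrightarrow> t"
    using er(2) by (rule LIMSEQ_subseq_LIMSEQ)
  have gS: "(\<lambda>k. \<gamma> (S (r k))) \<longlonglongrightarrow> \<gamma> t"
    using continuous_on_tendsto_compose[OF gamma_cont Sr] by simp
  have cS: "(\<lambda>k. cc \<sigma> (S (r k))) \<longlonglongrightarrow> c"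
    using continuous_on_tendsto_compose[OF cc_cont Sr] by (simp add: c_def)
  have Elim: "(\<lambda>k. E (r k)) \<longlonglongrightarrow> e"
    using er(3) by (simp add: o_def)
  have npos: "inverse (norm (cc \<sigma> (S k) - c)) > 0" for k
    using S(3)[of k] by simp
  have Eu: "x \<bullet> E k = inverse (norm (cc \<sigma> (S k) - c)) * (x \<bullet> cc \<sigma> (S k) - x \<bullet> c)" for x k
    by (simp add: E_def inner_diff_right)
  have E1: "\<gamma> u \<bullet> E k \<le> 0" for k
    unfolding Eu using ctrD(3)[OF c(2), of u "S k"] q npos[of k]
    by (simp add: c_def mult_le_0_iff)
  have E2: "\<gamma> t \<bullet> E k \<le> 0" for k
    unfolding Eu using ctrD(3)[OF c(2), of t "S k"] gamma_cc[of t \<sigma>] npos[of k]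
    by (simp add: c_def mult_le_0_iff)
  have E3: "\<gamma> (S k) \<bullet> E k \<ge> 0" for k
    unfolding Eu using ctrD(3)[OF c(1), of "S k"] gamma_cc[of "S k" \<sigma>] npos[of k]
    by (simp add: c_def zero_le_mult_iff)
  have E4: "c \<bullet> E k = - norm (cc \<sigma> (S k) - c) / 2" for k
  proof -
    define n where "n = norm (cc \<sigma> (S k) - c)"
    have "n\<^sup>2 = 2 - 2 * (c \<bullet> cc \<sigma> (S k))"
      using ctrD(2)[OF c(1)] ctrD(2)[OF c(2)]
      by (simp add: n_def power2_norm_eq_inner inner_diff inner_commute)
    then have "c \<bullet> cc \<sigma> (S k) - c \<bullet> c = - n\<^sup>2 / 2"
      using ctrD(2)[OF c(1)] by simp
    moreover have "n \<noteq> 0" using S(3) by (simp add: n_def)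
    ultimately show ?thesis
      unfolding Eu n_def[symmetric] by (simp add: power2_eq_square)
  qed
  have eu: "\<gamma> u \<bullet> e \<le> 0"
    by (rule LIMSEQ_le_const2[OF tendsto_inner[OF tendsto_const Elim]]) (use E1 in auto)
  have et: "\<gamma> t \<bullet> e \<le> 0"
    by (rule LIMSEQ_le_const2[OF tendsto_inner[OF tendsto_const Elim]]) (use E2 in auto)
  have et': "\<gamma> t \<bullet> e \<ge> 0"
    by (rule LIMSEQ_le_const[OF tendsto_inner[OF gS Elim]]) (use E3 in auto)
  have ec: "c \<bullet> e = 0"
  proof -
    have "(\<lambda>k. - norm (cc \<sigma> (S (r k)) - c) / 2) \<longlonglongrightarrow> - norm (c - c) / 2"
      by (intro tendsto_intros cS) auto
    then have "(\<lambda>k. c \<bullet> E (r k)) \<longlonglongrightarrow> 0"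
      by (simp add: E4)
    then show ?thesis
      using tendsto_inner[OF tendsto_const Elim, of c] LIMSEQ_unique by blast
  qed
  have etau: "\<tau> t \<bullet> e \<ge> 0"
  proof -
    \<comment> \<open>By \<open>E2\<close> and \<open>E3\<close> the increment of the curve has a
      nonnegative inner product with the increment of the centre. Dividing by \<open>s - t\<close>
      and passing to the limit turns this into a statement on the tangent.\<close>
    define Q where "Q s = (\<gamma> s - \<gamma> t) /\<^sub>R (s - t)" for s
    have "filterlim (\<lambda>k. S (r k) - t) (at 0) sequentially"
      unfolding filterlim_at using S(1) Sr
      by (auto simp: o_def less_imp_neq[symmetric] intro!: always_eventually tendsto_eq_intros)
    then have "(\<lambda>k. Q (S (r k))) \<longlonglongrightarrow> v t *\<^sub>R \<tau> t"
      unfolding Q_def using filterlim_compose[OF vector_derivative_quotient[OF der[of t]], of "\<lambda>k. S (r k) - t"]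
      by (simp only: add_diff_cancel_left' add_diff_eq)
    then have "(\<lambda>k. Q (S (r k)) \<bullet> E (r k)) \<longlonglongrightarrow> (v t *\<^sub>R \<tau> t) \<bullet> e"
      by (intro tendsto_inner Elim)
    moreover have "Q (S (r k)) \<bullet> E (r k) \<ge> 0" for k
      unfolding Q_def using S(1)[of "r k"] E3[of "r k"] E2[of "r k"] by (simp add: inner_diff_left)
    ultimately have "(v t *\<^sub>R \<tau> t) \<bullet> e \<ge> 0"
      by (intro LIMSEQ_le_const) auto
    then show ?thesis
      using v_pos[of t] by (simp add: zero_le_mult_iff)
  qed
  have "e \<bullet> \<gamma> t = 0"
    using et et' by (simp add: inner_commute)
  moreover from this have "e \<bullet> (\<gamma> t \<times> \<tau> t) = 0"
  proof -
    have "cos \<theta> * (\<gamma> t \<bullet> e) + \<sigma> * sin \<theta> * ((\<gamma> t \<times> \<tau> t) \<bullet> e) = 0"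
      using ec by (simp add: c_def cc_def inner_add_left)
    then show ?thesis
      using \<open>e \<bullet> \<gamma> t = 0\<close> sin_pos \<sigma> by (auto simp: inner_commute)
  qed
  \<comment> \<open>A unit vector orthogonal to \<open>\<gamma> t\<close> and to the normal is the
    tangent up to sign, and \<open>etau\<close> selects the forward one. The ball would then run
    into the contact point \<open>\<gamma> u\<close>, against \<open>eu\<close>.\<close>
  ultimately have "e = - \<tau> t \<or> e = \<tau> t"
    using perp_plane_unit[OF unit norm_nu(1)[of t], of t e] er(1)
    by (simp add: cross_gamma_nu dot_cross_self)
  then have "e = \<tau> t"
    using etau by auto
  then show False
    using eu q(2) by simp
qed

text \<open>The plane orthogonal to \<open>\<tau> t\<close> contains \<open>\<gamma> t\<close> and
  the centre, so it cuts the circle in two opposite points. The second alternative is the reflection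
  of \<open>\<gamma> t\<close> in the axis through the centre.\<close>

lemma circle_perp_tangent:
  assumes \<sigma>: "\<bar>\<sigma>\<bar> = 1" and x: "norm x = 1" "x \<bullet> cc \<sigma> t = cos \<theta>" "x \<bullet> \<tau> t = 0"
  shows "x = \<gamma> t \<or> x = (2 * cos \<theta>) *\<^sub>R cc \<sigma> t - \<gamma> t"
proof -
  define c where "c = cc \<sigma> t"
  have c: "norm c = 1" "c \<bullet> c = 1" "c \<bullet> \<tau> t = 0" "\<tau> t \<bullet> c = 0"
    using ctrD[OF ctr_cc[OF \<sigma>]] tau_cc by (auto simp: c_def inner_commute)
  define y where "y = x - cos \<theta> *\<^sub>R c"
  define z where "z = \<gamma> t - cos \<theta> *\<^sub>R c"
  have xx: "x \<bullet> x = 1" using x by (simp add: norm_eq_1)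
  have xc: "x \<bullet> c = cos \<theta>" "\<gamma> t \<bullet> c = cos \<theta>"
    using x gamma_cc by (auto simp: c_def)
  have perp: "y \<bullet> c = 0" "y \<bullet> \<tau> t = 0" "z \<bullet> c = 0" "z \<bullet> \<tau> t = 0"
    using x xc c by (simp_all add: y_def z_def inner_diff_left)
  define n where "n = c \<times> \<tau> t"
  have y: "y = (y \<bullet> n) *\<^sub>R n" and z: "z = (z \<bullet> n) *\<^sub>R n"
    unfolding n_def using perp c tau_unit by (intro perp_plane_expand; simp)+
  have n1: "norm n = 1"
    unfolding n_def using c tau_unit by (intro norm_cross_orthonormal) auto
  have "norm y = \<bar>y \<bullet> n\<bar>" "norm z = \<bar>z \<bullet> n\<bar>"
    using y z n1 by (metis mult.right_neutral norm_scaleR)+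
  moreover have "y \<bullet> y = z \<bullet> z"
    using xc xx c by (simp add: y_def z_def inner_diff_left inner_diff_right inner_commute)
  ultimately have "\<bar>y \<bullet> n\<bar> = \<bar>z \<bullet> n\<bar>"
    by (metis norm_eq)
  then have "y \<bullet> n = z \<bullet> n \<or> y \<bullet> n = - (z \<bullet> n)"
    by linarith
  then have "y = z \<or> y = - z"
    using y z by (metis scaleR_minus_left)
  then show ?thesis
    unfolding c_def[symmetric]
  proof
    assume "y = z" then show "x = \<gamma> t \<or> x = (2 * cos \<theta>) *\<^sub>R c - \<gamma> t"
      by (simp add: y_def z_def)
  next
    assume "y = - z"
    then have "x = cos \<theta> *\<^sub>R c + cos \<theta> *\<^sub>R c - \<gamma> t"
      by (simp add: y_def z_def algebra_simps)
    also have "\<dots> = (2 * cos \<theta>) *\<^sub>R c - \<gamma> t"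
      by (simp only: mult_2 scaleR_add_left)
    finally show "x = \<gamma> t \<or> x = (2 * cos \<theta>) *\<^sub>R c - \<gamma> t" by simp
  qed
qed

text \<open>With no contact strictly on the side \<open>d\<close> of the tangent, pushing the ball
  that way must be blocked by a contact with zero tangential component. The task is to obtain one
  other than \<open>\<gamma> t\<close>; by \<open>circle_perp_tangent\<close> it is the
  antipode.\<close>

lemma antipode_in_range:
  assumes \<sigma>: "\<bar>\<sigma>\<bar> = 1" and d: "\<bar>d\<bar> = 1"
    and K: "\<And>s. \<gamma> s \<bullet> cc \<sigma> t = cos \<theta> \<Longrightarrow> d * (\<gamma> s \<bullet> \<tau> t) \<le> 0"
  shows "(2 * cos \<theta>) *\<^sub>R cc \<sigma> t - \<gamma> t \<in> range \<gamma>"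
proof -
  define c where "c = cc \<sigma> t"
  have c: "ctr c" "c \<bullet> c = 1" "\<tau> t \<bullet> c = 0" "\<gamma> t \<bullet> c = cos \<theta>" "c \<bullet> \<gamma> t = cos \<theta>"
    using ctrD[OF ctr_cc[OF \<sigma>]] ctr_cc[OF \<sigma>] tau_cc gamma_cc by (auto simp: c_def inner_commute)
  define h where "h k = inverse (real (Suc k))" for k
  \<comment> \<open>The small tilt away from \<open>\<gamma> t\<close> gives
    \<open>\<gamma> t\<close> itself a negative inner product with \<open>w k\<close>. The contacts
    found have inner product at most the square of cos \<theta> with \<open>\<gamma> t\<close>, and
    this bound survives the limit.\<close>
  define w where "w k = d *\<^sub>R \<tau> t - h k *\<^sub>R (\<gamma> t - cos \<theta> *\<^sub>R c)" for k
  have "w k \<bullet> c = 0" for k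
    using c by (simp add: w_def inner_diff_left)
  then have "\<exists>s. \<gamma> s \<bullet> c = cos \<theta> \<and> \<gamma> s \<bullet> w k \<ge> 0" for k
    by (intro contact_in_halfspace c) simp
  then obtain S where S: "\<And>k. \<gamma> (S k) \<bullet> c = cos \<theta>" "\<And>k. \<gamma> (S k) \<bullet> w k \<ge> 0"
    by metis
  obtain x r where xr: "x \<in> range \<gamma>" "strict_mono r" "((\<lambda>k. \<gamma> (S k)) \<circ> r) \<longlonglongrightarrow> x"
    using compact_range unfolding compact_def by (metis rangeI)
  have lim: "(\<lambda>k. \<gamma> (S (r k))) \<longlonglongrightarrow> x"
    using xr(3) by (simp add: o_def)
  have xc: "x \<bullet> c = cos \<theta>"
    using tendsto_inner[OF lim tendsto_const[of c]] S(1) by (simp add: LIMSEQ_const_iff)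
  have "h \<longlonglongrightarrow> 0"
    unfolding h_def by (rule LIMSEQ_inverse_real_of_nat)
  then have "(\<lambda>k. h (r k)) \<longlonglongrightarrow> 0"
    using LIMSEQ_subseq_LIMSEQ[OF _ xr(2)] by (auto simp: o_def)
  then have "(\<lambda>k. w (r k)) \<longlonglongrightarrow> d *\<^sub>R \<tau> t - 0 *\<^sub>R (\<gamma> t - cos \<theta> *\<^sub>R c)"
    unfolding w_def by (intro tendsto_intros)
  then have "(\<lambda>k. \<gamma> (S (r k)) \<bullet> w (r k)) \<longlonglongrightarrow> x \<bullet> (d *\<^sub>R \<tau> t - 0 *\<^sub>R (\<gamma> t - cos \<theta> *\<^sub>R c))"
    by (intro tendsto_inner lim)
  then have "0 \<le> x \<bullet> (d *\<^sub>R \<tau> t - 0 *\<^sub>R (\<gamma> t - cos \<theta> *\<^sub>R c))"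
    by (rule LIMSEQ_le_const) (use S(2) in auto)
  then have "d * (x \<bullet> \<tau> t) \<ge> 0"
    by simp
  moreover have "d * (x \<bullet> \<tau> t) \<le> 0"
    using xc xr(1) K by (auto simp: c_def)
  ultimately have xt: "x \<bullet> \<tau> t = 0"
    using d by auto
  have "\<gamma> (S k) \<bullet> \<gamma> t \<le> (cos \<theta>)\<^sup>2" for k
  proof -
    have "h k * (\<gamma> (S k) \<bullet> \<gamma> t - cos \<theta> * cos \<theta>) \<le> 0"
      using S(2)[of k] K[of "S k"] S(1)[of k]
      by (simp add: w_def inner_diff_right c_def[symmetric])
    moreover have "h k > 0" by (simp add: h_def)
    ultimately show ?thesis
      by (simp add: mult_le_0_iff power2_eq_square)
  qed
  then have "x \<bullet> \<gamma> t \<le> (cos \<theta>)\<^sup>2"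
    by (intro LIMSEQ_le_const2[OF tendsto_inner[OF lim tendsto_const]]) auto
  moreover have "(cos \<theta>)\<^sup>2 < 1"
    using sin_pos sin_cos_squared_add[of \<theta>] by (smt (verit) zero_less_power)
  ultimately have "x \<noteq> \<gamma> t" by auto
  then show ?thesis
    using circle_perp_tangent[OF \<sigma>, of x t] xc xt xr(1) unit unfolding c_def by (metis rangeE)
qed


section \<open>Orientation reversal, resting touching balls and the half circles they
  produce\<close>

lemma reversed: "thick_curve \<theta> (\<lambda>t. \<gamma> (- t)) (\<lambda>t. - \<tau> (- t)) (\<lambda>t. v (- t))"
proof
  show "((\<lambda>t. \<gamma> (- t)) has_vector_derivative v (- t) *\<^sub>R - \<tau> (- t)) (at t)" for t
  proof -
    have "(\<gamma> \<circ> uminus has_vector_derivative (-1) *\<^sub>R (v (- t) *\<^sub>R \<tau> (- t))) (at t)"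
      by (rule vector_diff_chain_at) (auto intro!: derivative_eq_intros der)
    then show ?thesis by (simp add: o_def)
  qed
  show "continuous_on UNIV (\<lambda>t. - \<tau> (- t))"
    by (intro continuous_intros continuous_on_compose2[OF tau_cont]) auto
  show "\<gamma> (- (t + 2 * pi)) = \<gamma> (- t)" for t
    using period[of "- t - 2 * pi"] by simp
  show "\<exists>s. cos \<theta> \<le> \<gamma> (- s) \<bullet> \<xi>" if "norm \<xi> = 1" for \<xi>
    using cover[OF that] by (metis minus_minus)
  show "cos \<theta> * (\<gamma> (- s) \<bullet> \<gamma> (- t)) + sin \<theta> * \<bar>\<gamma> (- s) \<bullet> (\<gamma> (- t) \<times> - \<tau> (- t))\<bar> \<le> cos \<theta>" for s t
    using thick[of "- s" "- t"] by simp
qed (use th_pos th_le unit v_pos tau_unit in auto)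

text \<open>Reversal flips the normal and thereby exchanges the two sides; statements about the past
  of \<open>t\<close> follow from those about its future.\<close>

lemma cc_reversed: "thick_curve.cc \<theta> (\<lambda>t. \<gamma> (- t)) (\<lambda>t. - \<tau> (- t)) \<sigma> t = cc (- \<sigma>) (- t)"
  by (simp add: thick_curve.cc_def[OF reversed] cc_def)

text \<open>The point \<open>- c\<close> has to be covered as well, and for \<theta> < pi / 2 the
  closed balls of radius \<theta> about \<open>c\<close> and \<open>- c\<close> are disjoint.
  Periodicity moves the witness beyond \<open>a\<close>.\<close>

lemma not_all_on_circle:
  assumes "norm c = 1" "\<theta> < pi / 2"
  shows "\<exists>s\<ge>a. \<gamma> s \<bullet> c \<noteq> cos \<theta>"
proof -
  obtain u where "cos \<theta> \<le> \<gamma> u \<bullet> (- c)"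
    using cover[of "- c"] assms by auto
  moreover obtain s where "s \<ge> a" "\<gamma> s = \<gamma> u"
    using period_shift by blast
  moreover have "cos \<theta> > 0"
    using th_pos assms by (intro cos_gt_zero) auto
  ultimately show ?thesis
    by (intro exI[of _ s]) auto
qed

text \<open>\<open>b\<close> is the time at which the centre first starts to move, finite by
  \<open>not_all_on_circle\<close>. A contact ahead of \<open>b\<close> would hold the centre still
  for longer, by \<open>cc_locally_constant\<close>.\<close>

lemma constant_right_end:
  assumes \<sigma>: "\<bar>\<sigma>\<bar> = 1" and th: "\<theta> < pi / 2"
  shows "\<exists>b\<ge>t. (\<forall>s\<in>{t..b}. cc \<sigma> s = cc \<sigma> t) \<and> (\<forall>u. \<gamma> u \<bullet> cc \<sigma> t = cos \<theta> \<longrightarrow> \<gamma> u \<bullet> \<tau> b \<le> 0)"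
proof -
  define c where "c = cc \<sigma> t"
  define Z where "Z = {s. s \<ge> t \<and> cc \<sigma> s \<noteq> c}"
  define b where "b = Inf Z"
  obtain s where "s \<ge> t" "\<gamma> s \<bullet> c \<noteq> cos \<theta>"
    using not_all_on_circle[of c t] ctrD(1)[OF ctr_cc[OF \<sigma>]] th by (auto simp: c_def)
  then have ne: "Z \<noteq> {}"
    using gamma_cc[of s \<sigma>] by (auto simp: Z_def)
  have bdd: "bdd_below Z"
    by (auto simp: Z_def bdd_below_def)
  have tb: "t \<le> b"
    unfolding b_def by (rule cInf_greatest[OF ne]) (auto simp: Z_def)
  have c1: "cc \<sigma> s = c" if "t \<le> s" "s < b" for s
    using cInf_lower[OF _ bdd, of s] that by (auto simp: Z_def b_def)
  have c2: "cc \<sigma> b = c"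
  proof (cases "b = t")
    case False
    have "closed {s. cc \<sigma> s = c}"
      using continuous_closed_vimage[of "{c}" "cc \<sigma>"] cc_cont[of \<sigma>]
      by (simp add: vimage_def continuous_on_eq_continuous_at)
    moreover have "{t..<b} \<subseteq> {s. cc \<sigma> s = c}"
      using c1 by auto
    ultimately have "closure {t..<b} \<subseteq> {s. cc \<sigma> s = c}"
      by (rule closure_minimal[rotated])
    then show ?thesis
      using False tb by (auto simp: closure_atLeastLessThan)
  qed (simp add: c_def)
  have "\<gamma> u \<bullet> \<tau> b \<le> 0" if u: "\<gamma> u \<bullet> c = cos \<theta>" for u
  proof (rule ccontr)
    assume "\<not> ?thesis"
    then have "\<gamma> u \<bullet> cc \<sigma> b = cos \<theta>" "\<gamma> u \<bullet> \<tau> b > 0"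
      using u c2 by simp_all
    then obtain \<epsilon> where e: "\<epsilon> > 0" "\<forall>s\<in>{b..<b+\<epsilon>}. cc \<sigma> s = cc \<sigma> b"
      using cc_locally_constant[OF \<sigma>] by blast
    have "b + \<epsilon> \<le> z" if z: "z \<in> Z" for z
    proof (rule ccontr)
      assume "\<not> ?thesis"
      moreover have "b \<le> z"
        using cInf_lower[OF z bdd] by (simp add: b_def)
      ultimately have "cc \<sigma> z = c"
        using e(2) c2 by simp
      then show False using z by (simp add: Z_def)
    qed
    then have "b + \<epsilon> \<le> Inf Z"
      by (rule cInf_greatest[OF ne])
    then show False using e by (simp add: b_def)
  qed
  moreover have "cc \<sigma> s = c" if "s \<in> {t..b}" for s
    using c1[of s] c2 that by (cases "s = b") auto
  ultimately show ?thesis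
    using tb unfolding c_def by blast
qed

lemma constant_left_end:
  assumes \<sigma>: "\<bar>\<sigma>\<bar> = 1" and th: "\<theta> < pi / 2"
  shows "\<exists>a\<le>t. (\<forall>s\<in>{a..t}. cc \<sigma> s = cc \<sigma> t) \<and> (\<forall>u. \<gamma> u \<bullet> cc \<sigma> t = cos \<theta> \<longrightarrow> \<gamma> u \<bullet> \<tau> a \<ge> 0)"
proof -
  obtain b where b: "b \<ge> - t" "\<And>s. s \<in> {- t..b} \<Longrightarrow> cc \<sigma> (- s) = cc \<sigma> t"
    "\<And>u. \<gamma> (- u) \<bullet> cc \<sigma> t = cos \<theta> \<Longrightarrow> \<gamma> (- u) \<bullet> - \<tau> (- b) \<le> 0"
    using thick_curve.constant_right_end[OF reversed, of "- \<sigma>" "- t"] \<sigma> th by (auto simp: cc_reversed)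
  show ?thesis
  proof (intro exI[of _ "- b"] conjI ballI allI impI)
    show "cc \<sigma> s = cc \<sigma> t" if "s \<in> {- b..t}" for s
      using b(2)[of "- s"] that by auto
    show "\<gamma> u \<bullet> \<tau> (- b) \<ge> 0" if "\<gamma> u \<bullet> cc \<sigma> t = cos \<theta>" for u
      using b(3)[of "- u"] that by simp
  qed (use b in auto)
qed

text \<open>\<open>w\<close> is the direction from the centre to the middle of the half circle of
  contacts. Contacts are confined to the closed side, while filling is asked on the open side only;
  the two end points join by closedness of the curve.\<close>

definition base :: "real^3 \<Rightarrow> real^3 \<Rightarrow> bool" where
  "base c w \<longleftrightarrow> ctr c \<and> norm w = 1 \<and> w \<bullet> c = 0 \<and>
     (\<forall>s. \<gamma> s \<bullet> c = cos \<theta> \<longrightarrow> \<gamma> s \<bullet> w \<ge> 0) \<and>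
     (\<forall>x. norm x = 1 \<and> x \<bullet> c = cos \<theta> \<and> x \<bullet> w > 0 \<longrightarrow> x \<in> range \<gamma>)"

text \<open>On the maximal interval from \<open>a\<close> to \<open>b\<close> where the ball rests,
  no contact lies behind \<open>a\<close> and none lies ahead of \<open>b\<close>. This makes the
  end points antipodal, so the curve runs through a half circle whose middle direction is the
  tangent at \<open>a\<close>.\<close>

lemma base_exists:
  assumes \<sigma>: "\<bar>\<sigma>\<bar> = 1" and th: "\<theta> < pi / 2"
    and u: "\<gamma> u \<bullet> cc \<sigma> t = cos \<theta>" "\<gamma> u \<bullet> \<tau> t \<noteq> 0"
  shows "\<exists>w. base (cc \<sigma> t) w"
proof -
  define c where "c = cc \<sigma> t"
  have c: "ctr c" using ctr_cc[OF \<sigma>] by (simp add: c_def)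
  obtain b where b: "t \<le> b" "\<And>s. s \<in> {t..b} \<Longrightarrow> cc \<sigma> s = c"
    "\<And>u. \<gamma> u \<bullet> c = cos \<theta> \<Longrightarrow> \<gamma> u \<bullet> \<tau> b \<le> 0"
    using constant_right_end[OF \<sigma> th] unfolding c_def by metis
  obtain a where a: "a \<le> t" "\<And>s. s \<in> {a..t} \<Longrightarrow> cc \<sigma> s = c"
    "\<And>u. \<gamma> u \<bullet> c = cos \<theta> \<Longrightarrow> \<gamma> u \<bullet> \<tau> a \<ge> 0"
    using constant_left_end[OF \<sigma> th] unfolding c_def by metis
  have ab: "cc \<sigma> s = c" if "s \<in> {a..b}" for s
    using a(2)[of s] b(2)[of s] that by (cases "s \<le> t") auto
  \<comment> \<open>If the interval shrank to \<open>t\<close>, every contact would be neither ahead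
    nor behind, contrary to the choice of \<open>u\<close>.\<close>
  have "a < b"
    using a b u unfolding c_def by (metis antisym_conv not_less order_trans)
  have on: "\<gamma> s \<bullet> c = cos \<theta>" "\<tau> s \<bullet> c = 0" "c \<times> \<gamma> s = (\<sigma> * sin \<theta>) *\<^sub>R \<tau> s" if "s \<in> {a..b}" for s
    using ab[OF that] gamma_cc tau_cc cross_cc by metis+
  have aI: "a \<in> {a..b}" and bI: "b \<in> {a..b}"
    using \<open>a < b\<close> by auto
  have cross_inj: "\<tau> s = d *\<^sub>R \<tau> s'" if "s \<in> {a..b}" "s' \<in> {a..b}" "c \<times> \<gamma> s = d *\<^sub>R (c \<times> \<gamma> s')" for s s' d
  proof -
    have "(\<sigma> * sin \<theta>) *\<^sub>R \<tau> s = (\<sigma> * sin \<theta>) *\<^sub>R (d *\<^sub>R \<tau> s')"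
      using that on(3) by (simp add: mult_ac)
    moreover have "\<sigma> * sin \<theta> \<noteq> 0" using \<sigma> sin_pos by auto
    ultimately show ?thesis by (metis scaleR_cancel_left)
  qed
  have ccsymb: "cc \<sigma> a = c" "cc \<sigma> b = c"
    using ab aI bI by auto
  have increase: "\<exists>s\<in>{a..b}. \<gamma> a \<bullet> y < \<gamma> s \<bullet> y" if "\<tau> a \<bullet> y > 0" for y
  proof -
    have "0 < v a * (\<tau> a \<bullet> y)"
      using v_pos[of a] that by simp
    then obtain d where d: "d > 0" "\<And>h. 0 < h \<Longrightarrow> h < d \<Longrightarrow> \<gamma> a \<bullet> y < \<gamma> (a + h) \<bullet> y"
      using DERIV_pos_inc_right[OF inner_der] by blast
    have "\<gamma> a \<bullet> y < \<gamma> (a + min (d / 2) (b - a)) \<bullet> y"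
      using d(1) \<open>a < b\<close> by (intro d(2)) auto
    moreover have "a + min (d / 2) (b - a) \<in> {a..b}"
      using d(1) \<open>a < b\<close> by auto
    ultimately show ?thesis by blast
  qed
  have ne: "\<gamma> a \<noteq> \<gamma> b"
  proof
    assume "\<gamma> a = \<gamma> b"
    then have "\<tau> b = 1 *\<^sub>R \<tau> a"
      using aI bI by (intro cross_inj) auto
    then have "\<gamma> s \<bullet> \<tau> a = 0" if "s \<in> {a..b}" for s
      using a(3)[of s] b(3)[of s] on(1)[OF that] by simp
    then show False
      using increase[of "\<tau> a"] aI by fastforce
  qed
  have ant: "(2 * cos \<theta>) *\<^sub>R c - \<gamma> a \<in> range \<gamma>"
    using antipode_in_range[OF \<sigma>, of "-1" a] a(3) ccsymb by simp
  then obtain s' where s': "\<gamma> s' = (2 * cos \<theta>) *\<^sub>R c - \<gamma> a" by (metis rangeE)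
  have "\<gamma> s' \<bullet> c = cos \<theta>"
    using ctrD(2)[OF c] on(1)[OF aI] by (simp add: s' inner_diff_left)
  then have "\<gamma> s' \<bullet> \<tau> b \<le> 0" "\<gamma> a \<bullet> \<tau> b \<le> 0"
    using b(3) on(1)[OF aI] by auto
  moreover have "\<gamma> s' \<bullet> \<tau> b = - (\<gamma> a \<bullet> \<tau> b)"
    using on(2)[OF bI] by (simp add: s' inner_diff_left inner_commute[of c])
  \<comment> \<open>Both \<open>\<gamma> a\<close> and its antipode are contacts, so neither is
    ahead of \<open>b\<close>; their tangential components at \<open>b\<close> are opposite and
    hence vanish.\<close>
  ultimately have "\<gamma> a \<bullet> \<tau> b = 0" by simp
  then have "\<gamma> a = (2 * cos \<theta>) *\<^sub>R c - \<gamma> b"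
    using circle_perp_tangent[OF \<sigma>, of "\<gamma> a" b] unit on(1)[OF aI] ccsymb ne by auto
  then have tb: "\<tau> b = (-1) *\<^sub>R \<tau> a"
    using aI bI by (intro cross_inj) (auto simp: Cross3.right_diff_distrib cross_mult_right)
  have "x \<in> range \<gamma>" if x: "norm x = 1" "x \<bullet> c = cos \<theta>" "x \<bullet> \<tau> a > 0" for x
  proof -
    \<comment> \<open>The point of this stretch nearest to \<open>x\<close> is interior, since the
      tangents at both ends exclude a maximum there. So \<open>x\<close> is orthogonal to its
      tangent and equals it or its antipode; in the second case the point would also be the farthest
      one from \<open>x\<close>.\<close>
    have "continuous_on {a..b} (\<lambda>s. \<gamma> s \<bullet> x)"
      by (intro continuous_intros continuous_on_subset[OF gamma_cont]) auto
    then obtain T where T: "T \<in> {a..b}" "\<And>s. s \<in> {a..b} \<Longrightarrow> \<gamma> s \<bullet> x \<le> \<gamma> T \<bullet> x"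
      using continuous_attains_sup[of "{a..b}"] \<open>a < b\<close> by (metis atLeastatMost_empty_iff2 compact_Icc not_less order_less_imp_le)
    have pos: "\<tau> a \<bullet> x > 0"
      using x(3) by (simp add: inner_commute)
    then have "T \<noteq> a"
      using increase T(2) by fastforce
    moreover have "T \<noteq> b"
    proof
      assume "T = b"
      have "v b * (\<tau> b \<bullet> x) < 0"
        using v_pos[of b] x(3) by (simp add: tb inner_commute)
      then obtain d where d: "d > 0" "\<And>h. 0 < h \<Longrightarrow> h < d \<Longrightarrow> \<gamma> b \<bullet> x < \<gamma> (b - h) \<bullet> x"
        using DERIV_neg_dec_left[OF inner_der] by blast
      have "\<gamma> b \<bullet> x < \<gamma> (b - min (d / 2) (b - a)) \<bullet> x"
        using d(1) \<open>a < b\<close> by (intro d(2)) auto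
      moreover have "b - min (d / 2) (b - a) \<in> {a..b}"
        using d(1) \<open>a < b\<close> by auto
      ultimately show False
        using T \<open>T = b\<close> by fastforce
    qed
    ultimately have Tin: "a < T" "T < b"
      using T(1) by auto
    have "v T * (\<tau> T \<bullet> x) = 0"
      by (rule DERIV_local_max[OF inner_der, of "min (T - a) (b - T)"])
        (use Tin T(2) in \<open>auto simp: abs_less_iff\<close>)
    then have tx: "x \<bullet> \<tau> T = 0"
      using v_pos[of T] by (simp add: inner_commute)
    have "x = \<gamma> T \<or> x = (2 * cos \<theta>) *\<^sub>R c - \<gamma> T"
      using circle_perp_tangent[OF \<sigma>, of x T] x(1,2) ab[OF T(1)] tx by auto
    moreover have "x \<noteq> (2 * cos \<theta>) *\<^sub>R c - \<gamma> T"
    proof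
      assume "x = (2 * cos \<theta>) *\<^sub>R c - \<gamma> T"
      then have gT: "\<gamma> T = (2 * cos \<theta>) *\<^sub>R c - x" by simp
      have "x \<bullet> x = 1" using x by (simp add: norm_eq_1)
      have "\<gamma> T \<bullet> x \<le> \<gamma> s \<bullet> x" if "s \<in> {a..b}" for s
      proof -
        have "\<gamma> s \<bullet> \<gamma> T \<le> 1"
          using norm_cauchy_schwarz[of "\<gamma> s" "\<gamma> T"] by (simp add: unit)
        then have "2 * (cos \<theta> * cos \<theta>) - \<gamma> s \<bullet> x \<le> 1"
          using on(1)[OF that] by (simp add: gT inner_diff_right)
        then show ?thesis
          using x(2) \<open>x \<bullet> x = 1\<close> by (simp add: gT inner_diff_left inner_commute[of c])
      qed
      then show False
        using increase[OF pos] T(2) aI by fastforce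
    qed
    ultimately show ?thesis by auto
  qed
  then have "base c (\<tau> a)"
    unfolding base_def using c tau_unit on(2)[OF aI] a(3) by auto
  then show ?thesis
    unfolding c_def ..
qed

end

subsection \<open>Concentric half circles\<close>

text \<open>Polar coordinates about the pole \<open>c\<close>: for orthonormal \<open>c\<close> and
  \<open>e\<close> this is the point at distance \<open>u\<close> from \<open>c\<close> on the
  meridian in direction \<open>e\<close>.\<close>

definition arc_pt :: "real^3 \<Rightarrow> real^3 \<Rightarrow> real \<Rightarrow> real^3" where
  "arc_pt c e u = cos u *\<^sub>R c + sin u *\<^sub>R e"

lemma arc_pt_inner:
  assumes "norm c = 1" "e \<bullet> c = 0" "e' \<bullet> c = 0"
  shows "arc_pt c e u \<bullet> arc_pt c e' u' = cos u * cos u' + sin u * sin u' * (e \<bullet> e')"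
proof -
  have "c \<bullet> c = 1" "c \<bullet> e' = 0" "c \<bullet> e = 0"
    using assms by (simp_all add: norm_eq_1 inner_commute)
  then show ?thesis
    using assms by (simp add: arc_pt_def inner_add_left inner_add_right)
qed

lemma arc_pt_inner_same:
  assumes "norm c = 1" "e \<bullet> c = 0" "norm e = 1"
  shows "arc_pt c e u \<bullet> arc_pt c e u' = cos (u - u')"
proof -
  have "e \<bullet> e = 1" using assms by (simp add: norm_eq_1)
  then show ?thesis
    using arc_pt_inner[OF assms(1,2,2)] by (simp add: cos_diff)
qed

lemma norm_arc_pt:
  assumes "norm c = 1" "e \<bullet> c = 0" "norm e = 1"
  shows "norm (arc_pt c e u) = 1"
  using arc_pt_inner_same[OF assms, of u u] by (simp add: norm_eq_1)

lemma arc_pt_reflect: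
  "(2 * cos a) *\<^sub>R arc_pt c e u - arc_pt c e (u - a) = arc_pt c e (u + a)"
proof -
  have "2 * cos a * cos u - cos (u - a) = cos (u + a)" "2 * cos a * sin u - sin (u - a) = sin (u + a)"
    by (simp_all add: cos_add cos_diff sin_add sin_diff)
  then have "arc_pt c e (u + a) = (2 * cos a * cos u - cos (u - a)) *\<^sub>R c + (2 * cos a * sin u - sin (u - a)) *\<^sub>R e"
    by (simp add: arc_pt_def)
  also have "\<dots> = (2 * cos a) *\<^sub>R arc_pt c e u - arc_pt c e (u - a)"
    by (simp add: arc_pt_def algebra_simps)
  finally show ?thesis ..
qed

lemma arc_pt_cross:
  assumes "norm c = 1" "norm e = 1"
  shows "arc_pt c e u \<times> arc_pt c e (u + pi / 2) = c \<times> e"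
proof -
  have "e \<times> c = - (c \<times> e)" by (rule cross_skew)
  moreover have "(cos u * cos u) *\<^sub>R (c \<times> e) + (sin u * sin u) *\<^sub>R (c \<times> e) = c \<times> e"
    using sin_cos_squared_add3[of u] by (simp flip: scaleR_add_left)
  ultimately show ?thesis
    by (simp add: arc_pt_def cos_add sin_add cross_add_left cross_add_right cross_mult_left
        cross_mult_right Cross3.right_diff_distrib mult_ac)
qed

lemma great_circle_at_distance:
  assumes c: "norm c = 1" "norm e = 1" "e \<bullet> c = 0"
    and x: "norm x = 1" "x \<bullet> (c \<times> e) = 0" "x \<bullet> arc_pt c e u = cos a"
  shows "x = arc_pt c e (u + a) \<or> x = arc_pt c e (u - a)"
proof -
  define A where "A = arc_pt c e u"
  define B where "B = arc_pt c e (u + pi / 2)"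
  have AB: "norm A = 1" "norm B = 1" "A \<bullet> B = 0" "A \<times> B = c \<times> e"
    using norm_arc_pt arc_pt_inner_same arc_pt_cross c by (auto simp: A_def B_def)
  define b where "b = x \<bullet> B"
  have ex: "x = cos a *\<^sub>R A + b *\<^sub>R B"
    using frame_expand[OF AB(1-3), of x] x unfolding AB(4) by (simp add: A_def b_def)
  have "1 = x \<bullet> x" using x by (simp add: norm_eq_1)
  also have "\<dots> = (cos a)\<^sup>2 + b\<^sup>2"
    using frame_inner[OF AB(1-3), of x x] x unfolding AB(4) by (simp add: A_def b_def power2_eq_square)
  finally have "b\<^sup>2 = (sin a)\<^sup>2"
    using sin_cos_squared_add[of a] by linarith
  then have "b = sin a \<or> b = - sin a"
    by (simp add: power2_eq_iff)
  moreover have "cos a *\<^sub>R A + sin a *\<^sub>R B = arc_pt c e (u + a)"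
    by (simp add: A_def B_def arc_pt_def cos_add sin_add algebra_simps)
  moreover have "cos a *\<^sub>R A + (- sin a) *\<^sub>R B = arc_pt c e (u - a)"
    by (simp add: A_def B_def arc_pt_def cos_add sin_add cos_diff sin_diff algebra_simps)
  ultimately show ?thesis
    using ex by metis
qed

lemma hemisphere_polar:
  assumes c: "norm c = 1" "norm w = 1" "w \<bullet> c = 0"
    and x: "norm x = 1" "x \<bullet> w \<ge> 0"
  obtains e u where "norm e = 1" "e \<bullet> c = 0" "e \<bullet> w \<ge> 0" "x = arc_pt c e u" "0 \<le> u" "u \<le> pi"
proof -
  have c': "c \<bullet> w = 0" "c \<bullet> c = 1"
    using c by (auto simp: inner_commute norm_eq_1)
  have x1: "\<bar>x \<bullet> c\<bar> \<le> 1"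
    using Cauchy_Schwarz_ineq2[of x c] x c by simp
  define u where "u = arccos (x \<bullet> c)"
  have u: "0 \<le> u" "u \<le> pi" "x \<bullet> c = cos u"
    using x1 arccos_bounded[of "x \<bullet> c"] by (auto simp: u_def cos_arccos_abs)
  obtain e where e: "norm e = 1" "e \<bullet> c = 0" "e \<bullet> w \<ge> 0" "x = arc_pt c e u"
  proof (cases "sin u = 0")
    \<comment> \<open>At a pole the meridian is undetermined; \<open>w\<close> is a choice on the
      required side.\<close>
    case True
    define y where "y = x - cos u *\<^sub>R c"
    have "y \<bullet> y = 1 - (cos u)\<^sup>2"
      using x u c c' by (simp add: y_def inner_diff_left inner_diff_right inner_commute norm_eq_1 power2_eq_square)
    then have "y = 0"
      using True sin_cos_squared_add[of u] by simp
    then have "x = arc_pt c w u"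
      using True by (simp add: y_def arc_pt_def)
    then show thesis using that[of w] c c' by simp
  next
    case False
    then have su: "sin u > 0" using u sin_ge_zero[of u] by linarith
    define y where "y = x - cos u *\<^sub>R c"
    have "y \<bullet> y = 1 - (cos u)\<^sup>2"
      using x u c c' by (simp add: y_def inner_diff_left inner_diff_right inner_commute norm_eq_1 power2_eq_square)
    then have yy: "y \<bullet> y = (sin u)\<^sup>2"
      using sin_cos_squared_add[of u] by linarith
    have ny: "norm y = sin u"
      using su yy by (simp add: norm_eq_sqrt_inner)
    have "norm (y /\<^sub>R sin u) = 1" "(y /\<^sub>R sin u) \<bullet> c = 0" "(y /\<^sub>R sin u) \<bullet> w \<ge> 0"
      "x = arc_pt c (y /\<^sub>R sin u) u"
      using ny su u c c' x by (simp_all add: y_def inner_diff_left arc_pt_def)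
    then show thesis using that by blast
  qed
  show thesis
    using that[OF e] u by blast
qed

context thick_curve
begin

text \<open>Reflecting the centre in the contact point gives the other ball touching the curve
  there.\<close>

lemma ctr_opposite:
  assumes "ctr c" "\<gamma> t \<bullet> c = cos \<theta>"
  shows "ctr ((2 * cos \<theta>) *\<^sub>R \<gamma> t - c)"
proof -
  obtain \<sigma> where s: "\<bar>\<sigma>\<bar> = 1" "c = cc \<sigma> t"
    using touch[OF assms] by blast
  have "(2 * cos \<theta>) *\<^sub>R \<gamma> t - c = cc (- \<sigma>) t"
    unfolding mult_2 scaleR_add_left by (simp add: s cc_def)
  then show ?thesis
    using ctr_cc[of "- \<sigma>" t] s by simp
qed

lemma closed_ctr: "closed {c. ctr c}"
proof -
  have "{c. ctr c} = sphere 0 1 \<inter> (\<Inter>s. {c. \<gamma> s \<bullet> c \<le> cos \<theta>})"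
    by (auto simp: ctr_def)
  then show ?thesis
    by (auto intro!: closed_Int closed_INT closed_halfspace_le)
qed

text \<open>Turning \<open>e\<close> moves the centre across the plane of \<open>c\<close> and \<open>e\<close> in both directions, so no
  contact point can lie off that plane.\<close>

lemma propagate_step:
  assumes c: "norm c = 1" and e: "norm e = 1" "e \<bullet> c = 0" "e \<bullet> w > 0"
    and C: "\<And>e. norm e = 1 \<Longrightarrow> e \<bullet> c = 0 \<Longrightarrow> e \<bullet> w > 0 \<Longrightarrow> ctr (arc_pt c e \<beta>)"
    and sb: "sin \<beta> \<noteq> 0"
  shows "arc_pt c e (\<beta> + \<theta>) \<in> range \<gamma>"
proof -
  define f where "f = c \<times> e"
  have f: "norm f = 1" "f \<bullet> c = 0" "f \<bullet> e = 0" "e \<bullet> f = 0"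
    using norm_cross_orthonormal[of c e] c e by (simp_all add: f_def dot_cross_self inner_commute)
  have ee: "e \<bullet> e = 1" using e by (simp add: norm_eq_1)
  \<comment> \<open>Rotation of the meridian about \<open>c\<close>. All nearby rotated centres are
    empty, so \<open>h\<close> below is maximal at 0, and its derivative there is sin \<beta> times
    the component of the contact point along \<open>f\<close>.\<close>
  define E where "E \<phi> = arc_pt e f \<phi>" for \<phi>
  have E: "norm (E \<phi>) = 1" "E \<phi> \<bullet> c = 0" for \<phi>
    using norm_arc_pt[of e f] e f by (auto simp: E_def arc_pt_def inner_add_left)
  have perp: "\<gamma> s \<bullet> f = 0" if s: "\<gamma> s \<bullet> arc_pt c e \<beta> = cos \<theta>" for s
  proof -
    define h where "h \<phi> = \<gamma> s \<bullet> arc_pt c (E \<phi>) \<beta>" for \<phi>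
    have "isCont (\<lambda>\<phi>. E \<phi> \<bullet> w) 0"
      unfolding E_def arc_pt_def by (intro continuous_intros)
    moreover have "E 0 \<bullet> w > 0"
      using e by (simp add: E_def arc_pt_def)
    ultimately have "\<forall>\<^sub>F \<phi> in at 0. E \<phi> \<bullet> w > 0"
      unfolding isCont_def by (rule order_tendstoD)
    then obtain d where d: "d > 0" "\<And>\<phi>. \<phi> \<noteq> 0 \<Longrightarrow> dist \<phi> 0 < d \<Longrightarrow> E \<phi> \<bullet> w > 0"
      by (auto simp: eventually_at)
    have h0: "h 0 = cos \<theta>" using s by (simp add: h_def E_def arc_pt_def)
    have "h \<phi> \<le> h 0" if "\<bar>0 - \<phi>\<bar> < d" for \<phi>
    proof (cases "\<phi> = 0")
      case False
      then have "ctr (arc_pt c (E \<phi>) \<beta>)"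
        using d that by (intro C E) (auto simp: dist_norm)
      then show ?thesis
        using ctrD(3) h0 by (simp add: h_def)
    qed simp
    moreover have "(h has_real_derivative sin \<beta> * (\<gamma> s \<bullet> f)) (at 0)"
      unfolding h_def arc_pt_def E_def inner_add_right inner_scaleR_right
      by (auto intro!: derivative_eq_intros)
    ultimately have "sin \<beta> * (\<gamma> s \<bullet> f) = 0"
      using d(1) DERIV_local_max by blast
    then show ?thesis using sb by simp
  qed
  \<comment> \<open>\<open>B\<close> points away from the pole along the meridian. It selects the
    outer of the two possible contacts, at \<beta> + \<theta> instead of \<beta> - \<theta>.\<close>
  define B where "B = arc_pt c e (\<beta> + pi / 2)"
  have "B \<bullet> arc_pt c e \<beta> = 0"
    using c e arc_pt_inner_same by (simp add: B_def)
  then obtain s where s: "\<gamma> s \<bullet> arc_pt c e \<beta> = cos \<theta>" "\<gamma> s \<bullet> B \<ge> 0"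
    using contact_in_halfspace[OF C[OF e], of B] by auto
  have "arc_pt c e (\<beta> - \<theta>) \<bullet> B = cos (\<theta> + pi / 2)"
    using arc_pt_inner_same[OF c e(2,1), of "\<beta> - \<theta>" "\<beta> + pi / 2"] cos_minus[of "\<theta> + pi / 2"]
    by (simp add: B_def algebra_simps)
  also have "\<dots> < 0"
    using sin_pos by (simp add: cos_add)
  finally have "\<gamma> s \<noteq> arc_pt c e (\<beta> - \<theta>)"
    using s(2) by auto
  then have "\<gamma> s = arc_pt c e (\<beta> + \<theta>)"
    using great_circle_at_distance[OF c e(1,2) unit _ s(1)] perp[OF s(1)] by (auto simp: f_def)
  then show ?thesis by (metis rangeI)
qed

text \<open>Centres occur at even and curve points at odd multiples of \<theta>. Each new curve
  point comes from \<open>propagate_step\<close>, each new centre by reflection in it. The bound on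
  \<open>i\<close> keeps the sine of the centre's angle nonzero in the step; at the pole itself
  \<open>base\<close> supplies the first half circle.\<close>

lemma propagate:
  assumes b: "base c w" and i: "i = 0 \<or> (2 * real i) * \<theta> < pi"
    and e: "norm e = 1" "e \<bullet> c = 0" "e \<bullet> w > 0"
  shows "arc_pt c e ((2 * real i + 1) * \<theta>) \<in> range \<gamma> \<and> ctr (arc_pt c e (2 * real i * \<theta>)) \<and>
    ctr (arc_pt c e ((2 * real i + 2) * \<theta>))"
  using i e
proof (induction i arbitrary: e)
  case 0
  have c: "norm c = 1" "ctr c" using b by (auto simp: base_def ctr_def)
  have wc: "w \<bullet> c = 0" "c \<bullet> w = 0" using b by (auto simp: base_def inner_commute)
  have "arc_pt c e \<theta> \<bullet> c = cos \<theta>" "arc_pt c e \<theta> \<bullet> w > 0"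
    using 0 c wc sin_pos by (simp_all add: arc_pt_def inner_add_left norm_eq_1)
  moreover have "norm (arc_pt c e \<theta>) = 1"
    using norm_arc_pt c 0 by blast
  ultimately obtain s where s: "arc_pt c e \<theta> = \<gamma> s"
    using b unfolding base_def by blast
  have "ctr ((2 * cos \<theta>) *\<^sub>R arc_pt c e \<theta> - c)"
    unfolding s using \<open>arc_pt c e \<theta> \<bullet> c = cos \<theta>\<close> c s by (intro ctr_opposite) auto
  moreover have "arc_pt c e (\<theta> - \<theta>) = c"
    by (simp add: arc_pt_def)
  ultimately show ?case
    using s c arc_pt_reflect[of \<theta> c e \<theta>] by (auto simp: arc_pt_def[of _ _ 0])
next
  case (Suc i)
  define \<beta> where "\<beta> = (2 * real i + 2) * \<theta>"
  have bpi: "0 < \<beta>" "\<beta> < pi"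
    using Suc.prems(1) th_pos by (auto simp: \<beta>_def algebra_simps intro!: add_pos_nonneg)
  have "2 * real i * \<theta> < pi"
    using bpi th_pos by (simp add: \<beta>_def algebra_simps)
  then have C: "ctr (arc_pt c e \<beta>)" if "norm e = 1" "e \<bullet> c = 0" "e \<bullet> w > 0" for e
    using Suc.IH that by (auto simp: \<beta>_def)
  have c: "norm c = 1" using b by (auto simp: base_def ctr_def)
  have "sin \<beta> \<noteq> 0" using sin_gt_zero[OF bpi] by simp
  then have r: "arc_pt c e (\<beta> + \<theta>) \<in> range \<gamma>"
    using propagate_step[OF c Suc.prems(2-4) C] by blast
  then obtain s where s: "arc_pt c e (\<beta> + \<theta>) = \<gamma> s" by auto
  have "\<gamma> s \<bullet> arc_pt c e \<beta> = cos \<theta>"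
    using arc_pt_inner_same[OF c Suc.prems(3,2), of "\<beta> + \<theta>" \<beta>] s by simp
  then have "ctr ((2 * cos \<theta>) *\<^sub>R \<gamma> s - arc_pt c e \<beta>)"
    by (rule ctr_opposite[OF C[OF Suc.prems(2-4)]])
  moreover have "(2 * cos \<theta>) *\<^sub>R \<gamma> s - arc_pt c e \<beta> = arc_pt c e (\<beta> + \<theta> + \<theta>)"
    using arc_pt_reflect[of \<theta> c e "\<beta> + \<theta>"] s by simp
  moreover have "(2 * real (Suc i) + 1) * \<theta> = \<beta> + \<theta>" "2 * real (Suc i) * \<theta> = \<beta>"
    "(2 * real (Suc i) + 2) * \<theta> = \<beta> + \<theta> + \<theta>"
    by (simp_all add: \<beta>_def algebra_simps)
  ultimately show ?case
    using r C[OF Suc.prems(2-4)] by simp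
qed

text \<open>A second direction on the open side, linearly independent of \<open>w\<close>; the
  triple 3, 4, 5 keeps its norm rational.\<close>

lemma base_two_directions:
  assumes "base c w"
  obtains e where "norm e = 1" "e \<bullet> c = 0" "e \<bullet> w = 3 / 5" "e = (3 / 5) *\<^sub>R w + (4 / 5) *\<^sub>R (c \<times> w)"
proof -
  have c: "norm c = 1" "norm w = 1" "w \<bullet> c = 0" "c \<bullet> w = 0" "w \<bullet> w = 1"
    using assms by (auto simp: base_def ctr_def inner_commute norm_eq_1)
  define f where "f = c \<times> w"
  have f: "f \<bullet> f = 1" "f \<bullet> c = 0" "f \<bullet> w = 0" "w \<bullet> f = 0"
    using norm_cross_orthonormal[of c w] c by (simp_all add: f_def dot_cross_self norm_eq_1)
  define e where "e = (3 / 5) *\<^sub>R w + (4 / 5) *\<^sub>R f"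
  have "norm e = 1" "e \<bullet> c = 0" "e \<bullet> w = 3 / 5"
    using c f by (simp_all add: e_def norm_eq_1 inner_add_left inner_add_right)
  then show thesis
    using that by (simp add: e_def f_def)
qed

text \<open>On one meridian the curve point and the centre are exactly \<theta> apart. If their
  sines had opposite signs, a pole would lie between them, and turning one of them to another
  meridian would bring them closer than \<theta>.\<close>

lemma adjacent_sines:
  assumes b: "base c w"
    and r: "\<And>e. norm e = 1 \<Longrightarrow> e \<bullet> c = 0 \<Longrightarrow> e \<bullet> w > 0 \<Longrightarrow> arc_pt c e \<alpha> \<in> range \<gamma>"
    and C: "\<And>e. norm e = 1 \<Longrightarrow> e \<bullet> c = 0 \<Longrightarrow> e \<bullet> w > 0 \<Longrightarrow> ctr (arc_pt c e \<beta>)"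
    and ab: "\<beta> = \<alpha> + \<theta> \<or> \<beta> = \<alpha> - \<theta>"
  shows "sin \<alpha> * sin \<beta> \<ge> 0"
proof -
  have c: "norm c = 1" "norm w = 1" "w \<bullet> c = 0" "w \<bullet> w = 1"
    using b by (auto simp: base_def ctr_def norm_eq_1)
  obtain e where e: "norm e = 1" "e \<bullet> c = 0" "e \<bullet> w = 3 / 5"
    using base_two_directions[OF b] by metis
  obtain s where s: "arc_pt c e \<alpha> = \<gamma> s"
    using r[of e] e by auto
  have "\<gamma> s \<bullet> arc_pt c w \<beta> \<le> cos \<theta>"
    using ctrD(3)[OF C[of w]] c by simp
  then have "cos \<alpha> * cos \<beta> + sin \<alpha> * sin \<beta> * (3 / 5) \<le> cos \<theta>"
    using arc_pt_inner[OF c(1) e(2) c(3), of \<alpha> \<beta>] s e by simp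
  moreover have "cos \<theta> = cos (\<alpha> - \<beta>)"
    using ab by auto
  ultimately show ?thesis
    by (simp add: cos_diff)
qed

text \<open>Take the last even multiple of \<theta> below pi. If the next one overshoots pi, the
  signs in \<open>adjacent_sines\<close> force the curve points in between to be at angle pi, all at
  \<open>- c\<close>. The tangent there is orthogonal to touching balls in independent directions
  and would vanish.\<close>

lemma base_angle:
  assumes b: "base c w" and th: "\<theta> < pi / 2"
  obtains n :: nat where "2 * real n * \<theta> = pi" "n > 0"
proof -
  define m where "m = (LEAST m :: nat. pi \<le> (2 * real m + 2) * \<theta>)"
  obtain k :: nat where "pi / \<theta> < real k"
    using reals_Archimedean2 by blast
  then have "pi \<le> real k * \<theta>"
    using th_pos by (simp add: field_simps)
  also have "\<dots> \<le> (2 * real k + 2) * \<theta>"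
    using th_pos by (intro mult_right_mono) auto
  finally have "pi \<le> (2 * real k + 2) * \<theta>" .
  then have m1: "pi \<le> (2 * real m + 2) * \<theta>"
    unfolding m_def by (rule LeastI)
  have m2: "2 * real m * \<theta> < pi" 
  proof (cases m)
    case (Suc k)
    then have "\<not> pi \<le> (2 * real k + 2) * \<theta>"
      using not_less_Least[of k "\<lambda>m. pi \<le> (2 * real m + 2) * \<theta>"] by (simp add: m_def)
    then show ?thesis using Suc by (simp add: algebra_simps)
  qed simp
  define \<alpha> where "\<alpha> = (2 * real m + 1) * \<theta>"
  have ab: "(2 * real m + 2) * \<theta> = \<alpha> + \<theta>" "2 * real m * \<theta> = \<alpha> - \<theta>"
    by (simp_all add: \<alpha>_def algebra_simps)
  have m3: "\<alpha> - \<theta> < pi"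
    using m2 unfolding ab .
  have P: "arc_pt c e \<alpha> \<in> range \<gamma> \<and> ctr (arc_pt c e (\<alpha> - \<theta>)) \<and> ctr (arc_pt c e (\<alpha> + \<theta>))"
    if "norm e = 1" "e \<bullet> c = 0" "e \<bullet> w > 0" for e
    using propagate[OF b disjI2[OF m2] that] unfolding ab \<alpha>_def[symmetric] by blast
  have "\<alpha> + \<theta> = pi"
  proof (rule ccontr)
    assume ne: "\<not> ?thesis"
    have bounds: "pi < \<alpha> + \<theta>" "\<alpha> - \<theta> < pi" "\<alpha> > 0"
      using m1 m3 ne th_pos unfolding ab by (auto simp: \<alpha>_def intro!: mult_pos_pos)
    have "sin (\<alpha> + \<theta>) < 0"
      using bounds th th_pos by (intro sin_lt_zero) auto
    moreover have "sin \<alpha> * sin (\<alpha> + \<theta>) \<ge> 0"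
      by (rule adjacent_sines[OF b]) (use P in auto)
    ultimately have s1: "sin \<alpha> \<le> 0"
      by (simp add: zero_le_mult_iff)
    then have a: "\<alpha> \<ge> pi"
      using sin_gt_zero[of \<alpha>] bounds by linarith
    then have "sin (\<alpha> - \<theta>) > 0"
      using bounds th by (intro sin_gt_zero) auto
    moreover have "sin \<alpha> * sin (\<alpha> - \<theta>) \<ge> 0"
      by (rule adjacent_sines[OF b]) (use P in auto)
    ultimately have "sin \<alpha> = 0"
      using s1 by (simp add: zero_le_mult_iff)
    moreover have "\<alpha> < pi + \<theta>" using bounds by simp
    ultimately have api: "\<alpha> = pi"
      using a sin_lt_zero[of \<alpha>] th by (cases "\<alpha> = pi") auto
    have c: "norm w = 1" "w \<bullet> c = 0" "w \<bullet> w = 1" "norm c = 1" "c \<bullet> w = 0"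
      using b by (auto simp: base_def norm_eq_1 ctr_def inner_commute)
    obtain e where e: "norm e = 1" "e \<bullet> c = 0" "e \<bullet> w = 3 / 5" "e = (3 / 5) *\<^sub>R w + (4 / 5) *\<^sub>R (c \<times> w)"
      using base_two_directions[OF b] by metis
    have "arc_pt c e \<alpha> = - c" for e
      by (simp add: api arc_pt_def)
    then obtain s where s: "\<gamma> s = - c"
      using P[of w] c by auto
    have perp: "\<tau> s \<bullet> x = 0" if x: "norm x = 1" "x \<bullet> c = 0" "x \<bullet> w > 0" for x
    proof -
      have "ctr (arc_pt c x (\<alpha> - \<theta>))"
        using P[of x] x by auto
      moreover have "\<gamma> s = arc_pt c x \<alpha>"
        by (simp add: s api arc_pt_def)
      then have "\<gamma> s \<bullet> arc_pt c x (\<alpha> - \<theta>) = cos \<theta>"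
        using arc_pt_inner_same[OF c(4) x(2,1)] by simp
      ultimately have "\<tau> s \<bullet> arc_pt c x (\<alpha> - \<theta>) = 0"
        by (rule touch(1))
      moreover have "\<tau> s \<bullet> c = 0"
        using gamma_tau(2)[of s] s by simp
      ultimately show ?thesis
        using sin_pos by (simp add: arc_pt_def api inner_add_right inner_diff_right)
    qed
    have "\<tau> s \<bullet> w = 0" "\<tau> s \<bullet> e = 0"
      using c e(1-3) by (auto intro!: perp)
    then have "\<tau> s \<bullet> w = 0" "\<tau> s \<bullet> (c \<times> w) = 0"
      by (auto simp: e(4) inner_add_right)
    moreover have "\<tau> s \<bullet> c = 0"
      using gamma_tau(2)[of s] s by simp
    ultimately have "\<tau> s = 0"
      using frame_expand[OF c(4,1,5), of "\<tau> s"] by simp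
    then show False using tau_unit[of s] by simp
  qed
  then have "2 * real (Suc m) * \<theta> = pi"
    by (simp add: \<alpha>_def algebra_simps)
  then show thesis using that by blast
qed

text \<open>The curve and the set of empty centres are closed, so the boundary meridians follow by a
  limit. The index \<open>j = n\<close> is the pole \<open>- c\<close>, obtained as the outer centre
  of the last step.\<close>

lemma base_closed_half:
  assumes b: "base c w" and th: "\<theta> < pi / 2" and n: "2 * real n * \<theta> = pi"
    and e: "norm e = 1" "e \<bullet> c = 0" "e \<bullet> w \<ge> 0"
  shows "i < n \<Longrightarrow> arc_pt c e ((2 * real i + 1) * \<theta>) \<in> range \<gamma>"
    and "j \<le> n \<Longrightarrow> ctr (arc_pt c e (2 * real j * \<theta>))"
proof -
  have c: "norm c = 1" "norm w = 1" "w \<bullet> c = 0"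
    using b by (auto simp: base_def ctr_def)
  have le: "2 * real i * \<theta> < pi" if "i < n" for i
    using that th_pos unfolding n[symmetric] by simp
  have npos: "n > 0" using n by (cases n) auto
  have op: "(i < n \<longrightarrow> arc_pt c e ((2 * real i + 1) * \<theta>) \<in> range \<gamma>) \<and>
      (j \<le> n \<longrightarrow> ctr (arc_pt c e (2 * real j * \<theta>)))"
    if e: "norm e = 1" "e \<bullet> c = 0" "e \<bullet> w > 0" for e i j
  proof (intro conjI impI)
    show "arc_pt c e ((2 * real i + 1) * \<theta>) \<in> range \<gamma>" if "i < n"
      using propagate[OF b _ e] le[OF that] by blast
    show "ctr (arc_pt c e (2 * real j * \<theta>))" if "j \<le> n"
    proof (cases "j < n")
      case True
      then show ?thesis using propagate[OF b _ e] le[OF True] by blast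
    next
      case False
      then have "j = n" using that by simp
      then obtain k where k: "j = Suc k" "k < n"
        using npos by (cases n) auto
      then have "ctr (arc_pt c e ((2 * real k + 2) * \<theta>))"
        using propagate[OF b _ e] le[OF k(2)] by blast
      then show ?thesis using k by (simp add: algebra_simps)
    qed
  qed
  have lim: "arc_pt c e u \<in> S"
    if S: "closed S" "\<And>e. norm e = 1 \<Longrightarrow> e \<bullet> c = 0 \<Longrightarrow> e \<bullet> w > 0 \<Longrightarrow> arc_pt c e u \<in> S" for u S
  proof (cases "e \<bullet> w > 0")
    case False
    then have ew: "e \<bullet> w = 0" "w \<bullet> e = 0" using e by (auto simp: inner_commute)
    \<comment> \<open>Rotating a boundary direction towards \<open>w\<close> enters the open side at
      once, and 0 is a limit of such angles.\<close>
    define F where "F h = arc_pt c (arc_pt e w h) u" for h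
    have "closed (F -` S)"
      unfolding F_def arc_pt_def by (intro closed_vimage S continuous_intros)
    moreover have "{0<..<pi} \<subseteq> F -` S"
    proof
      fix h assume h: "h \<in> {0<..<pi}"
      have "norm (arc_pt e w h) = 1" "arc_pt e w h \<bullet> c = 0"
        using norm_arc_pt[of e w h] e c ew by (auto simp: arc_pt_def inner_add_left)
      moreover have "arc_pt e w h \<bullet> w = sin h"
        using ew c by (simp add: arc_pt_def inner_add_left norm_eq_1)
      ultimately show "h \<in> F -` S"
        using S(2) h sin_gt_zero[of h] by (simp add: F_def)
    qed
    ultimately have "closure {0<..<pi} \<subseteq> F -` S"
      by (rule closure_minimal[rotated])
    moreover have "0 \<in> closure {0<..<pi}"
      by simp
    ultimately have "0 \<in> F -` S"
      by blast
    then show ?thesis by (simp add: F_def arc_pt_def)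
  qed (use S e in auto)
  show "arc_pt c e ((2 * real i + 1) * \<theta>) \<in> range \<gamma>" if "i < n"
    using op that by (intro lim closed_range) auto
  show "ctr (arc_pt c e (2 * real j * \<theta>))" if "j \<le> n"
    using lim[OF closed_ctr] op that by auto
qed

text \<open>On its own meridian a curve point keeps distance \<theta> from all centres at even
  multiples of \<theta>, including both poles. Only the odd multiples remain.\<close>

lemma base_hemisphere_arc:
  assumes b: "base c w" and th: "\<theta> < pi / 2" and n: "2 * real n * \<theta> = pi"
    and s: "\<gamma> s \<bullet> w \<ge> 0"
  obtains e i where "i < n" "norm e = 1" "e \<bullet> c = 0" "e \<bullet> w \<ge> 0"
    "\<gamma> s = arc_pt c e ((2 * real i + 1) * \<theta>)"
proof -
  have c: "norm c = 1" "norm w = 1" "w \<bullet> c = 0"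
    using b by (auto simp: base_def ctr_def)
  obtain e u where e: "norm e = 1" "e \<bullet> c = 0" "e \<bullet> w \<ge> 0" "\<gamma> s = arc_pt c e u"
    and u: "0 \<le> u" "u \<le> pi"
    using hemisphere_polar[OF c unit s] by metis
  have far: "\<not> \<bar>u - 2 * real j * \<theta>\<bar> < \<theta>" if "j \<le> n" for j
  proof
    assume a: "\<bar>u - 2 * real j * \<theta>\<bar> < \<theta>"
    have "cos (u - 2 * real j * \<theta>) \<le> cos \<theta>"
      using ctrD(3)[OF base_closed_half(2)[OF b th n e(1-3) that], of s]
        arc_pt_inner_same[OF c(1) e(2,1), of u "2 * real j * \<theta>"] e(4) by simp
    moreover have "cos \<theta> < cos \<bar>u - 2 * real j * \<theta>\<bar>"
      using a th_le by (intro cos_monotone_0_pi) auto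
    ultimately show False by (simp add: cos_abs_real)
  qed
  define i where "i = nat \<lfloor>u / (2 * \<theta>)\<rfloor>"
  have "0 \<le> u / (2 * \<theta>)" using u th_pos by simp
  then have "real i \<le> u / (2 * \<theta>)" "u / (2 * \<theta>) < real i + 1"
    unfolding i_def by linarith+
  then have i: "2 * real i * \<theta> \<le> u" "u < (2 * real i + 2) * \<theta>"
    using th_pos by (simp_all add: field_simps)
  have "2 * real i * \<theta> \<le> 2 * real n * \<theta>"
    using i u n by simp
  then have "i \<le> n" using th_pos by simp
  moreover have "i \<noteq> n"
    using far[of n] n i u th_pos by auto
  ultimately have "i < n" by simp
  have "\<not> \<bar>u - 2 * real i * \<theta>\<bar> < \<theta>" "\<not> \<bar>u - 2 * real (Suc i) * \<theta>\<bar> < \<theta>"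
    using far[of i] far[of "Suc i"] \<open>i < n\<close> by auto
  then have "u = (2 * real i + 1) * \<theta>"
    using i by (simp add: algebra_simps abs_if split: if_splits)
  then show thesis
    using that[OF \<open>i < n\<close> e(1-3)] e(4) by simp
qed

lemma base_hemisphere:
  assumes b: "base c w" and th: "\<theta> < pi / 2" and n: "2 * real n * \<theta> = pi"
    and x: "norm x = 1" "x \<bullet> w \<ge> 0"
  shows "x \<in> range \<gamma> \<longleftrightarrow> (\<exists>i<n. x \<bullet> c = cos ((2 * real i + 1) * \<theta>))"
proof -
  have c: "norm c = 1" "norm w = 1" "w \<bullet> c = 0"
    using b by (auto simp: base_def ctr_def)
  have arc_c: "arc_pt c e u \<bullet> c = cos u" if "norm e = 1" "e \<bullet> c = 0" for e u
    using arc_pt_inner_same[OF c(1) that(2,1), of u 0] by (simp add: arc_pt_def[of _ _ 0])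
  show ?thesis
  proof
    assume "\<exists>i<n. x \<bullet> c = cos ((2 * real i + 1) * \<theta>)"
    then obtain i where i: "i < n" "x \<bullet> c = cos ((2 * real i + 1) * \<theta>)"
      by auto
    obtain e u where e: "norm e = 1" "e \<bullet> c = 0" "e \<bullet> w \<ge> 0" "x = arc_pt c e u"
      and u: "0 \<le> u" "u \<le> pi"
      using hemisphere_polar[OF c x] by metis
    have "real i + 1 \<le> real n" using i by simp
    then have "(2 * real i + 1) * \<theta> \<le> 2 * real n * \<theta>"
      using th_pos by simp
    then have "u = (2 * real i + 1) * \<theta>"
      using cos_inj_pi[of u "(2 * real i + 1) * \<theta>"] u i n th_pos arc_c[OF e(1,2)] e(4) by simp
    then show "x \<in> range \<gamma>"
      using base_closed_half(1)[OF b th n e(1-3) i(1)] e(4) by simp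
  next
    assume "x \<in> range \<gamma>"
    then obtain s where s: "x = \<gamma> s" by auto
    obtain e i where "i < n" "norm e = 1" "e \<bullet> c = 0" "\<gamma> s = arc_pt c e ((2 * real i + 1) * \<theta>)"
      using base_hemisphere_arc[OF b th n, of s] x s by metis
    then show "\<exists>i<n. x \<bullet> c = cos ((2 * real i + 1) * \<theta>)"
      using arc_c s by auto
  qed
qed

end

subsection \<open>Normal great circles\<close>

text \<open>The parameter is nonnegative because the chain in \<open>full\<close> is indexed by
  natural numbers and runs in one direction.\<close>

lemma great_circle_param:
  assumes c: "norm c = 1" "norm e = 1" "e \<bullet> c = 0"
    and x: "norm x = 1" "x \<bullet> (c \<times> e) = 0"
  obtains u where "0 \<le> u" "x = arc_pt c e u"
proof -
  have ce: "c \<bullet> e = 0" using c by (simp add: inner_commute)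
  have "x \<bullet> x = (x \<bullet> c)\<^sup>2 + (x \<bullet> e)\<^sup>2"
    using frame_inner[OF c(1,2) ce, of x x] x by (simp add: power2_eq_square)
  then have "(x \<bullet> c)\<^sup>2 + (x \<bullet> e)\<^sup>2 = 1"
    using x by (simp add: norm_eq_1)
  then obtain u where u: "0 \<le> u" "x \<bullet> c = cos u" "x \<bullet> e = sin u"
    using sincos_total_2pi[of "x \<bullet> c" "x \<bullet> e"] by metis
  have "x = (x \<bullet> c) *\<^sub>R c + (x \<bullet> e) *\<^sub>R e + (x \<bullet> (c \<times> e)) *\<^sub>R (c \<times> e)"
    by (rule frame_expand[OF c(1,2) ce])
  also have "\<dots> = arc_pt c e u"
    unfolding u x(2) by (simp add: arc_pt_def)
  finally show thesis using that u by blast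
qed

lemma arc_pt_shift: "arc_pt c e (u + x) = arc_pt (arc_pt c e u) (arc_pt c e (u + pi / 2)) x"
  by (simp add: arc_pt_def cos_add sin_add algebra_simps)

lemma arc_pt_tangent:
  assumes "norm c = 1" "norm e = 1" "e \<bullet> c = 0"
  shows "norm (arc_pt c e (u + pi / 2)) = 1" "arc_pt c e (u + pi / 2) \<bullet> arc_pt c e u = 0"
  using norm_arc_pt arc_pt_inner_same assms by auto

lemma arc_pt_neg: "arc_pt c (- e) u = arc_pt c e (- u)"
  by (simp add: arc_pt_def)

context thick_curve
begin

text \<open>The tangent is orthogonal to the point and to the touching centre, which together span
  the plane of the great circle. So the curve crosses that circle at a right angle.\<close>

lemma chain_tangent:
  assumes c: "norm c = 1" "norm e = 1" "e \<bullet> c = 0"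
    and s: "\<gamma> s = arc_pt c e u" and C: "ctr (arc_pt c e u')" "u' = u + \<theta> \<or> u' = u - \<theta>"
  shows "\<tau> s = c \<times> e \<or> \<tau> s = - (c \<times> e)"
proof -
  define B where "B = arc_pt c e (u + pi / 2)"
  have B: "norm B = 1" "B \<bullet> \<gamma> s = 0" "\<gamma> s \<bullet> B = 0" "\<gamma> s \<times> B = c \<times> e"
    using arc_pt_tangent[OF c] arc_pt_cross[OF c(1,2)] unfolding B_def s by (auto simp: inner_commute)
  have "arc_pt c e u \<bullet> arc_pt c e u' = cos \<theta>"
    using arc_pt_inner_same[OF c(1,3,2), of u u'] C(2) by auto
  then have "\<tau> s \<bullet> arc_pt c e u' = 0"
    using touch(1)[OF C(1), of s] s by simp
  moreover obtain d where d: "u' = u + d" "sin d \<noteq> 0"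
    using C(2) sin_pos by (auto intro: that[of \<theta>] that[of "- \<theta>"])
  have "arc_pt c e u' = cos d *\<^sub>R \<gamma> s + sin d *\<^sub>R B"
    unfolding d B_def s by (subst arc_pt_shift) (simp only: arc_pt_def)
  ultimately have "\<tau> s \<bullet> B = 0"
    using d(2) by (simp add: inner_add_right)
  then show ?thesis
    using perp_plane_unit[OF unit[of s] B(1,3), of "\<tau> s"] B(4) tau_unit by simp
qed

text \<open>The normal great circle through \<open>p\<close> on which touching balls and curve points alternate for ever.\<close>

definition full :: "real^3 \<Rightarrow> real^3 \<Rightarrow> bool" where
  "full p \<nu> \<longleftrightarrow> norm p = 1 \<and> norm \<nu> = 1 \<and> \<nu> \<bullet> p = 0 \<and>
     (\<forall>i::nat. arc_pt p \<nu> (2 * real i * \<theta>) \<in> range \<gamma> \<and> ctr (arc_pt p \<nu> ((2 * real i + 1) * \<theta>)))"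

text \<open>Walk along the normal great circle from contact to antipodal contact. Where this first
  fails, a half circle appears with the current point strictly inside it, and the tangent there is
  still the initial one up to sign; the latter is how \<open>base_opposite\<close> tells this half
  circle from the old one.\<close>

lemma chain:
  assumes th: "\<theta> < pi / 2"
  shows "full (\<gamma> t) (\<gamma> t \<times> \<tau> t) \<or>
    (\<exists>s c w. base c w \<and> \<gamma> s \<bullet> w > 0 \<and> (\<tau> s = \<tau> t \<or> \<tau> s = - \<tau> t))"
proof (rule disjCI)
  assume neg: "\<not> (\<exists>s c w. base c w \<and> \<gamma> s \<bullet> w > 0 \<and> (\<tau> s = \<tau> t \<or> \<tau> s = - \<tau> t))"
  define p where "p = \<gamma> t"
  define \<nu> where "\<nu> = \<gamma> t \<times> \<tau> t"
  have fr: "norm p = 1" "norm \<nu> = 1" "\<nu> \<bullet> p = 0" "p \<times> \<nu> = - \<tau> t"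
    using unit norm_nu cross_gamma_nu by (auto simp: p_def \<nu>_def dot_cross_self)
  have "arc_pt p \<nu> (2 * real i * \<theta>) \<in> range \<gamma> \<and> ctr (arc_pt p \<nu> ((2 * real i + 1) * \<theta>))" for i
  proof (induction i)
    case 0
    have "arc_pt p \<nu> \<theta> = cc 1 t"
      by (simp add: arc_pt_def cc_def p_def \<nu>_def)
    then show ?case
      using ctr_cc[of 1 t] by (simp add: arc_pt_def[of _ _ 0] p_def)
  next
    case (Suc i)
    define u where "u = 2 * real i * \<theta>"
    have e: "(2 * real i + 1) * \<theta> = u + \<theta>" "2 * real (Suc i) * \<theta> = u + \<theta> + \<theta>"
      "(2 * real (Suc i) + 1) * \<theta> = u + \<theta> + \<theta> + \<theta>"
      by (simp_all add: u_def algebra_simps)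
    define C where "C = arc_pt p \<nu> (u + \<theta>)"
    have C: "ctr C" using Suc e(1) by (simp add: C_def)
    obtain s where s: "\<gamma> s = arc_pt p \<nu> u"
      using Suc by (auto simp: u_def)
    have ts: "\<tau> s = \<tau> t \<or> \<tau> s = - \<tau> t"
      using chain_tangent[OF fr(1-3) s C[unfolded C_def]] fr(4) by auto
    have sC: "\<gamma> s \<bullet> C = cos \<theta>"
      using arc_pt_inner_same[OF fr(1,3,2), of u "u + \<theta>"] by (simp add: s C_def)
    obtain \<sigma> where \<sigma>: "\<bar>\<sigma>\<bar> = 1" "C = cc \<sigma> s"
      using touch(2)[OF C sC] by blast
    have ant: "(2 * cos \<theta>) *\<^sub>R C - \<gamma> s = arc_pt p \<nu> (u + \<theta> + \<theta>)"
      using arc_pt_reflect[of \<theta> p \<nu> "u + \<theta>"] by (simp add: s C_def)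
    have r: "arc_pt p \<nu> (u + \<theta> + \<theta>) \<in> range \<gamma>"
    proof (rule ccontr)
      assume nr: "\<not> ?thesis"
      \<comment> \<open>Without the antipode, \<open>antipode_in_range\<close> yields contacts both
        ahead and behind.\<close>
      have "\<exists>q. \<gamma> q \<bullet> C = cos \<theta> \<and> d * (\<gamma> q \<bullet> \<tau> s) > 0" if "\<bar>d\<bar> = 1" for d
      proof (rule ccontr)
        assume "\<not> ?thesis"
        then have "(2 * cos \<theta>) *\<^sub>R C - \<gamma> s \<in> range \<gamma>"
          unfolding \<sigma>(2) using that by (intro antipode_in_range[OF \<sigma>(1), of d]) (auto simp: not_less)
        then show False using nr ant by simp
      qed
      from this[of 1] this[of "-1"] obtain q q'
        where q: "\<gamma> q \<bullet> C = cos \<theta>" "\<gamma> q \<bullet> \<tau> s > 0" "\<gamma> q' \<bullet> C = cos \<theta>" "\<gamma> q' \<bullet> \<tau> s < 0"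
        by auto
      obtain w where w: "base C w"
        using base_exists[OF \<sigma>(1) th, of q s] q \<sigma>(2) by auto
      then have w1: "norm w = 1" "w \<bullet> C = 0" "\<gamma> s \<bullet> w \<ge> 0" "\<gamma> q \<bullet> w \<ge> 0" "\<gamma> q' \<bullet> w \<ge> 0"
        using sC q unfolding base_def by auto
      \<comment> \<open>An end point of the half circle would have \<open>w\<close> as its tangent
        up to sign, and then \<open>q\<close> and \<open>q'\<close> would lie on different sides of
        it.\<close>
      have "\<gamma> s \<bullet> w \<noteq> 0"
      proof
        assume z: "\<gamma> s \<bullet> w = 0"
        have "w \<bullet> C = \<sigma> * sin \<theta> * (w \<bullet> (\<gamma> s \<times> \<tau> s))"
          using z by (simp add: \<sigma>(2) cc_def inner_add_right inner_commute)
        then have "w \<bullet> (\<gamma> s \<times> \<tau> s) = 0"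
          using w1(2) \<sigma>(1) sin_pos by auto
        then have "w = - \<tau> s \<or> w = \<tau> s"
          using perp_plane_unit[OF unit norm_nu(1)[of s], of s w] z w1(1)
          by (simp add: cross_gamma_nu dot_cross_self inner_commute)
        then show False
          using q w1 by auto
      qed
      then show False
        using neg w w1(3) ts by force
    qed
    then obtain s' where s': "\<gamma> s' = arc_pt p \<nu> (u + \<theta> + \<theta>)" by (metis rangeE)
    have "\<gamma> s' \<bullet> C = cos \<theta>"
      using arc_pt_inner_same[OF fr(1,3,2), of "u + \<theta> + \<theta>" "u + \<theta>"] by (simp add: s' C_def)
    then have "ctr ((2 * cos \<theta>) *\<^sub>R \<gamma> s' - C)"
      by (rule ctr_opposite[OF C])
    moreover have "(2 * cos \<theta>) *\<^sub>R \<gamma> s' - C = arc_pt p \<nu> (u + \<theta> + \<theta> + \<theta>)"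
      using arc_pt_reflect[of \<theta> p \<nu> "u + \<theta> + \<theta>"] unfolding s' C_def add_diff_cancel_right' .
    ultimately show ?case
      using r unfolding e by simp
  qed
  then show "full (\<gamma> t) (\<gamma> t \<times> \<tau> t)"
    using fr unfolding full_def p_def \<nu>_def by blast
qed

text \<open>\<omega> lies between two consecutive curve points of the chain, and \<delta> is its
  offset from the centre halfway between them. Reversing the direction \<open>H\<close> makes the
  offset nonnegative.\<close>

lemma full_local:
  assumes f: "full p \<nu>" and \<omega>: "norm \<omega> = 1" "\<omega> \<bullet> (p \<times> \<nu>) = 0"
  obtains H \<delta> where "0 \<le> \<delta>" "\<delta> \<le> \<theta>" "norm H = 1" "H \<bullet> \<omega> = 0"
    "\<omega> \<times> H = p \<times> \<nu> \<or> \<omega> \<times> H = - (p \<times> \<nu>)"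
    "ctr (arc_pt \<omega> H (- \<delta>))" "arc_pt \<omega> H (\<theta> - \<delta>) \<in> range \<gamma>" "arc_pt \<omega> H (- \<theta> - \<delta>) \<in> range \<gamma>"
proof -
  have fr: "norm p = 1" "norm \<nu> = 1" "\<nu> \<bullet> p = 0"
    using f by (auto simp: full_def)
  obtain x where x: "0 \<le> x" "\<omega> = arc_pt p \<nu> x"
    using great_circle_param[OF fr \<omega>] by metis
  define i where "i = nat \<lfloor>x / (2 * \<theta>)\<rfloor>"
  have "0 \<le> x / (2 * \<theta>)" using x th_pos by simp
  then have "real i \<le> x / (2 * \<theta>)" "x / (2 * \<theta>) < real i + 1"
    unfolding i_def by linarith+
  then have i: "2 * real i * \<theta> \<le> x" "x < (2 * real i + 2) * \<theta>"
    using th_pos by (simp_all add: field_simps)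
  define \<delta> where "\<delta> = x - (2 * real i + 1) * \<theta>"
  define H where "H = arc_pt p \<nu> (x + pi / 2)"
  have H: "norm H = 1" "H \<bullet> \<omega> = 0" "\<omega> \<times> H = p \<times> \<nu>"
    using arc_pt_tangent[OF fr] arc_pt_cross[OF fr(1,2)] unfolding H_def x(2) by auto
  have sh: "arc_pt \<omega> H y = arc_pt p \<nu> (x + y)" for y
    unfolding H_def x(2) by (rule arc_pt_shift[symmetric])
  have e: "x + - \<delta> = (2 * real i + 1) * \<theta>" "x + (\<theta> - \<delta>) = 2 * real (Suc i) * \<theta>"
    "x + (- \<theta> - \<delta>) = 2 * real i * \<theta>"
    by (simp_all add: \<delta>_def algebra_simps)
  have pts: "ctr (arc_pt \<omega> H (- \<delta>))" "arc_pt \<omega> H (\<theta> - \<delta>) \<in> range \<gamma>" "arc_pt \<omega> H (- \<theta> - \<delta>) \<in> range \<gamma>"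
    unfolding sh e using f unfolding full_def by blast+
  have d: "\<delta> \<le> \<theta>" "- \<theta> \<le> \<delta>"
    using i by (simp_all add: \<delta>_def algebra_simps)
  show thesis
  proof (cases "\<delta> \<ge> 0")
    case True
    then show thesis using that[of \<delta> H] H pts d by blast
  next
    case False
    show thesis
      by (rule that[of "- \<delta>" "- H"]) (use False H pts d in \<open>auto simp: arc_pt_neg\<close>)
  qed
qed

text \<open>Two different diameters of contacts would produce a half circle of contacts. Both ends
  of each diameter lie on its closed side, so \<open>w\<close> would be orthogonal to \<omega> and
  to both independent directions.\<close>

lemma no_crossing_centre:
  assumes th: "\<theta> < pi / 2" and \<omega>: "ctr \<omega>"
    and H: "norm H = 1" "H \<bullet> \<omega> = 0" and H': "norm H' = 1" "H' \<bullet> \<omega> = 0"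
    and r: "arc_pt \<omega> H \<theta> \<in> range \<gamma>" "arc_pt \<omega> H (- \<theta>) \<in> range \<gamma>"
      "arc_pt \<omega> H' \<theta> \<in> range \<gamma>" "arc_pt \<omega> H' (- \<theta>) \<in> range \<gamma>"
  shows "H' \<bullet> (\<omega> \<times> H) = 0"
proof (rule ccontr)
  assume ne: "H' \<bullet> (\<omega> \<times> H) \<noteq> 0"
  have n: "norm \<omega> = 1" "\<omega> \<bullet> H = 0" "\<omega> \<bullet> \<omega> = 1"
    using ctrD[OF \<omega>] H by (auto simp: inner_commute)
  obtain s where s: "\<gamma> s = arc_pt \<omega> H \<theta>" using r(1) by (metis rangeE)
  obtain q where q: "\<gamma> q = arc_pt \<omega> H' \<theta>" using r(3) by (metis rangeE)
  have on: "arc_pt \<omega> h x \<bullet> \<omega> = cos x" if "h \<bullet> \<omega> = 0" for h x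
    using that n by (simp add: arc_pt_def inner_add_left)
  have s\<omega>: "\<gamma> s \<bullet> \<omega> = cos \<theta>" "\<gamma> q \<bullet> \<omega> = cos \<theta>"
    unfolding s q using on H H' by auto
  obtain \<sigma> where \<sigma>: "\<bar>\<sigma>\<bar> = 1" "\<omega> = cc \<sigma> s"
    using touch(2)[OF \<omega> s\<omega>(1)] by blast
  have ts: "\<tau> s = \<omega> \<times> H \<or> \<tau> s = - (\<omega> \<times> H)"
    using chain_tangent[OF n(1) H s, of 0] \<omega> by (simp add: arc_pt_def)
  have "\<gamma> q \<bullet> (\<omega> \<times> H) = sin \<theta> * (H' \<bullet> (\<omega> \<times> H))"
    by (simp add: q arc_pt_def inner_add_left dot_cross_self)
  then have "\<gamma> q \<bullet> \<tau> s \<noteq> 0"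
    using ne ts sin_pos by auto
  then obtain w where w: "base \<omega> w"
    using base_exists[OF \<sigma>(1) th, of q s] s\<omega> \<sigma>(2) by auto
  have w1: "norm w = 1" "w \<bullet> \<omega> = 0" "\<omega> \<bullet> w = 0"
    using w by (auto simp: base_def inner_commute)
  have z: "h \<bullet> w = 0" if h: "h \<bullet> \<omega> = 0" "arc_pt \<omega> h \<theta> \<in> range \<gamma>" "arc_pt \<omega> h (- \<theta>) \<in> range \<gamma>" for h
  proof -
    have "arc_pt \<omega> h \<theta> \<bullet> w \<ge> 0" "arc_pt \<omega> h (- \<theta>) \<bullet> w \<ge> 0"
      using h on[OF h(1), of \<theta>] on[OF h(1), of "- \<theta>"] w unfolding base_def by auto
    then have "sin \<theta> * (h \<bullet> w) \<ge> 0" "sin \<theta> * (h \<bullet> w) \<le> 0"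
      using w1 by (simp_all add: arc_pt_def inner_add_left inner_diff_left)
    then show ?thesis
      using sin_pos by (simp add: zero_le_mult_iff mult_le_0_iff)
  qed
  have "w \<bullet> H = 0"
    using z[OF H(2) r(1,2)] by (simp add: inner_commute)
  then have "w = \<omega> \<times> H \<or> w = - (\<omega> \<times> H)"
    using perp_plane_unit[OF n(1) H(1) n(2)] w1 by blast
  moreover have "H' \<bullet> w = 0"
    using z[OF H'(2) r(3,4)] .
  ultimately show False
    using ne by auto
qed

text \<open>Great circles with non-parallel normals meet at some \<omega>. Comparing the two
  alternating patterns near \<omega> forces equal offsets, namely 0 or \<theta>: either \<omega> is
  a centre, excluded by \<open>no_crossing_centre\<close>, or a curve point with two different
  tangent lines.\<close>

lemma full_unique:
  assumes th: "\<theta> < pi / 2" and f: "full p \<nu>" and f': "full p' \<nu>'"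
  shows "\<bar>(p \<times> \<nu>) \<bullet> (p' \<times> \<nu>')\<bar> \<ge> 1"
proof (rule ccontr)
  define N where "N = p \<times> \<nu>"
  define N' where "N' = p' \<times> \<nu>'"
  assume "\<not> ?thesis"
  then have lt: "\<bar>N \<bullet> N'\<bar> < 1" by (simp add: N_def N'_def)
  have "norm N = 1" "norm N' = 1"
    using f f' unfolding full_def N_def N'_def by (auto intro!: norm_cross_orthonormal simp: inner_commute)
  then have "(norm (N \<times> N'))\<^sup>2 = 1 - (N \<bullet> N')\<^sup>2"
    by (simp add: norm_cross)
  moreover have "(N \<bullet> N')\<^sup>2 < 1"
    using lt by (simp add: abs_square_less_1)
  ultimately have nz: "N \<times> N' \<noteq> 0"
    by auto
  define \<omega> where "\<omega> = (N \<times> N') /\<^sub>R norm (N \<times> N')"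
  have \<omega>: "norm \<omega> = 1" "\<omega> \<bullet> N = 0" "\<omega> \<bullet> N' = 0"
    using nz by (simp_all add: \<omega>_def dot_cross_self)
  obtain H \<delta> where H: "0 \<le> \<delta>" "\<delta> \<le> \<theta>" "norm H = 1" "H \<bullet> \<omega> = 0"
    "\<omega> \<times> H = N \<or> \<omega> \<times> H = - N"
    "ctr (arc_pt \<omega> H (- \<delta>))" "arc_pt \<omega> H (\<theta> - \<delta>) \<in> range \<gamma>" "arc_pt \<omega> H (- \<theta> - \<delta>) \<in> range \<gamma>"
    using full_local[OF f \<omega>(1)] \<omega>(2) unfolding N_def by metis
  obtain H' \<delta>' where H': "0 \<le> \<delta>'" "\<delta>' \<le> \<theta>" "norm H' = 1" "H' \<bullet> \<omega> = 0"
    "\<omega> \<times> H' = N' \<or> \<omega> \<times> H' = - N'"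
    "ctr (arc_pt \<omega> H' (- \<delta>'))" "arc_pt \<omega> H' (\<theta> - \<delta>') \<in> range \<gamma>" "arc_pt \<omega> H' (- \<theta> - \<delta>') \<in> range \<gamma>"
    using full_local[OF f' \<omega>(1)] \<omega>(3) unfolding N'_def by metis
  have HH: "(\<omega> \<times> H) \<bullet> (\<omega> \<times> H') = H \<bullet> H'"
    using \<omega>(1) H(4) by (simp add: dot_cross norm_eq_1)
  then have k: "\<bar>H \<bullet> H'\<bar> < 1"
    using lt H(5) H'(5) by auto
  have perpne: "H' \<bullet> (\<omega> \<times> H) \<noteq> 0"
  proof
    assume z: "H' \<bullet> (\<omega> \<times> H) = 0"
    have "\<omega> \<bullet> H = 0" using H(4) by (simp add: inner_commute)
    then have "H' \<bullet> H' = (H' \<bullet> H)\<^sup>2"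
      using frame_inner[OF \<omega>(1) H(3), of H' H'] z H'(4) by (simp add: power2_eq_square)
    then have "(H \<bullet> H')\<^sup>2 = 1"
      using H'(3) by (simp add: norm_eq_1 inner_commute)
    then show False using k by (simp add: abs_square_eq_1)
  qed
  text \<open>Triangle inequality through \<open>\<omega>\<close>: the centre at distance \<open>\<delta>\<close> on one circle and the curve
    point at distance \<open>\<theta> - \<delta>'\<close> on the other are at most \<open>\<theta>\<close> apart.\<close>
  have key: "d = d' \<and> (d = 0 \<or> d = \<theta>)"
    if d: "0 \<le> d" "d \<le> d'" "d' \<le> \<theta>" and h: "norm h = 1" "h \<bullet> \<omega> = 0" "norm h' = 1" "h' \<bullet> \<omega> = 0"
      and hh: "\<bar>h \<bullet> h'\<bar> < 1"
      and c: "ctr (arc_pt \<omega> h (- d))" and r: "arc_pt \<omega> h' (\<theta> - d') \<in> range \<gamma>" for d d' h h'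
  proof -
    obtain s where s: "\<gamma> s = arc_pt \<omega> h' (\<theta> - d')" using r by (metis rangeE)
    have "\<gamma> s \<bullet> arc_pt \<omega> h (- d) = cos (\<theta> - d') * cos d - sin (\<theta> - d') * sin d * (h' \<bullet> h)"
      using arc_pt_inner[OF \<omega>(1) h(4) h(2), of "\<theta> - d'" "- d"] s by simp
    then have le1: "cos (\<theta> - d') * cos d - sin (\<theta> - d') * sin d * (h' \<bullet> h) \<le> cos \<theta>"
      using ctrD(3)[OF c, of s] by simp
    have "cos \<theta> \<le> cos (\<theta> - d' + d)"
      using d th_le by (intro cos_monotone_0_pi_le) auto
    then have "cos \<theta> \<le> cos (\<theta> - d') * cos d - sin (\<theta> - d') * sin d"
      by (simp add: cos_add)
    \<comment> \<open>As \<open>h\<close> and \<open>h'\<close> are not parallel, the triangle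
      inequality is strict unless one of its two short sides vanishes.\<close>
    then have "sin (\<theta> - d') * sin d * (1 - h' \<bullet> h) \<le> 0"
      using le1 by (simp add: algebra_simps)
    moreover have "1 - h' \<bullet> h > 0" using hh by (simp add: inner_commute abs_less_iff)
    moreover have "sin (\<theta> - d') \<ge> 0" "sin d \<ge> 0"
      using d th_le by (auto intro!: sin_ge_zero)
    ultimately have cs: "sin (\<theta> - d') = 0 \<or> sin d = 0"
      by (metis mult_pos_pos order_le_less not_le)
    have i1: "\<theta> - d' = 0" if "sin (\<theta> - d') = 0"
      using that d th_le th_pos sin_gt_zero[of "\<theta> - d'"] by fastforce
    have i2: "d = 0" if "sin d = 0"
      using that d th_le th_pos sin_gt_zero[of d] by fastforce
    have i3: "d = \<theta>" if "\<theta> - d' = 0"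
    proof -
      have "cos d \<le> cos \<theta>" using le1 that by simp
      then show ?thesis
        using cos_monotone_0_pi[of d \<theta>] d th_le by (cases "d < \<theta>") auto
    qed
    have i4: "d' = 0" if "d = 0"
    proof -
      have "cos (\<theta> - d') \<le> cos \<theta>" using le1 that by simp
      then show ?thesis
        using cos_monotone_0_pi[of "\<theta> - d'" \<theta>] d th_le by (cases "d' > 0") auto
    qed
    show ?thesis
      using cs
    proof
      assume "sin (\<theta> - d') = 0"
      then show ?thesis using i1 i3 by simp
    next
      assume "sin d = 0"
      then show ?thesis using i2 i4 by simp
    qed
  qed
  have "\<delta> = \<delta>' \<and> (\<delta> = 0 \<or> \<delta> = \<theta>)"
  proof (cases "\<delta> \<le> \<delta>'")
    case True
    show ?thesis
      using key[OF H(1) True H'(2) H(3,4) H'(3,4) k H(6) H'(7)] .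
  next
    case False
    then have "\<delta>' \<le> \<delta>" by simp
    then show ?thesis
      using key[OF H'(1) _ H(2) H'(3,4) H(3,4) _ H'(6) H(7)] k by (auto simp: inner_commute)
  qed
  then consider "\<delta> = 0" "\<delta>' = 0" | "\<delta> = \<theta>" "\<delta>' = \<theta>" by auto
  then show False
  proof cases
    case 1
    then have "ctr \<omega>" using H(6) by (simp add: arc_pt_def)
    then have "H' \<bullet> (\<omega> \<times> H) = 0"
      using no_crossing_centre[OF th _ H(3,4) H'(3,4)] H(7,8) H'(7,8) 1 by simp
    then show False using perpne by simp
  next
    case 2
    have "\<omega> \<in> range \<gamma>" using H(7) 2 by (simp add: arc_pt_def)
    then obtain s where s: "\<gamma> s = \<omega>" by (metis rangeE)
    have a: "\<gamma> s = arc_pt \<omega> h 0" for h by (simp add: s arc_pt_def)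
    have "\<omega> \<times> H = \<tau> s \<or> \<omega> \<times> H = - \<tau> s"
      using chain_tangent[OF \<omega>(1) H(3,4) a H(6)] 2 by auto
    moreover have "\<omega> \<times> H' = \<tau> s \<or> \<omega> \<times> H' = - \<tau> s"
      using chain_tangent[OF \<omega>(1) H'(3,4) a H'(6)] 2 by auto
    ultimately have "\<bar>(\<omega> \<times> H) \<bullet> (\<omega> \<times> H')\<bar> = \<bar>\<tau> s \<bullet> \<tau> s\<bar>"
      by (elim disjE) simp_all
    then show False using k HH by simp
  qed
qed

text \<open>Otherwise all normal great circles are full and hence coincide, so all tangents agree up
  to sign. The curve is then orthogonal to its own tangent direction and cannot move along
  it.\<close>

lemma exists_base:
  assumes th: "\<theta> < pi / 2"
  shows "\<exists>c w. base c w"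
proof (rule ccontr)
  assume "\<not> ?thesis"
  then have f: "full (\<gamma> t) (\<gamma> t \<times> \<tau> t)" for t
    using chain[OF th] by blast
  have "\<tau> t = \<tau> 0 \<or> \<tau> t = - \<tau> 0" for t
    using abs_inner_unit[OF tau_unit tau_unit] full_unique[OF th f f, of t 0]
    by (simp add: cross_gamma_nu)
  then have z: "\<gamma> t \<bullet> \<tau> 0 = 0" for t
    using gamma_tau(1)[of t] by (metis inner_minus_right neg_equal_0_iff_equal)
  have "((\<lambda>s. \<gamma> s \<bullet> \<tau> 0) has_real_derivative 0) (at 0)"
    unfolding z by simp
  then have "v 0 * (\<tau> 0 \<bullet> \<tau> 0) = 0"
    using DERIV_unique inner_der by blast
  then show False using v_pos[of 0] by simp
qed


subsection \<open>The opposite hemisphere\<close>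

lemma base_tangent:
  assumes b: "base c w" and th: "\<theta> < pi / 2" and s: "\<gamma> s \<bullet> w \<ge> 0"
  shows "\<tau> s \<bullet> c = 0"
proof -
  obtain n where n: "2 * real n * \<theta> = pi"
    using base_angle[OF b th] by metis
  obtain e i where e: "i < n" "norm e = 1" "e \<bullet> c = 0" "e \<bullet> w \<ge> 0"
    "\<gamma> s = arc_pt c e ((2 * real i + 1) * \<theta>)"
    using base_hemisphere_arc[OF b th n s] by metis
  have c: "norm c = 1" using b by (simp add: base_def ctr_def)
  have "ctr (arc_pt c e (2 * real i * \<theta>))"
    using base_closed_half(2)[OF b th n e(2-4), of i] e(1) by simp
  moreover have "2 * real i * \<theta> = (2 * real i + 1) * \<theta> - \<theta>"
    by (simp add: algebra_simps)
  ultimately have "\<tau> s = c \<times> e \<or> \<tau> s = - (c \<times> e)"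
    using chain_tangent[OF c e(2,3,5)] by metis
  then show ?thesis by (auto simp: dot_cross_self)
qed

text \<open>Since 4 n \<theta> is a full turn, periodicity and evenness of the cosine fold every odd
  multiple into the first n. This supplies the unbounded chain that \<open>full\<close> asks
  for.\<close>

lemma odd_multiple_cases:
  assumes n: "2 * real n * \<theta> = pi" and npos: "n > 0"
  shows "\<exists>j<n. cos ((2 * real i + 1) * \<theta>) = cos ((2 * real j + 1) * \<theta>)"
proof (induction i rule: less_induct)
  case (less i)
  consider "i < n" | "n \<le> i" "i < 2 * n" | "2 * n \<le> i" by linarith
  then show ?case
  proof cases
    case 2
    then have j: "2 * n - 1 - i < n" "real (2 * n - 1 - i) = 2 * real n - 1 - real i"
      by auto
    have "(2 * real (2 * n - 1 - i) + 1) * \<theta> = 2 * pi - (2 * real i + 1) * \<theta>"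
      unfolding j(2) n[symmetric] by (simp add: algebra_simps)
    then have "cos ((2 * real (2 * n - 1 - i) + 1) * \<theta>) = cos ((2 * real i + 1) * \<theta>)"
      by (simp add: cos_diff)
    then show ?thesis using j(1) by metis
  next
    case 3
    then have "real (i - 2 * n) = real i - 2 * real n" by simp
    then have "(2 * real (i - 2 * n) + 1) * \<theta> = (2 * real i + 1) * \<theta> - 2 * pi"
      unfolding n[symmetric] by (simp add: algebra_simps)
    then have "cos ((2 * real (i - 2 * n) + 1) * \<theta>) = cos ((2 * real i + 1) * \<theta>)"
      by (simp add: cos_diff)
    then show ?thesis
      using less[of "i - 2 * n"] 3 npos by auto
  qed auto
qed

text \<open>The boundary circle of the hemisphere passes through the end points of all its half
  circles. The chain starts at distance \<theta> from the pole because \<open>full\<close> begins at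
  a curve point, not at a centre.\<close>

lemma base_boundary_full:
  assumes b: "base c w" and th: "\<theta> < pi / 2"
  shows "full (arc_pt c (c \<times> w) \<theta>) (arc_pt c (c \<times> w) (\<theta> + pi / 2))"
proof -
  define e where "e = c \<times> w"
  have c: "norm c = 1" "norm w = 1" "w \<bullet> c = 0" "c \<bullet> w = 0" "ctr c"
    using b by (auto simp: base_def ctr_def inner_commute)
  have e: "norm e = 1" "e \<bullet> c = 0" "e \<bullet> w = 0"
    unfolding e_def using c by (auto simp: dot_cross_self intro!: norm_cross_orthonormal)
  obtain n where n: "2 * real n * \<theta> = pi" "n > 0"
    using base_angle[OF b th] by metis
  have r: "arc_pt c e ((2 * real i + 1) * \<theta>) \<in> range \<gamma>" for i
  proof -
    have "arc_pt c e u \<bullet> c = cos u" for u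
      using arc_pt_inner_same[OF c(1) e(2,1), of u 0] by (simp add: arc_pt_def[of _ _ 0])
    moreover have "arc_pt c e u \<bullet> w = 0" for u
      using c e by (simp add: arc_pt_def inner_add_left)
    ultimately show ?thesis
      using base_hemisphere[OF b th n(1) norm_arc_pt[OF c(1) e(2,1)]] odd_multiple_cases[OF n, of i]
      by simp
  qed
  have C: "ctr (arc_pt c e (2 * real i * \<theta>))" for i
  proof (induction i)
    case 0
    then show ?case using c by (simp add: arc_pt_def)
  next
    case (Suc i)
    define u where "u = (2 * real i + 1) * \<theta>"
    have e1: "2 * real i * \<theta> = u - \<theta>" "2 * real (Suc i) * \<theta> = u + \<theta>"
      by (simp_all add: u_def algebra_simps)
    obtain s where s: "\<gamma> s = arc_pt c e u"
      using r[of i] unfolding u_def by (metis rangeE)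
    have "\<gamma> s \<bullet> arc_pt c e (u - \<theta>) = cos \<theta>"
      using arc_pt_inner_same[OF c(1) e(2,1), of u "u - \<theta>"] by (simp add: s)
    then have "ctr ((2 * cos \<theta>) *\<^sub>R \<gamma> s - arc_pt c e (u - \<theta>))"
      using Suc unfolding e1 by (intro ctr_opposite)
    then show ?case
      unfolding e1 s arc_pt_reflect .
  qed
  have sh: "arc_pt (arc_pt c e \<theta>) (arc_pt c e (\<theta> + pi / 2)) x = arc_pt c e (\<theta> + x)" for x
    by (rule arc_pt_shift[symmetric])
  have e2: "\<theta> + 2 * real i * \<theta> = (2 * real i + 1) * \<theta>" "\<theta> + (2 * real i + 1) * \<theta> = 2 * real (Suc i) * \<theta>" for i
    by (simp_all add: algebra_simps)
  show ?thesis
    unfolding full_def e_def[symmetric] sh e2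
    using r C arc_pt_tangent[OF c(1) e(1,2)] norm_arc_pt[OF c(1) e(2,1)] by blast
qed

lemma moves_into_side:
  assumes "\<gamma> s \<bullet> w = 0" "\<tau> s \<bullet> w \<noteq> 0"
  shows "\<exists>d>0. (\<forall>h. 0 < h \<longrightarrow> h < d \<longrightarrow> \<gamma> (s + h) \<bullet> w > 0) \<or>
    (\<forall>h. 0 < h \<longrightarrow> h < d \<longrightarrow> \<gamma> (s - h) \<bullet> w > 0)"
proof -
  have "v s * (\<tau> s \<bullet> w) > 0 \<or> v s * (\<tau> s \<bullet> w) < 0"
    using v_pos[of s] assms by (auto simp: mult_less_0_iff zero_less_mult_iff)
  then show ?thesis
    using DERIV_pos_inc_right[OF inner_der, of s w] DERIV_neg_dec_left[OF inner_der, of s w] assms(1)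
    by auto
qed

text \<open>Where two such hemispheres overlap, the tangent is orthogonal to both poles. For
  non-parallel poles it would equal \<open>w\<close> up to sign near a boundary point of the first
  hemisphere, which keeps the curve from moving off that boundary. So the poles are parallel, and
  common contacts then align the half circles.\<close>

lemma base_unique:
  assumes th: "\<theta> < pi / 2" and b: "base c w" and b2: "base c2 w2"
  shows "w2 = w \<or> w2 = - w"
proof (rule ccontr)
  assume neg: "\<not> ?thesis"
  define e where "e = c \<times> w"
  have c: "norm c = 1" "norm w = 1" "w \<bullet> c = 0" "c \<bullet> w = 0" "c \<bullet> c = 1"
    using b by (auto simp: base_def ctr_def inner_commute norm_eq_1)
  have e: "norm e = 1" "e \<bullet> c = 0" "e \<bullet> w = 0" "c \<bullet> e = 0"
    unfolding e_def using c by (auto simp: dot_cross_self intro!: norm_cross_orthonormal)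
  have c2: "norm c2 = 1" "norm w2 = 1" "w2 \<bullet> c2 = 0"
    using b2 by (auto simp: base_def ctr_def)
  have cpos: "cos \<theta> > 0" using th th_pos by (intro cos_gt_zero) auto
  have nspan: "\<not> (w2 \<bullet> c = 0 \<and> w2 \<bullet> e = 0)"
  proof
    assume z: "w2 \<bullet> c = 0 \<and> w2 \<bullet> e = 0"
    have "c \<times> e = - w"
      using c unfolding e_def by (simp add: Lagrange)
    then show False
      using perp_plane_unit[OF c(1) e(1,4), of w2] z c2 neg by auto
  qed
  obtain n where n: "2 * real n * \<theta> = pi" "n > 0"
    using base_angle[OF b th] by metis
  have G: "arc_pt c h \<theta> \<in> range \<gamma>" "arc_pt c h (pi - \<theta>) \<in> range \<gamma>"
    if "h = e \<or> h = - e" for h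
  proof -
    have h: "norm h = 1" "h \<bullet> c = 0" "h \<bullet> w \<ge> 0" using that e by auto
    show "arc_pt c h \<theta> \<in> range \<gamma>"
      using base_closed_half(1)[OF b th n(1) h, of 0] n(2) by simp
    have "(2 * real (n - 1) + 1) * \<theta> = pi - \<theta>"
      using n by (simp add: of_nat_diff algebra_simps flip: n(1))
    then show "arc_pt c h (pi - \<theta>) \<in> range \<gamma>"
      using base_closed_half(1)[OF b th n(1) h, of "n - 1"] n(2) by simp
  qed
  \<comment> \<open>The end points of the first and last half circles have inner products a + b', a
    - b', - a + b' and - a - b' with \<open>w2\<close>; one is positive unless both terms vanish,
    which \<open>nspan\<close> excludes.\<close>
  have "\<exists>p. p \<in> range \<gamma> \<and> (\<exists>h u. (h = e \<or> h = - e) \<and> p = arc_pt c h u) \<and> p \<bullet> w2 > 0"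
  proof -
    define a where "a = cos \<theta> * (c \<bullet> w2)"
    define b' where "b' = sin \<theta> * (e \<bullet> w2)"
    have "a \<noteq> 0 \<or> b' \<noteq> 0"
      using nspan cpos sin_pos by (auto simp: a_def b'_def inner_commute)
    moreover have "arc_pt c e \<theta> \<bullet> w2 = a + b'" "arc_pt c (- e) \<theta> \<bullet> w2 = a - b'"
      "arc_pt c e (pi - \<theta>) \<bullet> w2 = - a + b'" "arc_pt c (- e) (pi - \<theta>) \<bullet> w2 = - a - b'"
      by (simp_all add: a_def b'_def arc_pt_def inner_add_left inner_diff_left)
    moreover have "a + b' > 0 \<or> a - b' > 0 \<or> - a + b' > 0 \<or> - a - b' > 0"
      using calculation(1) by linarith
    ultimately show ?thesis
      using G by (metis (no_types, lifting))
  qed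
  then obtain s h u where s: "\<gamma> s \<bullet> w2 > 0" "\<gamma> s = arc_pt c h u" "h = e \<or> h = - e"
    by (metis rangeE)
  have sw: "\<gamma> s \<bullet> w = 0"
    using s(2,3) c e by (auto simp: arc_pt_def inner_add_left inner_diff_left)
  have "\<tau> s \<bullet> c = 0" "\<tau> s \<bullet> c2 = 0"
    using base_tangent[OF b th, of s] base_tangent[OF b2 th, of s] sw s(1) by auto
  have tsw: "\<tau> s = w \<or> \<tau> s = - w"
  proof -
    obtain e' i where e': "i < n" "norm e' = 1" "e' \<bullet> c = 0" "e' \<bullet> w \<ge> 0"
      "\<gamma> s = arc_pt c e' ((2 * real i + 1) * \<theta>)"
      using base_hemisphere_arc[OF b th n(1), of s] sw order_refl by metis
    have "0 < (2 * real i + 1) * \<theta>" "(2 * real i + 1) * \<theta> < 2 * real n * \<theta>"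
      using e'(1) th_pos by (auto intro!: mult_strict_right_mono mult_pos_pos)
    then have "sin ((2 * real i + 1) * \<theta>) > 0"
      using n by (intro sin_gt_zero) auto
    moreover have "sin ((2 * real i + 1) * \<theta>) * (e' \<bullet> w) = 0"
      using sw e'(5) c by (simp add: arc_pt_def inner_add_left)
    ultimately have ew: "e' \<bullet> w = 0" by simp
    have "ctr (arc_pt c e' (2 * real i * \<theta>))"
      using base_closed_half(2)[OF b th n(1) e'(2-4), of i] e'(1) by simp
    moreover have "2 * real i * \<theta> = (2 * real i + 1) * \<theta> - \<theta>"
      by (simp add: algebra_simps)
    ultimately have "\<tau> s = c \<times> e' \<or> \<tau> s = - (c \<times> e')"
      using chain_tangent[OF c(1) e'(2,3,5)] by metis
    moreover have "w = c \<times> e' \<or> w = - (c \<times> e')"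
      using perp_plane_unit[OF c(1) e'(2), of w] e' ew c by (simp add: inner_commute)
    ultimately show ?thesis by auto
  qed
  then have wc2: "w \<bullet> c2 = 0"
    using \<open>\<tau> s \<bullet> c2 = 0\<close> by auto
  have "c2 = c \<or> c2 = - c"
  proof (rule ccontr)
    assume nc: "\<not> ?thesis"
    have "c2 \<bullet> e \<noteq> 0"
    proof
      assume z: "c2 \<bullet> e = 0"
      have "w \<times> e = c"
        unfolding e_def using c by (simp add: Lagrange inner_commute norm_eq_1)
      then show False
        using perp_plane_unit[OF c(2) e(1), of c2] e(3) z wc2 c2 nc by (simp add: inner_commute)
    qed
    have c2e: "c2 = (c2 \<bullet> c) *\<^sub>R c + (c2 \<bullet> e) *\<^sub>R e"
    proof -
      have "c \<times> e = - w"
        using c unfolding e_def by (simp add: Lagrange)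
      then show ?thesis
        using frame_expand[OF c(1) e(1,4), of c2] wc2 by (simp add: inner_commute)
    qed
    have "isCont (\<lambda>x. \<gamma> x \<bullet> w2) s"
      using gamma_cont by (intro continuous_intros) (simp add: continuous_on_eq_continuous_at)
    then have "\<forall>\<^sub>F x in at s. \<gamma> x \<bullet> w2 > 0"
      using s(1) unfolding isCont_def by (rule order_tendstoD)
    then obtain d1 where d1: "d1 > 0" "\<And>x. x \<noteq> s \<Longrightarrow> dist x s < d1 \<Longrightarrow> \<gamma> x \<bullet> w2 > 0"
      by (auto simp: eventually_at)
    have "\<tau> s \<bullet> w \<noteq> 0" using tsw c by (auto simp: norm_eq_1)
    then obtain d2 where d2: "d2 > 0"
      "(\<forall>h. 0 < h \<longrightarrow> h < d2 \<longrightarrow> \<gamma> (s + h) \<bullet> w > 0) \<or> (\<forall>h. 0 < h \<longrightarrow> h < d2 \<longrightarrow> \<gamma> (s - h) \<bullet> w > 0)"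
      using moves_into_side[OF sw] by auto
    define h where "h = min d1 d2 / 2"
    have h: "0 < h" "h < d1" "h < d2" using d1 d2 by (auto simp: h_def)
    then obtain x where x: "\<gamma> x \<bullet> w > 0" "\<gamma> x \<bullet> w2 > 0"
      using d2(2) d1(2)[of "s + h"] d1(2)[of "s - h"] by (auto simp: dist_norm)
    have t: "\<tau> x \<bullet> c = 0" "\<tau> x \<bullet> c2 = 0"
      using base_tangent[OF b th, of x] base_tangent[OF b2 th, of x] x by auto
    have "\<tau> x \<bullet> c2 = \<tau> x \<bullet> ((c2 \<bullet> c) *\<^sub>R c + (c2 \<bullet> e) *\<^sub>R e)"
      using c2e by simp
    then have "\<tau> x \<bullet> e = 0"
      using t \<open>c2 \<bullet> e \<noteq> 0\<close> by (simp add: inner_add_right)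
    moreover have "c \<times> e = - w"
      using c unfolding e_def by (simp add: Lagrange)
    ultimately have "\<tau> x = w \<or> \<tau> x = - w"
      using perp_plane_unit[OF c(1) e(1,4), of "\<tau> x"] t tau_unit by auto
    then have "\<gamma> x \<bullet> w = 0"
      by (metis gamma_tau(1) inner_minus_right neg_equal_0_iff_equal)
    then show False using x by simp
  qed
  moreover from this have cw2: "c \<bullet> w2 = 0"
    using c2(3) by (auto simp: inner_commute)
  \<comment> \<open>The two end points of the first half circle (of the last one if c2 = - c) are
    contacts of the ball about \<open>c2\<close>, so both \<open>e\<close> and \<open>- e\<close>
    lie on the closed side of \<open>w2\<close>.\<close>
  ultimately have "e \<bullet> w2 = 0"
  proof (elim disjE)
    assume cc: "c2 = c"
    have "h \<bullet> w2 \<ge> 0" if h: "h = e \<or> h = - e" for h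
    proof -
      have "arc_pt c h \<theta> \<bullet> c2 = cos \<theta>"
        using h c e cc by (auto simp: arc_pt_def inner_add_left inner_diff_left)
      then have "arc_pt c h \<theta> \<bullet> w2 \<ge> 0"
        using b2 G(1)[OF h] unfolding base_def by (metis rangeE)
      then show ?thesis
        using cw2 sin_pos by (simp add: arc_pt_def inner_add_left zero_le_mult_iff)
    qed
    from this[of e] this[of "- e"] show ?thesis by simp
  next
    assume cc: "c2 = - c"
    have "h \<bullet> w2 \<ge> 0" if h: "h = e \<or> h = - e" for h
    proof -
      have "arc_pt c h (pi - \<theta>) \<bullet> c2 = cos \<theta>"
        using h c e cc by (auto simp: arc_pt_def inner_add_left inner_diff_left)
      then have "arc_pt c h (pi - \<theta>) \<bullet> w2 \<ge> 0"
        using b2 G(2)[OF h] unfolding base_def by (metis rangeE)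
      then show ?thesis
        using cw2 sin_pos by (simp add: arc_pt_def inner_add_left inner_diff_left zero_le_mult_iff)
    qed
    from this[of e] this[of "- e"] show ?thesis by simp
  qed
  moreover have "w2 \<bullet> c = 0"
    using \<open>c2 = c \<or> c2 = - c\<close> c2 by auto
  ultimately show False
    using nspan by (simp add: inner_commute)
qed

text \<open>Across the boundary the curve has a point whose tangent is not orthogonal to
  \<open>c\<close>. Its normal great circle cannot be full, since it would have to be the boundary
  circle. So \<open>chain\<close> gives another half circle, and the tangent there rules out
  \<open>w\<close>.\<close>

lemma base_opposite:
  assumes th: "\<theta> < pi / 2" and b: "base c w"
  shows "\<exists>c2. base c2 (- w)"
proof -
  define e where "e = c \<times> w"
  have c: "norm c = 1" "norm w = 1" "w \<bullet> c = 0" "c \<bullet> w = 0" "ctr c"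
    using b by (auto simp: base_def ctr_def inner_commute)
  have e: "norm e = 1" "e \<bullet> c = 0" "e \<bullet> w = 0"
    unfolding e_def using c by (auto simp: dot_cross_self intro!: norm_cross_orthonormal)
  have ce: "c \<times> e = - w"
    using c unfolding e_def by (simp add: Lagrange norm_eq_1)
  obtain n where n: "2 * real n * \<theta> = pi" "n > 0"
    using base_angle[OF b th] by metis
  have "arc_pt c e \<theta> \<in> range \<gamma>"
    using base_closed_half(1)[OF b th n(1) e(1,2), of 0] e n(2) by simp
  then obtain s where s: "\<gamma> s = arc_pt c e \<theta>" by (metis rangeE)
  have sc: "\<gamma> s \<bullet> c = cos \<theta>" and sw: "\<gamma> s \<bullet> (- w) = 0"
    using c e by (simp_all add: s arc_pt_def inner_add_left norm_eq_1)
  have "\<tau> s = c \<times> e \<or> \<tau> s = - (c \<times> e)"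
    using chain_tangent[OF c(1) e(1,2) s, of 0] c(5) by (simp add: arc_pt_def)
  then have tw: "\<tau> s \<bullet> (- w) \<noteq> 0"
    using c ce by (auto simp: norm_eq_1)
  have off: "\<gamma> x \<bullet> c \<noteq> cos \<theta>" if "\<gamma> x \<bullet> (- w) > 0" for x
    using b that unfolding base_def by force
  obtain d where d: "d > 0"
    "(\<forall>h. 0 < h \<longrightarrow> h < d \<longrightarrow> \<gamma> (s + h) \<bullet> (- w) > 0) \<or> (\<forall>h. 0 < h \<longrightarrow> h < d \<longrightarrow> \<gamma> (s - h) \<bullet> (- w) > 0)"
    using moves_into_side[OF sw tw] by auto
  \<comment> \<open>Beyond \<open>s\<close> the curve leaves the circle about \<open>c\<close>,
    whose contacts all lie on the side of \<open>w\<close>; the mean value theorem for the height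
    over \<open>c\<close> finds the point. Which side of \<open>s\<close> is beyond depends on the
    orientation.\<close>
  have "\<exists>t. \<gamma> t \<bullet> (- w) > 0 \<and> \<tau> t \<bullet> c \<noteq> 0"
    using d(2)
  proof
    assume p: "\<forall>h. 0 < h \<longrightarrow> h < d \<longrightarrow> \<gamma> (s + h) \<bullet> (- w) > 0"
    obtain z where z: "s < z" "z < s + d / 2"
      "\<gamma> (s + d / 2) \<bullet> c - \<gamma> s \<bullet> c = (s + d / 2 - s) * (v z * (\<tau> z \<bullet> c))"
      using MVT2[of s "s + d / 2" "\<lambda>x. \<gamma> x \<bullet> c" "\<lambda>x. v x * (\<tau> x \<bullet> c)"] inner_der d(1) by auto
    have "\<gamma> (s + d / 2) \<bullet> c \<noteq> cos \<theta>"
      using off p d(1) by simp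
    then have "\<tau> z \<bullet> c \<noteq> 0"
      using z(3) sc by auto
    moreover have "\<gamma> z \<bullet> (- w) > 0"
      using p[rule_format, of "z - s"] z d(1) by simp
    ultimately show ?thesis by blast
  next
    assume p: "\<forall>h. 0 < h \<longrightarrow> h < d \<longrightarrow> \<gamma> (s - h) \<bullet> (- w) > 0"
    obtain z where z: "s - d / 2 < z" "z < s"
      "\<gamma> s \<bullet> c - \<gamma> (s - d / 2) \<bullet> c = (s - (s - d / 2)) * (v z * (\<tau> z \<bullet> c))"
      using MVT2[of "s - d / 2" s "\<lambda>x. \<gamma> x \<bullet> c" "\<lambda>x. v x * (\<tau> x \<bullet> c)"] inner_der d(1) by auto
    have "\<gamma> (s - d / 2) \<bullet> c \<noteq> cos \<theta>"
      using off p d(1) by simp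
    then have "\<tau> z \<bullet> c \<noteq> 0"
      using z(3) sc by auto
    moreover have "\<gamma> z \<bullet> (- w) > 0"
      using p[rule_format, of "s - z"] z d(1) by simp
    ultimately show ?thesis by blast
  qed
  then obtain t where t: "\<gamma> t \<bullet> (- w) > 0" "\<tau> t \<bullet> c \<noteq> 0" by blast
  have "\<not> full (\<gamma> t) (\<gamma> t \<times> \<tau> t)"
  proof
    assume f: "full (\<gamma> t) (\<gamma> t \<times> \<tau> t)"
    have "arc_pt c e \<theta> \<times> arc_pt c e (\<theta> + pi / 2) = - w"
      using arc_pt_cross[OF c(1) e(1)] ce by simp
    then have "\<bar>\<tau> t \<bullet> w\<bar> \<ge> 1"
      using full_unique[OF th f base_boundary_full[OF b th]]
      by (simp add: cross_gamma_nu e_def)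
    then have "\<tau> t = w \<or> \<tau> t = - w"
      using abs_inner_unit tau_unit c by blast
    then show False using t(2) c by auto
  qed
  then obtain s' c' w' where s': "base c' w'" "\<gamma> s' \<bullet> w' > 0" "\<tau> s' = \<tau> t \<or> \<tau> s' = - \<tau> t"
    using chain[OF th] by blast
  have "w' \<noteq> w"
  proof
    assume "w' = w"
    then have "\<tau> s' \<bullet> c = 0"
      using base_tangent[OF b th, of s'] s' by simp
    then show False using s'(3) t(2) by auto
  qed
  then have "w' = - w"
    using base_unique[OF th b s'(1)] by simp
  then show ?thesis using s' by blast
qed

end

subsection \<open>The explicit curves\<close>

lemma cos_eq_cases:
  fixes x y :: real
  assumes "cos y = cos x"
  shows "\<exists>m::int. y = x + 2 * pi * of_int m \<or> y = - x + 2 * pi * of_int m"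
proof -
  have "(sin y)\<^sup>2 = (sin x)\<^sup>2"
    using assms sin_cos_squared_add[of x] sin_cos_squared_add[of y] by (metis add_right_cancel)
  then have "sin y = sin x \<or> sin y = sin (- x)"
    by (simp add: power2_eq_iff)
  then show ?thesis
    using assms sin_cos_eq_iff[of y x] sin_cos_eq_iff[of y "- x"] by auto
qed

text \<open>cos (N arccos x) is the Chebyshev polynomial of degree N, so its value depends on an
  angle only through the cosine.\<close>

lemma cos_nat_mult_arccos_cos: "cos (real N * arccos (cos a)) = cos (real N * a)"
proof -
  obtain m :: int where "arccos (cos a) = a + 2 * pi * of_int m \<or> arccos (cos a) = - a + 2 * pi * of_int m"
    using cos_eq_cases[of "arccos (cos a)" a] by (auto simp: cos_arccos)
  then show ?thesis
  proof
    assume "arccos (cos a) = a + 2 * pi * of_int m"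
    then have "real N * arccos (cos a) = real N * a + 2 * pi * of_int (int N * m)"
      by (simp only: of_int_mult of_int_of_nat_eq algebra_simps)
    then show ?thesis
      using sin_cos_eq_iff by blast
  next
    assume "arccos (cos a) = - a + 2 * pi * of_int m"
    then have "real N * arccos (cos a) = - (real N * a) + 2 * pi * of_int (int N * m)"
      by (simp only: of_int_mult of_int_of_nat_eq algebra_simps)
    then show ?thesis
      using sin_cos_eq_iff by (metis cos_minus)
  qed
qed

lemma frame_rotation:
  fixes a b :: "real^3"
  assumes "norm a = 1" "norm b = 1" "a \<bullet> b = 0"
  obtains Q where "rotation_matrix Q"
    "\<And>y. Q *v y = y $ 1 *\<^sub>R a + y $ 2 *\<^sub>R b + y $ 3 *\<^sub>R (a \<times> b)"
proof -
  define A :: "real^3^3" where "A = vector [a, b, a \<times> b]"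
  have A: "A $ 1 = a" "A $ 2 = b" "A $ 3 = a \<times> b"
    by (simp_all add: A_def)
  have "column i (transpose A) = A $ i" for i
    by (simp add: column_def transpose_def vec_eq_iff)
  then have "orthogonal_matrix (transpose A)"
    unfolding orthogonal_matrix_orthonormal_columns
    using assms norm_cross_orthonormal[OF assms]
    by (auto simp: forall_3 A orthogonal_def dot_cross_self inner_commute)
  moreover have "det (transpose A) = 1"
  proof -
    have "det (transpose A) = a \<bullet> (b \<times> (a \<times> b))"
      by (simp add: A_def dot_cross_det)
    also have "\<dots> = 1"
      using assms by (simp add: Lagrange inner_diff_right norm_eq_1 inner_commute)
    finally show ?thesis .
  qed
  moreover have "transpose A *v y = y $ 1 *\<^sub>R a + y $ 2 *\<^sub>R b + y $ 3 *\<^sub>R (a \<times> b)" for y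
    by (simp add: matrix_vector_mult_def transpose_def vec_eq_iff sum_3 A mult.commute)
  ultimately show thesis
    using that[of "transpose A"] by (auto simp: rotation_matrix_def)
qed

text \<open>\<open>\<gamma>\<^bsub>n,k\<^esub>\<close> in a frame where \<open>c\<close> is the north pole and \<open>- w\<close> points east.\<close>

definition ropes :: "real^3 \<Rightarrow> real^3 \<Rightarrow> nat \<Rightarrow> nat \<Rightarrow> (real^3) set" where
  "ropes c w n k = {x. norm x = 1 \<and>
     (x \<bullet> w \<ge> 0 \<and> (\<exists>i<n. x \<bullet> c = cos ((2 * real i + 1) * (pi / (2 * real n)))) \<or>
      x \<bullet> w \<le> 0 \<and> (\<exists>i<n. x \<bullet> arc_pt c (c \<times> w) (2 * real k * (pi / (2 * real n)))
        = cos ((2 * real i + 1) * (pi / (2 * real n)))))}"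

lemma latitude_circle_iff:
  assumes "i < n"
  shows "y \<in> latitude_circle n i \<longleftrightarrow> norm y = 1 \<and> y $ 3 = cos ((2 * real i + 1) * (pi / (2 * real n)))"
proof -
  define a where "a = (2 * real i + 1) * (pi / (2 * real n))"
  have "(2 * real i + 1) * pi \<le> (2 * real n) * pi"
    using assms by (intro mult_right_mono) auto
  then have a: "0 \<le> a" "a \<le> pi"
    using assms by (auto simp: a_def field_simps)
  have "\<bar>y $ 3\<bar> \<le> 1" if "norm y = 1"
    using component_le_norm_cart[of y 3] that by simp
  then have "arccos (y $ 3) = a \<longleftrightarrow> y $ 3 = cos a" if "norm y = 1"
    using that a arccos_cos[of a] cos_arccos_abs[of "y $ 3"] by auto
  moreover have "y \<in> latitude_circle n i \<longleftrightarrow> norm y = 1 \<and> arccos (y $ 3) = a"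
    by (simp add: latitude_circle_def sphere_dist_def inner_axis a_def)
  ultimately show ?thesis
    unfolding a_def[symmetric] by blast
qed

lemma rot_e1_inverse: "rot_e1 \<alpha> (rot_e1 (- \<alpha>) y) = y"
proof -
  have s: "cos \<alpha> * cos \<alpha> + sin \<alpha> * sin \<alpha> = 1"
    using sin_cos_squared_add3[of \<alpha>] by simp
  have "cos \<alpha> * (cos \<alpha> * y $ 2 + sin \<alpha> * y $ 3) - sin \<alpha> * (cos \<alpha> * y $ 3 - sin \<alpha> * y $ 2)
      = (cos \<alpha> * cos \<alpha> + sin \<alpha> * sin \<alpha>) * y $ 2"
    "sin \<alpha> * (cos \<alpha> * y $ 2 + sin \<alpha> * y $ 3) + cos \<alpha> * (cos \<alpha> * y $ 3 - sin \<alpha> * y $ 2)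
      = (cos \<alpha> * cos \<alpha> + sin \<alpha> * sin \<alpha>) * y $ 3"
    by (simp_all only: algebra_simps)
  then show ?thesis
    unfolding s by (simp add: rot_e1_def vec_eq_iff forall_3)
qed

lemma norm_rot_e1: "norm (rot_e1 \<alpha> y) = norm y"
proof -
  have s: "cos \<alpha> * cos \<alpha> + sin \<alpha> * sin \<alpha> = 1"
    using sin_cos_squared_add3[of \<alpha>] by simp
  have sq: "(p * a - q * b) * (p * a - q * b) + (q * a + p * b) * (q * a + p * b)
      = (p * p + q * q) * (a * a + b * b)" for a b p q :: real
    by (simp add: algebra_simps)
  have "rot_e1 \<alpha> y \<bullet> rot_e1 \<alpha> y = y $ 1 * y $ 1 +
      ((cos \<alpha> * y $ 2 - sin \<alpha> * y $ 3) * (cos \<alpha> * y $ 2 - sin \<alpha> * y $ 3) +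
       (sin \<alpha> * y $ 2 + cos \<alpha> * y $ 3) * (sin \<alpha> * y $ 2 + cos \<alpha> * y $ 3))"
    by (simp only: rot_e1_def inner_vec_def sum_3 vector_3 inner_real_def add.assoc)
  also have "\<dots> = y \<bullet> y"
    unfolding sq s by (simp add: inner_vec_def sum_3)
  finally show ?thesis by (simp add: norm_eq)
qed

lemma gamma_curve_iff:
  fixes y :: "real^3" and n k :: nat
  defines "\<alpha> \<equiv> 2 * real k * (pi / (2 * real n))"
  shows "y \<in> gamma_curve n k \<longleftrightarrow> norm y = 1 \<and>
    (y $ 1 \<le> 0 \<and> (\<exists>i<n. y $ 3 = cos ((2 * real i + 1) * (pi / (2 * real n)))) \<or>
     y $ 1 \<ge> 0 \<and> (\<exists>i<n. cos \<alpha> * y $ 3 - sin \<alpha> * y $ 2 = cos ((2 * real i + 1) * (pi / (2 * real n)))))"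
proof -
  define z where "z = rot_e1 (- \<alpha>) y"
  have "z $ 1 = y $ 1" "z $ 3 = cos \<alpha> * y $ 3 - sin \<alpha> * y $ 2"
    by (simp_all add: z_def rot_e1_def)
  moreover have "norm z = norm y" "rot_e1 \<alpha> z = y"
    unfolding z_def by (rule norm_rot_e1 rot_e1_inverse)+
  ultimately have z: "z $ 1 = y $ 1" "z $ 3 = cos \<alpha> * y $ 3 - sin \<alpha> * y $ 2"
    "norm z = norm y" "rot_e1 \<alpha> z = y" by blast+
  have "rot_e1 (- \<alpha>) (rot_e1 \<alpha> x) = x" for x
    using rot_e1_inverse[of "- \<alpha>" x] by simp
  then have im: "y \<in> rot_e1 \<alpha> ` S \<longleftrightarrow> z \<in> S" for S
    by (metis image_iff z(4) z_def)
  have "y \<in> west_hemisphere \<inter> (\<Union>i<n. latitude_circle n i) \<longleftrightarrow>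
      norm y = 1 \<and> y $ 1 \<le> 0 \<and> (\<exists>i<n. y $ 3 = cos ((2 * real i + 1) * (pi / (2 * real n))))"
    using latitude_circle_iff by (auto simp: west_hemisphere_def)
  moreover have "z \<in> east_hemisphere \<inter> (\<Union>i<n. latitude_circle n i) \<longleftrightarrow>
      norm z = 1 \<and> z $ 1 \<ge> 0 \<and> (\<exists>i<n. z $ 3 = cos ((2 * real i + 1) * (pi / (2 * real n))))"
    using latitude_circle_iff by (auto simp: east_hemisphere_def)
  ultimately show ?thesis
    unfolding gamma_curve_def Un_iff \<alpha>_def[symmetric] im z by blast
qed

text \<open>The positively oriented frame (- w, w \<times> c, c) plays the role of the standard
  basis. East is \<open>- w\<close>, and c \<times> w = - f reproduces the sign of the sine in
  \<open>rot_e1\<close>.\<close>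

lemma ropes_congruent:
  assumes c: "norm c = 1" "norm w = 1" "w \<bullet> c = 0"
  shows "sphere_congruent (ropes c w n k) (gamma_curve n k)"
proof -
  define f where "f = w \<times> c"
  have f: "norm f = 1" "(- w) \<bullet> f = 0" "f \<bullet> c = 0" "c \<bullet> f = 0"
    unfolding f_def using norm_cross_orthonormal[OF c(2,1,3)] by (simp_all add: dot_cross_self)
  have wf: "(- w) \<times> f = c"
    using c by (simp add: f_def Lagrange norm_eq_1 inner_commute)
  have nw: "norm (- w) = 1" using c by simp
  obtain Q where Q: "rotation_matrix Q" "\<And>y. Q *v y = y $ 1 *\<^sub>R (- w) + y $ 2 *\<^sub>R f + y $ 3 *\<^sub>R c"
    using frame_rotation[OF nw f(1,2)] wf by metis
  have co: "(Q *v y) \<bullet> (- w) = y $ 1" "(Q *v y) \<bullet> f = y $ 2" "(Q *v y) \<bullet> c = y $ 3" for y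
  proof -
    have "c \<bullet> c = 1" "w \<bullet> w = 1" "f \<bullet> f = 1" "w \<bullet> c = 0" "c \<bullet> w = 0" "f \<bullet> c = 0" "c \<bullet> f = 0"
      "w \<bullet> f = 0" "f \<bullet> w = 0"
      using c f by (auto simp: norm_eq_1 inner_commute)
    then show "(Q *v y) \<bullet> (- w) = y $ 1" "(Q *v y) \<bullet> f = y $ 2" "(Q *v y) \<bullet> c = y $ 3"
      by (simp_all add: Q(2) inner_add_left inner_diff_left)
  qed
  have e: "c \<times> w = - f"
    unfolding f_def by (rule cross_skew)
  have iff: "Q *v y \<in> ropes c w n k \<longleftrightarrow> y \<in> gamma_curve n k" for y
  proof -
    have "(Q *v y) \<bullet> (Q *v y) = y \<bullet> y"
      using frame_inner[OF nw f(1,2), of "Q *v y" "Q *v y"] unfolding wf co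
      by (simp add: inner_vec_def sum_3)
    then have "norm (Q *v y) = norm y" by (simp add: norm_eq)
    moreover have "(Q *v y) \<bullet> w = - y $ 1"
      using co(1)[of y] by simp
    moreover have "(Q *v y) \<bullet> arc_pt c (c \<times> w) \<alpha> = cos \<alpha> * y $ 3 - sin \<alpha> * y $ 2" for \<alpha>
      using co(2,3)[of y] by (simp add: e arc_pt_def inner_diff_right)
    ultimately show ?thesis
      unfolding ropes_def gamma_curve_iff mem_Collect_eq by (simp add: co(3))
  qed
  have "x \<in> (\<lambda>y. Q *v y) ` gamma_curve n k" if "x \<in> ropes c w n k" for x
  proof -
    define y :: "real^3" where "y = vector [x \<bullet> (- w), x \<bullet> f, x \<bullet> c]"
    have "Q *v y = x"
      using frame_expand[OF nw f(1,2), of x] unfolding wf Q(2) y_def vector_3 by (rule sym)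
    then show ?thesis
      using iff[of y] that by (metis imageI)
  qed
  then have "ropes c w n k = (\<lambda>y. Q *v y) ` gamma_curve n k"
    using iff by auto
  then show ?thesis
    unfolding sphere_congruent_def using Q(1) by blast
qed

text \<open>A common divisor \<open>g \<ge> 2\<close> gives a continuous function with finitely many values on the
  curve, \<open>cos (n u / g)\<close> in the angle \<open>u\<close> from the pole, that separates the first two parallels.\<close>

lemma ropes_connected_coprime:
  assumes c: "norm c = 1" "norm w = 1" "w \<bullet> c = 0"
    and n: "n > 0" and conn: "connected (ropes c w n k)"
  shows "gcd k n = 1"
proof (rule ccontr)
  assume g1: "gcd k n \<noteq> 1"
  define g where "g = gcd k n"
  have "g > 0" using n by (simp add: g_def)
  then have g2: "g \<ge> 2" using g1 unfolding g_def by linarith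
  define \<theta> where "\<theta> = pi / (2 * real n)"
  define e where "e = c \<times> w"
  define c2 where "c2 = arc_pt c e (2 * real k * \<theta>)"
  have cw: "c \<bullet> w = 0" "c \<bullet> c = 1" using c by (auto simp: inner_commute norm_eq_1)
  have e: "norm e = 1" "e \<bullet> c = 0" "e \<bullet> w = 0"
    unfolding e_def using c cw by (auto simp: dot_cross_self intro!: norm_cross_orthonormal)
  have ce: "c \<times> e = - w"
    using cw c unfolding e_def by (simp add: Lagrange)
  have c2: "norm c2 = 1"
    unfolding c2_def by (rule norm_arc_pt[OF c(1) e(2,1)])
  obtain N where N: "n = g * N" using gcd_dvd2[of k n] unfolding g_def by (elim dvdE)
  obtain K where K: "k = g * K" using gcd_dvd1[of k n] unfolding g_def by (elim dvdE)
  have Npos: "N > 0" using N n by (cases N) auto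
  have N\<theta>: "real N * \<theta> = pi / (2 * real g)"
    using Npos N by (simp add: \<theta>_def)
  have NK: "real N * (2 * real k * \<theta>) = real K * pi"
    using Npos N K g2 by (simp add: \<theta>_def)
  define F where "F p x = cos (real N * arccos (x \<bullet> p))" for p x :: "real^3"
  define R where "R = ropes c w n k"
  define W where "W = R \<inter> {x. x \<bullet> w \<ge> 0}"
  define E where "E = R \<inter> {x. x \<bullet> w \<le> 0}"
  have Runit: "norm x = 1" if "x \<in> R" for x
    using that by (simp add: R_def ropes_def)
  have bdd: "- 1 \<le> x \<bullet> p \<and> x \<bullet> p \<le> 1" if "x \<in> R" "norm p = 1" for x p
    using Cauchy_Schwarz_ineq2[of x p] Runit[OF that(1)] that(2) by (simp add: abs_le_iff)
  have contF: "continuous_on S (F p)" if "S \<subseteq> R" "norm p = 1" for S p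
    unfolding F_def using bdd that by (intro continuous_intros) auto
  \<comment> \<open>On the boundary circle the pole \<open>c2\<close> shifts the angle by 2 k
    \<theta>, hence N times the angle by K pi; the factor (-1)^K compensates and makes the two
    pieces agree.\<close>
  define f where "f x = (if x \<in> W then F c x else (-1) ^ K * F c2 x)" for x
  have agree: "F c x = (-1) ^ K * F c2 x" if x: "x \<in> W" "x \<in> E" for x
  proof -
    have "x \<bullet> (c \<times> e) = 0" "norm x = 1"
      using x Runit by (auto simp: W_def E_def ce)
    then obtain u where u: "x = arc_pt c e u"
      using great_circle_param[OF c(1) e(1,2)] by metis
    have "x \<bullet> c = cos u"
      using arc_pt_inner_same[OF c(1) e(2,1), of u 0] by (simp add: u arc_pt_def[of _ _ 0])
    then have "F c x = cos (real N * u)"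
      by (simp add: F_def cos_nat_mult_arccos_cos)
    moreover have "x \<bullet> c2 = cos (u - 2 * real k * \<theta>)"
      using arc_pt_inner_same[OF c(1) e(2,1)] by (simp add: u c2_def)
    then have "F c2 x = cos (real N * (u - 2 * real k * \<theta>))"
      unfolding F_def by (simp only: cos_nat_mult_arccos_cos)
    then have "F c2 x = cos (real N * u - real K * pi)"
      unfolding right_diff_distrib NK .
    then have "F c2 x = (-1) ^ K * cos (real N * u)"
      by (simp add: cos_diff mult.commute)
    ultimately show ?thesis
      by (simp flip: power_mult_distrib)
  qed
  have clW: "closedin (top_of_set R) W" "closedin (top_of_set R) E"
    unfolding W_def E_def
    by (auto intro!: closedin_closed_Int closed_Collect_le continuous_intros)
  have "continuous_on (W \<union> E) (\<lambda>x. if x \<in> W then F c x else (-1) ^ K * F c2 x)"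
    using agree clW
    by (intro continuous_on_cases_local) (auto intro!: contF continuous_intros c c2 simp: W_def E_def
        elim: closedin_subset_trans)
  moreover have "W \<union> E = R" by (auto simp: W_def E_def)
  ultimately have "connected (f ` R)"
    using conn unfolding f_def R_def by (intro connected_continuous_image) auto
  moreover have "f ` R \<subseteq> (\<lambda>i. cos (real N * arccos (cos ((2 * real i + 1) * \<theta>)))) ` {..<n} \<union>
      (\<lambda>i. (-1) ^ K * cos (real N * arccos (cos ((2 * real i + 1) * \<theta>)))) ` {..<n}"
  proof
    fix y assume "y \<in> f ` R"
    then obtain x where x: "x \<in> R" "y = f x" by auto
    show "y \<in> (\<lambda>i. cos (real N * arccos (cos ((2 * real i + 1) * \<theta>)))) ` {..<n} \<union>
      (\<lambda>i. (-1) ^ K * cos (real N * arccos (cos ((2 * real i + 1) * \<theta>)))) ` {..<n}"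
    proof (cases "\<exists>i<n. x \<bullet> c = cos ((2 * real i + 1) * \<theta>) \<and> x \<bullet> w \<ge> 0")
      case True
      then show ?thesis
        using x by (auto simp: f_def F_def W_def)
    next
      case False
      then obtain i where i: "i < n" "x \<bullet> w \<le> 0" "x \<bullet> c2 = cos ((2 * real i + 1) * \<theta>)"
        using x(1) unfolding R_def ropes_def \<theta>_def[symmetric] e_def[symmetric] c2_def[symmetric] by auto
      have "f x = (-1) ^ K * F c2 x"
        using agree[of x] x i by (auto simp: f_def E_def)
      then show ?thesis
        using i x by (auto simp: F_def)
    qed
  qed
  then have "finite (f ` R)"
    by (rule finite_subset) auto
  ultimately have sing: "f ` R = {} \<or> (\<exists>a. f ` R = {a})"
    using connected_finite_iff_sing by blast
  have "n \<ge> 2"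
    using N Npos g2 by (metis dual_order.trans le_add1 mult_le_mono2 mult.right_neutral Suc_leI One_nat_def)
  have val: "arc_pt c e ((2 * real i + 1) * \<theta>) \<in> R"
    "f (arc_pt c e ((2 * real i + 1) * \<theta>)) = cos ((2 * real i + 1) * (pi / (2 * real g)))" if "i < n" for i
  proof -
    define x where "x = arc_pt c e ((2 * real i + 1) * \<theta>)"
    have x: "norm x = 1" "x \<bullet> w = 0" "x \<bullet> c = cos ((2 * real i + 1) * \<theta>)"
      using norm_arc_pt[OF c(1) e(2,1)] cw e by (simp_all add: x_def arc_pt_def inner_add_left)
    then show xR: "x \<in> R"
      using that unfolding R_def ropes_def \<theta>_def[symmetric] by auto
    have "f x = cos (real N * ((2 * real i + 1) * \<theta>))"
      using xR x by (simp add: f_def W_def F_def cos_nat_mult_arccos_cos)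
    also have "real N * ((2 * real i + 1) * \<theta>) = (2 * real i + 1) * (real N * \<theta>)"
      by simp
    finally show "f x = cos ((2 * real i + 1) * (pi / (2 * real g)))"
      unfolding N\<theta> .
  qed
  have "f p = f q" if "p \<in> R" "q \<in> R" for p q
    using sing that by (metis empty_iff imageI singletonD)
  moreover have "0 < n" "1 < n" using \<open>n \<ge> 2\<close> by auto
  \<comment> \<open>Connectedness and finiteness make \<open>f\<close> constant, but the first two
    parallels give the angles pi / (2 g) and 3 pi / (2 g), which g \<ge> 2 keeps in the interval
    where the cosine is injective.\<close>
  ultimately have "cos ((2 * real 0 + 1) * (pi / (2 * real g))) = cos ((2 * real 1 + 1) * (pi / (2 * real g)))"
    using val by metis
  then have "cos (pi / (2 * real g)) = cos (3 * (pi / (2 * real g)))" by simp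
  moreover have "0 < pi / (2 * real g)" "3 * (pi / (2 * real g)) \<le> pi"
    using g2 by (auto simp: field_simps)
  ultimately show False
    using cos_monotone_0_pi[of "pi / (2 * real g)" "3 * (pi / (2 * real g))"] by simp
qed

text \<open>All three points lie on the circle of radius sin \<theta> about \<open>c\<close>, whose
  Euclidean centre is cos \<theta> times \<open>c\<close>. Taking two of them diametrically opposite
  puts this centre visibly in the affine hull.\<close>

lemma thickness_le_three_points:
  assumes c: "norm c = 1" "norm w = 1" "w \<bullet> c = 0" and th: "0 < \<theta>" "\<theta> \<le> pi / 2"
    and A: "arc_pt c w \<theta> \<in> A" "arc_pt c (c \<times> w) \<theta> \<in> A" "arc_pt c (- (c \<times> w)) \<theta> \<in> A"
  shows "thickness A \<le> ereal (sin \<theta>)"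
proof -
  define e where "e = c \<times> w"
  have cw: "c \<bullet> w = 0" "c \<bullet> c = 1" "w \<bullet> w = 1" using c by (auto simp: inner_commute norm_eq_1)
  have e: "norm e = 1" "e \<bullet> e = 1" "e \<bullet> c = 0" "e \<bullet> w = 0" "w \<bullet> e = 0"
    unfolding e_def using c cw norm_cross_orthonormal[of c w] by (auto simp: dot_cross_self norm_eq_1)
  have sp: "sin \<theta> > 0" using th by (intro sin_gt_zero) auto
  define x where "x = arc_pt c e \<theta>"
  define y where "y = arc_pt c (- e) \<theta>"
  define z where "z = arc_pt c w \<theta>"
  have yx: "y - x = - ((sin \<theta> + sin \<theta>) *\<^sub>R e)" and zx: "z - x = sin \<theta> *\<^sub>R (w - e)"
    unfolding scaleR_add_left by (simp_all add: x_def y_def z_def arc_pt_def scaleR_diff_right)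
  have "e \<times> w \<noteq> 0"
    using norm_cross_orthonormal[OF e(1) c(2) e(4)] by auto
  then have "(y - x) \<times> (z - x) \<noteq> 0"
    unfolding yx zx cross_minus_left cross_mult_left cross_mult_right Cross3.right_diff_distrib
    using sp by auto
  then have nc: "\<not> collinear {x, y, z}"
    using collinear_3[of y x z] by (simp add: cross_eq_0 insert_commute)
  have ne: "x \<noteq> y" "y \<noteq> z" "z \<noteq> x"
    using nc by (auto simp: collinear_2 insert_commute)
  define m where "m = cos \<theta> *\<^sub>R c"
  have "x + y = m + m"
    by (simp add: m_def x_def y_def arc_pt_def)
  then have "m = (1 / 2) *\<^sub>R x + (1 / 2) *\<^sub>R y + 0 *\<^sub>R z"
    by (simp flip: scaleR_add_right)
  then have hull: "m \<in> affine hull {x, y, z}"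
    unfolding affine_hull_3 mem_Collect_eq
    by (intro exI[of _ "1 / 2"] exI[of _ "1 / 2"] exI[of _ 0]) auto
  have d: "dist m (arc_pt c h \<theta>) = sin \<theta>" if "norm h = 1" for h
    using that sp by (simp add: m_def arc_pt_def dist_norm)
  have "circumradius x y z = ereal (sin \<theta>)"
  proof -
    have "(THE r. \<exists>c \<in> affine hull {x, y, z}. dist c x = r \<and> dist c y = r \<and> dist c z = r) = sin \<theta>"
    proof (rule the1_equality[OF circumradius_unique[OF nc]], rule bexI[OF _ hull])
      show "dist m x = sin \<theta> \<and> dist m y = sin \<theta> \<and> dist m z = sin \<theta>"
        unfolding x_def y_def z_def using d[of e] d[of "- e"] d[of w] e(1) c(2) by simp
    qed
    then show ?thesis using nc by (simp add: circumradius_def)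
  qed
  moreover have "thickness A \<le> circumradius x y z"
    unfolding thickness_def using A ne
    by (intro Inf_lower) (auto simp: x_def y_def z_def e_def)
  ultimately show ?thesis by simp
qed

section \<open>From the hypotheses on thickness and area to touching balls\<close>

lemma thick_curve_of_closed_curve:
  fixes \<gamma> :: "real \<Rightarrow> real^3"
  assumes th: "0 < \<theta>" "\<theta> \<le> pi / 2" and cl: "closed_spherical_curve \<gamma>"
    and thick: "thickness (range \<gamma>) \<ge> ereal (sin \<theta>)"
    and area: "sphere_area (spherical_tube \<theta> (range \<gamma>)) = 4 * pi"
  shows "\<exists>\<tau> v. thick_curve \<theta> \<gamma> \<tau> v"
proof -
  define D where "D t = vector_derivative \<gamma> (at t)" for t
  define v where "v t = norm (D t)" for t
  define \<tau> where "\<tau> t = D t /\<^sub>R v t" for t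
  have per: "\<gamma> (t + 2 * pi) = \<gamma> t" and nz: "D t \<noteq> 0" and unit: "norm (\<gamma> t) = 1" for t
    using cl by (auto simp: closed_spherical_curve_def D_def image_subset_iff)
  have C1: "\<And>t. \<gamma> differentiable at t" "continuous_on UNIV D"
    using cl by (auto simp: closed_spherical_curve_def C1_differentiable_on_eq D_def)
  have der: "(\<gamma> has_vector_derivative D t) (at t)" for t
    using C1(1)[of t] unfolding D_def by (simp add: vector_derivative_works)
  have vp: "v t > 0" for t using nz by (simp add: v_def)
  have D: "v t *\<^sub>R \<tau> t = D t" for t using vp[of t] by (simp add: \<tau>_def)
  have tu: "norm (\<tau> t) = 1" for t using vp[of t] by (simp add: \<tau>_def v_def)
  have \<tau>cont: "continuous_on UNIV \<tau>"
    unfolding \<tau>_def v_def using C1(2) nz by (intro continuous_intros) auto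
  have gcont: "continuous_on UNIV \<gamma>"
    by (intro continuous_at_imp_continuous_on ballI has_vector_derivative_continuous[OF der])
  have gt: "\<gamma> t \<bullet> \<tau> t = 0" for t
  proof -
    have "((\<lambda>s. \<gamma> s \<bullet> \<gamma> t) has_derivative (\<lambda>h. (h *\<^sub>R D t) \<bullet> \<gamma> t)) (at t)"
      using der[of t, unfolded has_vector_derivative_def] by (rule has_derivative_inner_left)
    then have "((\<lambda>s. \<gamma> s \<bullet> \<gamma> t) has_real_derivative D t \<bullet> \<gamma> t) (at t)"
      unfolding has_field_derivative_def by (rule has_derivative_eq_rhs) (auto simp: mult_ac)
    moreover have "\<gamma> s \<bullet> \<gamma> t \<le> \<gamma> t \<bullet> \<gamma> t" for s
      using norm_cauchy_schwarz[of "\<gamma> s" "\<gamma> t"] unit by (simp add: norm_eq_1)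
    ultimately have "D t \<bullet> \<gamma> t = 0"
      using DERIV_local_max[of _ _ t 1] by simp
    then show ?thesis by (simp add: \<tau>_def inner_commute)
  qed
  have cos0: "cos \<theta> \<ge> 0" using th by (intro cos_ge_zero) auto
  have sin0: "sin \<theta> \<ge> 0" using th by (intro sin_ge_zero) auto
  have F1: "cos \<theta> * (\<gamma> s \<bullet> \<gamma> t) + sin \<theta> * \<bar>\<gamma> s \<bullet> (\<gamma> t \<times> \<tau> t)\<bar> \<le> cos \<theta>" for s t
  proof (cases "\<gamma> s = \<gamma> t")
    case True
    then show ?thesis using unit[of t] by (simp add: dot_cross_self norm_eq_1)
  next
    case False
    define N where "N = D t \<times> (\<gamma> s - \<gamma> t)"
    define M where "M = \<tau> t \<times> (\<gamma> s - \<gamma> t)"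
    \<comment> \<open>In coordinates of the frame at \<open>t\<close>, \<open>thick_tangent\<close>
      says that c squared is at most cos \<theta> squared times ((1 - a) squared + c squared).
      Moving the last term to the left gives the square of the claim.\<close>
    define a where "a = \<gamma> s \<bullet> \<gamma> t"
    define b where "b = \<gamma> s \<bullet> \<tau> t"
    define c where "c = \<gamma> s \<bullet> (\<gamma> t \<times> \<tau> t)"
    have gg: "\<gamma> r \<bullet> \<gamma> r = 1" for r using unit[of r] by (simp add: norm_eq_1)
    have N: "N = v t *\<^sub>R M"
      unfolding N_def M_def D[symmetric] by (rule cross_mult_left)
    have "(\<gamma> t \<bullet> N)\<^sup>2 \<le> (cos \<theta>)\<^sup>2 * (N \<bullet> N)"
      unfolding N_def by (rule thick_tangent[OF thick th unit der nz False])
    then have "(v t)\<^sup>2 * (\<gamma> t \<bullet> M)\<^sup>2 \<le> (v t)\<^sup>2 * ((cos \<theta>)\<^sup>2 * (M \<bullet> M))"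
      unfolding N by (simp add: power_mult_distrib power2_eq_square mult_ac)
    then have le: "(\<gamma> t \<bullet> M)\<^sup>2 \<le> (cos \<theta>)\<^sup>2 * (M \<bullet> M)"
      using vp[of t] by simp
    have "\<gamma> t \<bullet> M = \<gamma> t \<bullet> (\<tau> t \<times> \<gamma> s)"
      by (simp add: M_def Cross3.right_diff_distrib inner_diff_right dot_cross_self)
    also have "\<dots> = c"
      unfolding c_def by (metis cross_triple inner_commute)
    finally have Mc: "\<gamma> t \<bullet> M = c" .
    have abc: "a\<^sup>2 + b\<^sup>2 + c\<^sup>2 = 1"
      using frame_inner[OF unit[of t] tu gt, of "\<gamma> s" "\<gamma> s"] gg
      by (simp add: a_def b_def c_def power2_eq_square)
    have "M \<bullet> M = (\<gamma> s - \<gamma> t) \<bullet> (\<gamma> s - \<gamma> t) - (\<tau> t \<bullet> (\<gamma> s - \<gamma> t))\<^sup>2"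
      using norm_cross[of "\<tau> t" "\<gamma> s - \<gamma> t"] tu[of t] by (simp add: M_def power2_norm_eq_inner norm_eq_1)
    also have "\<dots> = 2 - 2 * a - b\<^sup>2"
      using gg gt[of t] by (simp add: a_def b_def inner_diff inner_commute)
    finally have "M \<bullet> M = (1 - a)\<^sup>2 + c\<^sup>2"
      using abc by (simp add: power2_eq_square algebra_simps)
    then have "c\<^sup>2 \<le> (cos \<theta>)\<^sup>2 * (1 - a)\<^sup>2 + (cos \<theta>)\<^sup>2 * c\<^sup>2"
      using le Mc by (simp add: distrib_left)
    moreover have "c\<^sup>2 = (sin \<theta>)\<^sup>2 * c\<^sup>2 + (cos \<theta>)\<^sup>2 * c\<^sup>2"
      using sin_cos_squared_add[of \<theta>] by (simp flip: distrib_right)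
    ultimately have "(sin \<theta> * \<bar>c\<bar>)\<^sup>2 \<le> (cos \<theta> * (1 - a))\<^sup>2"
      by (simp add: power_mult_distrib)
    moreover have "a \<le> 1"
      unfolding a_def using norm_cauchy_schwarz[of "\<gamma> s" "\<gamma> t"] unit by simp
    then have "0 \<le> cos \<theta> * (1 - a)"
      using cos0 by simp
    ultimately have "sin \<theta> * \<bar>c\<bar> \<le> cos \<theta> * (1 - a)"
      by (rule power2_le_imp_le)
    then show ?thesis
      by (simp add: a_def c_def algebra_simps)
  qed
  have "compact (range \<gamma>)"
    unfolding range_periodic[of \<gamma>, OF per]
    by (intro compact_continuous_image continuous_on_subset[OF gcont]) auto
  moreover have "range \<gamma> \<subseteq> sphere 0 1" using unit by auto
  ultimately have F2: "\<exists>s. cos \<theta> \<le> \<gamma> s \<bullet> \<xi>" if "norm \<xi> = 1" for \<xi>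
    using full_tube_covers[OF _ _ _ th area that] by auto
  have "thick_curve \<theta> \<gamma> \<tau> v"
    by (unfold_locales) (use th unit per vp tu \<tau>cont F1 F2 der D in auto)
  then show ?thesis by blast
qed

section \<open>The great circle case and identification of the curve\<close>

context thick_curve
begin

text \<open>With cosine 0 the touching condition puts the curve into the plane orthogonal to its
  normal. For \<open>x\<close> on that great circle the nearest curve point is \<open>x\<close> or
  \<open>- x\<close>, and in the second case the whole curve would be the single point
  \<open>- x\<close>.\<close>

lemma great_circle_case:
  assumes th: "\<theta> = pi / 2"
  shows "norm (\<gamma> 0 \<times> \<tau> 0) = 1" "range \<gamma> = {x. norm x = 1 \<and> x \<bullet> (\<gamma> 0 \<times> \<tau> 0) = 0}"
proof -
  define c where "c = \<gamma> 0 \<times> \<tau> 0"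
  show c1: "norm (\<gamma> 0 \<times> \<tau> 0) = 1" by (rule norm_nu)
  have perp: "\<gamma> s \<bullet> (\<gamma> t \<times> \<tau> t) = 0" for s t
    using thick[of s t] by (simp add: th)
  have "\<tau> s \<bullet> (\<gamma> t \<times> \<tau> t) = 0" for s t
    by (rule tau_perp_of_max) (simp add: perp)
  then have nu: "\<gamma> t \<times> \<tau> t = c \<or> \<gamma> t \<times> \<tau> t = - c" for t
    using perp_plane_unit[OF unit tau_unit gamma_tau(1), of "\<gamma> t \<times> \<tau> t" 0] perp[of 0 t] norm_nu
    by (simp add: c_def inner_commute)
  have "x \<in> range \<gamma>" if x: "norm x = 1" "x \<bullet> c = 0" for x
  proof -
    have "continuous_on (range \<gamma>) (\<lambda>y. y \<bullet> x)"
      by (intro continuous_intros)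
    then obtain y where y: "y \<in> range \<gamma>" "\<And>z. z \<in> range \<gamma> \<Longrightarrow> z \<bullet> x \<le> y \<bullet> x"
      using continuous_attains_sup[OF compact_range, of "\<lambda>y. y \<bullet> x"] by blast
    obtain T where T: "y = \<gamma> T" using y(1) by auto
    have "\<tau> T \<bullet> x = 0"
      by (rule tau_perp_of_max) (use y T in auto)
    moreover have "x \<bullet> (\<gamma> T \<times> \<tau> T) = 0"
      using nu[of T] x(2) by auto
    ultimately have ex: "x = (x \<bullet> \<gamma> T) *\<^sub>R \<gamma> T"
      using frame_expand[OF unit[of T] tau_unit gamma_tau(1), of x] by (simp add: inner_commute)
    then have "1 = \<bar>x \<bullet> \<gamma> T\<bar>"
      using x(1) unit[of T] by (metis mult.right_neutral norm_scaleR)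
    then have "x \<bullet> \<gamma> T = 1 \<or> x \<bullet> \<gamma> T = -1" by linarith
    moreover have "x \<bullet> \<gamma> T \<noteq> -1"
    proof
      assume m: "x \<bullet> \<gamma> T = -1"
      have same: "\<gamma> s = \<gamma> T" for s
      proof -
        have "\<gamma> s \<bullet> x \<le> -1" using y(2)[of "\<gamma> s"] T m by (simp add: inner_commute)
        then have "\<bar>\<gamma> s \<bullet> x\<bar> \<ge> 1" by linarith
        then have "\<gamma> s = x \<or> \<gamma> s = - x" using abs_inner_unit unit x by blast
        moreover have "\<gamma> s \<noteq> x"
          using \<open>\<gamma> s \<bullet> x \<le> -1\<close> x(1) by (auto simp: norm_eq_1)
        moreover have "x = - \<gamma> T" using ex m by simp
        ultimately show ?thesis by auto
      qed
      have "((\<lambda>s. \<gamma> s \<bullet> \<tau> T) has_real_derivative 0) (at T)"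
        using DERIV_const[of "\<gamma> T \<bullet> \<tau> T" "at T"] same by (metis (no_types, lifting) ext)
      then have "v T * (\<tau> T \<bullet> \<tau> T) = 0"
        using DERIV_unique inner_der by blast
      then show False using v_pos[of T] by simp
    qed
    ultimately have "x = \<gamma> T" using ex by (metis scaleR_one)
    then show ?thesis by blast
  qed
  then show "range \<gamma> = {x. norm x = 1 \<and> x \<bullet> (\<gamma> 0 \<times> \<tau> 0) = 0}"
    using perp[of _ 0] unit by (auto simp: c_def)
qed

lemma range_ropes:
  "\<exists>c w n k. norm c = 1 \<and> norm w = 1 \<and> w \<bullet> c = 0 \<and> 0 < n \<and> k < n \<and>
    \<theta> = pi / (2 * real n) \<and> range \<gamma> = ropes c w n k"
proof (cases "\<theta> = pi / 2")
  case True
  define c where "c = \<gamma> 0 \<times> \<tau> 0"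
  define w where "w = \<gamma> 0"
  have "range \<gamma> = ropes c w 1 0"
    unfolding great_circle_case(2)[OF True] c_def[symmetric] ropes_def by (auto simp: arc_pt_def)
  moreover have "norm c = 1" "norm w = 1" "w \<bullet> c = 0"
    using great_circle_case(1)[OF True] unit by (auto simp: c_def w_def dot_cross_self)
  ultimately show ?thesis
    using True by (intro exI[of _ c] exI[of _ w] exI[of _ "1 :: nat"] exI[of _ "0 :: nat"]) simp
next
  case False
  then have th: "\<theta> < pi / 2" using th_le by simp
  obtain c w where b: "base c w" using exists_base[OF th] by blast
  obtain c2 where b2: "base c2 (- w)" using base_opposite[OF th b] by blast
  obtain n where n: "2 * real n * \<theta> = pi" "n > 0" using base_angle[OF b th] by metis
  have \<theta>: "\<theta> = pi / (2 * real n)" using n by (simp add: field_simps)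
  have c: "norm c = 1" "norm w = 1" "w \<bullet> c = 0" "c \<bullet> w = 0"
    using b by (auto simp: base_def ctr_def inner_commute)
  have c2: "norm c2 = 1" "c2 \<bullet> w = 0"
    using b2 by (auto simp: base_def ctr_def inner_commute)
  define e where "e = c \<times> w"
  have e: "norm e = 1" "e \<bullet> c = 0" "e \<bullet> w = 0"
    unfolding e_def using c by (auto simp: dot_cross_self intro!: norm_cross_orthonormal)
  have ce: "c \<times> e = - w"
    using c unfolding e_def by (simp add: Lagrange norm_eq_1)
  obtain \<phi> where \<phi>: "c2 = arc_pt c e \<phi>"
    using great_circle_param[OF c(1) e(1,2) c2(1)] c2(2) ce by auto
  \<comment> \<open>This boundary point belongs to both closed hemispheres, so its distance from
    \<open>c2\<close> is an odd multiple of \<theta> too; hence \<phi> is an even multiple of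
    \<theta>.\<close>
  have "arc_pt c e \<theta> \<in> range \<gamma>"
    using base_closed_half(1)[OF b th n(1) e(1,2), of 0] e n(2) by simp
  moreover have "arc_pt c e \<theta> \<bullet> (- w) \<ge> 0"
    using c e by (simp add: arc_pt_def inner_add_left)
  ultimately obtain i where i: "i < n" "arc_pt c e \<theta> \<bullet> c2 = cos ((2 * real i + 1) * \<theta>)"
    using base_hemisphere[OF b2 th n(1) norm_arc_pt[OF c(1) e(2,1)]] by blast
  have "cos (\<phi> - \<theta>) = cos ((2 * real i + 1) * \<theta>)"
    using i(2) arc_pt_inner_same[OF c(1) e(2,1), of \<theta> \<phi>] cos_minus[of "\<phi> - \<theta>"] by (simp add: \<phi>)
  then obtain m :: int where m: "\<phi> - \<theta> = (2 * real i + 1) * \<theta> + 2 * pi * of_int m \<or>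
      \<phi> - \<theta> = - ((2 * real i + 1) * \<theta>) + 2 * pi * of_int m"
    using cos_eq_cases by blast
  obtain K :: int where K: "\<phi> = 2 * of_int K * \<theta>"
  proof -
    from m show thesis
    proof
      assume "\<phi> - \<theta> = (2 * real i + 1) * \<theta> + 2 * pi * of_int m"
      then have "\<phi> = 2 * of_int (int i + 1 + 2 * int n * m) * \<theta>"
        unfolding n(1)[symmetric] by (simp add: algebra_simps)
      then show thesis by (rule that)
    next
      assume "\<phi> - \<theta> = - ((2 * real i + 1) * \<theta>) + 2 * pi * of_int m"
      then have "\<phi> = 2 * of_int (- int i + 2 * int n * m) * \<theta>"
        unfolding n(1)[symmetric] by (simp add: algebra_simps)
      then show thesis by (rule that)
    qed
  qed
  \<comment> \<open>Reducing modulo n changes \<phi> by a multiple of pi and may replace the pole by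
    its antipode. The family of parallels is the same for both, by the symmetry i to n - 1 - i shown
    in \<open>refl\<close>.\<close>
  define k where "k = nat (K mod int n)"
  have "real_of_int K = real_of_int (int k + int n * (K div int n))"
    using n(2) by (simp add: k_def)
  then have KK: "real_of_int K = real k + real n * of_int (K div int n)"
    by simp
  have kn: "k < n" using n(2) by (simp add: k_def nat_less_iff)
  define c3 where "c3 = arc_pt c e (2 * real k * \<theta>)"
  have "\<phi> = 2 * real k * \<theta> + of_int (K div int n) * pi"
    unfolding K KK n(1)[symmetric] by (simp add: algebra_simps)
  then have "c2 = (if even (K div int n) then 1 else -1) *\<^sub>R c3"
    unfolding \<phi> c3_def arc_pt_def by (simp add: cos_add sin_add algebra_simps)
  then have c23: "c2 = c3 \<or> c2 = - c3" by auto
  have refl: "\<exists>j<n. - cos ((2 * real i + 1) * \<theta>) = cos ((2 * real j + 1) * \<theta>)" if "i < n" for i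
  proof (intro exI conjI)
    show "n - 1 - i < n" using n(2) by simp
    have r: "real (n - 1 - i) = real n - 1 - real i" using that by simp
    have "(2 * real (n - 1 - i) + 1) * \<theta> = pi - (2 * real i + 1) * \<theta>"
      unfolding r n(1)[symmetric] by (simp add: algebra_simps)
    then show "- cos ((2 * real i + 1) * \<theta>) = cos ((2 * real (n - 1 - i) + 1) * \<theta>)"
      by simp
  qed
  have c3iff: "(\<exists>i<n. x \<bullet> c2 = cos ((2 * real i + 1) * \<theta>)) \<longleftrightarrow>
      (\<exists>i<n. x \<bullet> c3 = cos ((2 * real i + 1) * \<theta>))" for x
    using c23
  proof
    assume "c2 = - c3"
    then have "x \<bullet> c2 = - (x \<bullet> c3)" by simp
    then show ?thesis
      using refl by (metis minus_equation_iff)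
  qed simp
  have "x \<in> range \<gamma> \<longleftrightarrow> x \<in> ropes c w n k" for x
  proof (cases "norm x = 1")
    case True
    have "x \<in> range \<gamma> \<longleftrightarrow> (\<exists>i<n. x \<bullet> c = cos ((2 * real i + 1) * \<theta>))" if "x \<bullet> w \<ge> 0"
      using base_hemisphere[OF b th n(1) True that] .
    moreover have "x \<in> range \<gamma> \<longleftrightarrow> (\<exists>i<n. x \<bullet> c3 = cos ((2 * real i + 1) * \<theta>))" if "x \<bullet> w \<le> 0"
      using base_hemisphere[OF b2 th n(1) True] that c3iff by simp
    moreover have "x \<bullet> w \<ge> 0 \<or> x \<bullet> w \<le> 0" by linarith
    ultimately show ?thesis
      unfolding ropes_def mem_Collect_eq \<theta>[symmetric] e_def[symmetric] c3_def[symmetric]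
      using True by blast
  next
    case False
    then show ?thesis using unit by (auto simp: ropes_def)
  qed
  then have "range \<gamma> = ropes c w n k" by blast
  then show ?thesis
    using c \<theta> n(2) kn by blast
qed

end

lemma ropes_thickness:
  assumes c: "norm c = 1" "norm w = 1" "w \<bullet> c = 0" and n: "n > 0"
  shows "thickness (ropes c w n k) \<le> ereal (sin (pi / (2 * real n)))"
proof (rule thickness_le_three_points[OF c])
  have cw: "c \<bullet> w = 0" "c \<bullet> c = 1" using c by (auto simp: inner_commute norm_eq_1)
  have e: "norm (c \<times> w) = 1" "(c \<times> w) \<bullet> c = 0" "(c \<times> w) \<bullet> w = 0"
    using c cw by (auto simp: dot_cross_self intro!: norm_cross_orthonormal)
  show "0 < pi / (2 * real n)" "pi / (2 * real n) \<le> pi / 2"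
    using n by (auto simp: field_simps)
  have "arc_pt c h (pi / (2 * real n)) \<in> ropes c w n k" if h: "norm h = 1" "h \<bullet> c = 0" "h \<bullet> w \<ge> 0" for h
  proof -
    have "sin (pi / (2 * real n)) \<ge> 0"
      using n by (intro sin_ge_zero) (auto simp: field_simps)
    then have "arc_pt c h (pi / (2 * real n)) \<bullet> w \<ge> 0"
      using h cw by (simp add: arc_pt_def inner_add_left)
    moreover have "arc_pt c h (pi / (2 * real n)) \<bullet> c = cos ((2 * real 0 + 1) * (pi / (2 * real n)))"
      using h cw by (simp add: arc_pt_def inner_add_left)
    ultimately show ?thesis
      using norm_arc_pt[OF c(1) h(2,1)] n unfolding ropes_def by blast
  qed
  then show "arc_pt c w (pi / (2 * real n)) \<in> ropes c w n k"
    "arc_pt c (c \<times> w) (pi / (2 * real n)) \<in> ropes c w n k"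
    "arc_pt c (- (c \<times> w)) (pi / (2 * real n)) \<in> ropes c w n k"
    using c e by auto
qed

theorem theorem3p1:
  fixes \<theta> \<Theta> :: real and \<gamma> :: "real \<Rightarrow> real^3"
  assumes "0 < \<theta>" and "\<theta> \<le> pi / 2"
    and "\<Theta> = sin \<theta>"
    and "closed_spherical_curve \<gamma>"
    and "thickness (range \<gamma>) \<ge> ereal \<Theta>"
    and "sphere_area (spherical_tube \<theta> (range \<gamma>)) = 4 * pi"
  shows "\<exists>n k :: nat. 0 < n \<and> k < n \<and> gcd k n = 1 \<and>
    \<theta> = pi / (2 * real n) \<and>
    thickness (range \<gamma>) = ereal (sin (pi / (2 * real n))) \<and>
    sphere_congruent (range \<gamma>) (gamma_curve n k)"
proof -
  have th: "thickness (range \<gamma>) \<ge> ereal (sin \<theta>)"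
    using assms(3,5) by simp
  obtain \<tau> v where tc: "thick_curve \<theta> \<gamma> \<tau> v"
    using thick_curve_of_closed_curve[OF assms(1,2,4) th assms(6)] by blast
  obtain c w n k where r: "norm c = 1" "norm w = 1" "w \<bullet> c = 0" "0 < n" "k < n"
    "\<theta> = pi / (2 * real n)" "range \<gamma> = ropes c w n k"
    using thick_curve.range_ropes[OF tc] by blast
  have "connected (range \<gamma>)"
    by (rule connected_continuous_image[OF thick_curve.gamma_cont[OF tc]]) simp
  then have "gcd k n = 1"
    using ropes_connected_coprime[OF r(1-4)] r(7) by simp
  moreover have "thickness (range \<gamma>) = ereal (sin (pi / (2 * real n)))"
    using ropes_thickness[OF r(1-4), of k] th r(6,7) by simp
  ultimately show ?thesis
    using r ropes_congruent[OF r(1-3)] by metis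
qed

end
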